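(* Let $d\ge3$, $r,s\in\mathbb{Z}$, let $Z=Z_d$ be the zigzag algebra of finite type $A_{d-1}$, $\widehat Z=\widehat Z_d$ the (signed) affine zigzag algebra, and let $\mathbf M^{\mathcal{E}v_{r,s}}$ be the evaluation birepresentation, whose underlying triangulated category is $K^b(Z\text{-}\mathrm{fgproj})$ (for every $r,s$). Let $X_i:=Ze_i$ for $1\le i\le d-1$ and let $X_0$ be the complex $$X_0:=\bigl(Ze_{d-1}\langle1\rangle\to Ze_{d-2}\langle2\rangle\to\cdots\to Ze_1\langle d-1\rangle\bigr)$$ with $Ze_{d-1}\langle1\rangle$ in homological degree $0$ and the differential out of homological degree $i$ given by right multiplication by $d-i-1\,|\,d-i-2$. Then there is an isomorphism of ungraded algebras $$\mathrm{End}_{\mathbf M^{\mathcal{E}v_{r,s}}}(X_0\oplus X_1\oplus\cdots\oplus X_{d-1})\cong\widehat Z,$$ where $\mathrm{End}_{\mathbf M^{\mathcal{E}v_{r,s}}}(X)=\bigoplus_{i,j\in\mathbb{Z}}\mathrm{Hom}_{K^b(Z\text{-}\mathrm{fgproj})}(X,X\langle i\rangle[j])$ is the total bigraded endomorphism algebra.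
   Context: **Affine zigzag algebra $\widehat Z_d$.** Let $\widehat I=\mathbb{Z}/d\mathbb{Z}=\{0,\dots,d-1\}$ and $I=\{1,\dots,d-1\}$. $\widehat Z_d$ is the quotient of the complex path algebra of the quiver with vertex set $\widehat I$ and one arrow in each direction between $i$ and $i+1$ for all $i\in\widehat I$. $e_i$ are the vertex idempotents, and $i_1|i_2|\cdots|i_k$ denotes the path from $i_k$ to $i_1$ via $i_{k-1},\dots,i_2$ (so $i|j\in e_i\widehat Z_de_j$). Relations: $i|i{+}1|i{+}2=0=i|i{-}1|i{-}2$ for $i\in\widehat I$; $i|i{+}1|i=i|i{-}1|i$ for $i\in I$; $0|1|0=(-1)^d\,(0|d{-}1|0)$. It has dimension $4d$. **Finite zigzag algebra.** $Z=Z_d:=(e_1+\cdots+e_{d-1})\widehat Z_d(e_1+\cdots+e_{d-1})$, which is spanned by $e_i$ and $\ell_i:=i|i{\pm}1|i$ ($i\in I$) and the arrows $i|i\pm1$ between elements of $I$; it is graded by path length. **Modules and complexes.** $Z\text{-}\mathrm{fgproj}$ is the category of finite-dimensional graded projective left $Z$-modules and degree-preserving maps, with $(M\langle1\rangle)_n=M_{n+1}$. $K^b(Z\text{-}\mathrm{fgproj})$ is its homotopy category of bounded complexes, with $(X[k])^n=X^{n+k}$. The product in $\bigoplus_{i,j}\mathrm{Hom}(X,X\langle i\rangle[j])$ is composition of morphisms after applying shifts. **The evaluation birepresentation.** $\mathbf M^{\mathcal{E}v_{r,s}}$ is the birepresentation of the extended affine type $A$ Soergel category obtained by pulling back, through the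 evaluation functor, the triangulated birepresentation of $K^b$ of finite type $A_{d-1}$ Soergel bimodules on $K^b(Z\text{-}\mathrm{fgproj})$ in which $B_i$ acts by $Ze_i\otimes_{\mathbb{C}}e_iZ\langle1\rangle\otimes_Z-$; the statement only concerns morphisms in its underlying category $K^b(Z\text{-}\mathrm{fgproj})$. *)

theory Defs
  imports Complex_Main "HOL-Algebra.QuotRing" "HOL-Algebra.Module"
begin

section \<open>Complex algebras\<close>

text \<open>
  A complex algebra is carried by the record \<^typ>\<open>(complex, 'a) module\<close>, which extends the
  ring record by a scalar multiplication. (The locale \<^locale>\<open>algebra\<close> cannot be used, since
  it requires commutativity.)
\<close>

definition alg_isomorphic ::
    "(complex, 'a, 'x) module_scheme \<Rightarrow> (complex, 'b, 'y) module_scheme \<Rightarrow> bool" where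
  "alg_isomorphic A B \<longleftrightarrow>
    (\<exists>\<phi> \<in> ring_iso A B. \<forall>c. \<forall>x \<in> carrier A. \<phi> (c \<odot>\<^bsub>A\<^esub> x) = c \<odot>\<^bsub>B\<^esub> \<phi> x)"


section \<open>The zigzag algebras\<close>

text \<open>
  The vertices are the integers \<open>0, \<dots>, d - 1\<close>, read modulo \<open>d\<close>. For \<open>d \<ge> 3\<close> an arrow is
  determined by its end points, so the path \<open>i\<^sub>1|i\<^sub>2|\<cdots>|i\<^sub>k\<close> (from \<open>i\<^sub>k\<close> to \<open>i\<^sub>1\<close>) is the list
  \<open>[i\<^sub>1, \<dots>, i\<^sub>k]\<close> of vertices; the idempotent at \<open>i\<close> is \<open>[i]\<close>, and a path of
  length \<open>n\<close> is a list with \<open>n + 1\<close> entries.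
\<close>

definition is_path :: "nat \<Rightarrow> int list \<Rightarrow> bool" where
  "is_path d p \<longleftrightarrow> p \<noteq> [] \<and> set p \<subseteq> {0..<int d} \<and>
    successively (\<lambda>i j. j = (i + 1) mod int d \<or> i = (j + 1) mod int d) p"

text \<open>
  Elements of the path algebra are finitely supported functions on paths. The coefficient of
  a product at the path \<open>p\<close> is the sum over all factorisations of \<open>p\<close> into two composable paths,
  i.e. over all entries of \<open>p\<close>, the chosen entry belonging to both factors.
\<close>

definition path_alg :: "nat \<Rightarrow> (complex, int list \<Rightarrow> complex) module" where
  "path_alg d =
    \<lparr> carrier = {f. finite {p. f p \<noteq> 0} \<and> (\<forall>p. f p \<noteq> 0 \<longrightarrow> is_path d p)},
      mult = (\<lambda>f g p. \<Sum>k<length p. f (take (Suc k) p) * g (drop k p)),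
      one = (\<lambda>p. if \<exists>i \<in> {0..<int d}. p = [i] then 1 else 0),
      zero = (\<lambda>p. 0),
      add = (\<lambda>f g p. f p + g p),
      smult = (\<lambda>c f p. c * f p) \<rparr>"

definition path_elem :: "int list \<Rightarrow> int list \<Rightarrow> complex" where
  "path_elem p = (\<lambda>q. if q = p then 1 else 0)"

definition zigzag_rels :: "nat \<Rightarrow> (int list \<Rightarrow> complex) set" where
  "zigzag_rels d =
     {path_elem [i, (i + 1) mod int d, (i + 2) mod int d] | i. i \<in> {0..<int d}} \<union>
     {path_elem [i, (i - 1) mod int d, (i - 2) mod int d] | i. i \<in> {0..<int d}} \<union>
     {path_elem [i, (i + 1) mod int d, i] \<ominus>\<^bsub>path_alg d\<^esub> path_elem [i, (i - 1) mod int d, i]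
        | i. i \<in> {1..<int d}} \<union>
     {path_elem [0, 1, 0] \<ominus>\<^bsub>path_alg d\<^esub> ((-1) ^ d \<odot>\<^bsub>path_alg d\<^esub> path_elem [0, int d - 1, 0])}"

definition zigzag_ideal :: "nat \<Rightarrow> (int list \<Rightarrow> complex) set" where
  "zigzag_ideal d = Idl\<^bsub>path_alg d\<^esub> (zigzag_rels d)"

type_synonym zz = "(int list \<Rightarrow> complex) set"

definition affine_zigzag :: "nat \<Rightarrow> (complex, zz) module" where
  "affine_zigzag d =
    (let Q = path_alg d Quot zigzag_ideal d in
     \<lparr> carrier = carrier Q, mult = mult Q, one = one Q, zero = zero Q, add = add Q,
       smult = (\<lambda>c S. \<Union>f\<in>S. zigzag_ideal d +>\<^bsub>path_alg d\<^esub> (c \<odot>\<^bsub>path_alg d\<^esub> f)) \<rparr>)"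

definition pth :: "nat \<Rightarrow> int list \<Rightarrow> zz" where
  "pth d p = zigzag_ideal d +>\<^bsub>path_alg d\<^esub> path_elem p"

text \<open>
  Graded algebras and graded modules share one record: the field \<open>homog\<close> gives the homogeneous
  components. As usual for modules in HOL-Algebra, the fields \<open>mult\<close> and \<open>one\<close> of a module
  carry no information.
\<close>

record ('a, 'm) graded = "('a, 'm) module" +
  homog :: "int \<Rightarrow> 'm set"

definition finite_zigzag :: "nat \<Rightarrow> (complex, zz) graded" where
  "finite_zigzag d =
    (let A = affine_zigzag d; e = (\<Oplus>\<^bsub>A\<^esub> i \<in> {1..<int d}. pth d [i]);
         Z = {e \<otimes>\<^bsub>A\<^esub> x \<otimes>\<^bsub>A\<^esub> e | x. x \<in> carrier A} in
     \<lparr> carrier = Z, mult = mult A, one = e, zero = zero A, add = add A, smult = smult A,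
       homog = (\<lambda>n. Z \<inter> {zigzag_ideal d +>\<^bsub>path_alg d\<^esub> f | f.
          f \<in> carrier (path_alg d) \<and> (\<forall>p. f p \<noteq> 0 \<longrightarrow> int (length p) = n + 1)}) \<rparr>)"


section \<open>Graded projective modules\<close>

locale graded_left_module = R?: ring A + M?: abelian_group M
  for A :: "(complex, 'a) graded" (structure) and M :: "('a, 'm) graded" (structure) +
  assumes smult_closed:
      "\<lbrakk>a \<in> carrier A; x \<in> carrier M\<rbrakk> \<Longrightarrow> a \<odot>\<^bsub>M\<^esub> x \<in> carrier M"
    and smult_l_distr:
      "\<lbrakk>a \<in> carrier A; b \<in> carrier A; x \<in> carrier M\<rbrakk> \<Longrightarrow>
        (a \<oplus>\<^bsub>A\<^esub> b) \<odot>\<^bsub>M\<^esub> x = a \<odot>\<^bsub>M\<^esub> x \<oplus>\<^bsub>M\<^esub> b \<odot>\<^bsub>M\<^esub> x"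
    and smult_r_distr:
      "\<lbrakk>a \<in> carrier A; x \<in> carrier M; y \<in> carrier M\<rbrakk> \<Longrightarrow>
        a \<odot>\<^bsub>M\<^esub> (x \<oplus>\<^bsub>M\<^esub> y) = a \<odot>\<^bsub>M\<^esub> x \<oplus>\<^bsub>M\<^esub> a \<odot>\<^bsub>M\<^esub> y"
    and smult_assoc:
      "\<lbrakk>a \<in> carrier A; b \<in> carrier A; x \<in> carrier M\<rbrakk> \<Longrightarrow>
        (a \<otimes>\<^bsub>A\<^esub> b) \<odot>\<^bsub>M\<^esub> x = a \<odot>\<^bsub>M\<^esub> (b \<odot>\<^bsub>M\<^esub> x)"
    and smult_one:
      "x \<in> carrier M \<Longrightarrow> \<one>\<^bsub>A\<^esub> \<odot>\<^bsub>M\<^esub> x = x"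
    and homog_subgroup:
      "additive_subgroup (homog M n) M"
    and homog_smult:
      "\<lbrakk>a \<in> homog A m; x \<in> homog M n\<rbrakk> \<Longrightarrow> a \<odot>\<^bsub>M\<^esub> x \<in> homog M (m + n)"
    and homog_decomposition:
      "x \<in> carrier M \<Longrightarrow>
        \<exists>!c. (\<forall>n. c n \<in> homog M n) \<and> finite {n. c n \<noteq> \<zero>\<^bsub>M\<^esub>} \<and>
          x = (\<Oplus>\<^bsub>M\<^esub> n \<in> {n. c n \<noteq> \<zero>\<^bsub>M\<^esub>}. c n)"

definition gr_hom ::
    "(complex, 'a) graded \<Rightarrow> ('a, 'm) graded \<Rightarrow> ('a, 'n) graded \<Rightarrow> ('m \<Rightarrow> 'n) set" where
  "gr_hom A M N = {f \<in> carrier M \<rightarrow>\<^sub>E carrier N.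
     (\<forall>x \<in> carrier M. \<forall>y \<in> carrier M. f (x \<oplus>\<^bsub>M\<^esub> y) = f x \<oplus>\<^bsub>N\<^esub> f y) \<and>
     (\<forall>a \<in> carrier A. \<forall>x \<in> carrier M. f (a \<odot>\<^bsub>M\<^esub> x) = a \<odot>\<^bsub>N\<^esub> f x) \<and>
     (\<forall>n. f ` homog M n \<subseteq> homog N n)}"

definition mshift :: "int \<Rightarrow> ('a, 'm) graded \<Rightarrow> ('a, 'm) graded" where
  "mshift k M = M\<lparr>homog := (\<lambda>n. homog M (n + k))\<rparr>"

definition zero_module :: "(complex, 'a) graded \<Rightarrow> ('a, 'a) graded" where
  "zero_module A =
    \<lparr> carrier = {\<zero>\<^bsub>A\<^esub>}, mult = undefined, one = undefined, zero = \<zero>\<^bsub>A\<^esub>,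
      add = (\<lambda>x y. \<zero>\<^bsub>A\<^esub>), smult = (\<lambda>a x. \<zero>\<^bsub>A\<^esub>), homog = (\<lambda>n. {\<zero>\<^bsub>A\<^esub>}) \<rparr>"

text \<open>The graded left module \<open>Ae\<close>, for a homogeneous idempotent \<open>e\<close> of degree \<open>0\<close>.\<close>

definition left_mod :: "(complex, 'a) graded \<Rightarrow> 'a \<Rightarrow> ('a, 'a) graded" where
  "left_mod A e =
    (let C = {x \<otimes>\<^bsub>A\<^esub> e | x. x \<in> carrier A} in
     \<lparr> carrier = C, mult = undefined, one = undefined, zero = \<zero>\<^bsub>A\<^esub>,
       add = add A, smult = mult A, homog = (\<lambda>n. homog A n \<inter> C) \<rparr>)"

definition msum :: "'i set \<Rightarrow> ('i \<Rightarrow> ('a, 'm) graded) \<Rightarrow> ('a, 'i \<Rightarrow> 'm) graded" where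
  "msum I M =
    \<lparr> carrier = (\<Pi>\<^sub>E i\<in>I. carrier (M i)), mult = undefined, one = undefined,
      zero = (\<lambda>i\<in>I. \<zero>\<^bsub>M i\<^esub>),
      add = (\<lambda>x y. \<lambda>i\<in>I. x i \<oplus>\<^bsub>M i\<^esub> y i),
      smult = (\<lambda>a x. \<lambda>i\<in>I. a \<odot>\<^bsub>M i\<^esub> x i),
      homog = (\<lambda>n. \<Pi>\<^sub>E i\<in>I. homog (M i) n) \<rparr>"

text \<open>
  The lifting property would quantify over modules on all types, so projectivity is expressed by
  being a graded direct summand of a finite direct sum of shifts of the regular module.
\<close>

definition fin_dim :: "(complex, 'a) graded \<Rightarrow> ('a, 'm) graded \<Rightarrow> bool" where
  "fin_dim A M \<longleftrightarrow> (\<exists>B. finite B \<and> B \<subseteq> carrier M \<and>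
     (\<forall>x \<in> carrier M. \<exists>c. x = (\<Oplus>\<^bsub>M\<^esub> b \<in> B. (c b \<odot>\<^bsub>A\<^esub> \<one>\<^bsub>A\<^esub>) \<odot>\<^bsub>M\<^esub> b)))"

definition gr_projective :: "(complex, 'a) graded \<Rightarrow> ('a, 'm) graded \<Rightarrow> bool" where
  "gr_projective A M \<longleftrightarrow>
    (\<exists>(n::nat) (k :: nat \<Rightarrow> int).
       let F = msum {..<n} (\<lambda>j. mshift (k j) (left_mod A \<one>\<^bsub>A\<^esub>)) in
       \<exists>\<iota> \<in> gr_hom A M F. \<exists>\<pi> \<in> gr_hom A F M. \<forall>x \<in> carrier M. \<pi> (\<iota> x) = x)"

definition fgproj :: "(complex, 'a) graded \<Rightarrow> ('a, 'm) graded \<Rightarrow> bool" where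
  "fgproj A M \<longleftrightarrow> graded_left_module A M \<and> fin_dim A M \<and> gr_projective A M"


section \<open>The bounded homotopy category\<close>

record ('a, 'm) cochain =
  obj :: "int \<Rightarrow> ('a, 'm) graded"
  diff :: "int \<Rightarrow> 'm \<Rightarrow> 'm"

definition Kb_obj :: "(complex, 'a) graded \<Rightarrow> ('a, 'm) cochain \<Rightarrow> bool" where
  "Kb_obj A X \<longleftrightarrow>
     (\<forall>n. fgproj A (obj X n)) \<and>
     finite {n. carrier (obj X n) \<noteq> {\<zero>\<^bsub>obj X n\<^esub>}} \<and>
     (\<forall>n. diff X n \<in> gr_hom A (obj X n) (obj X (n + 1))) \<and>
     (\<forall>n. \<forall>x \<in> carrier (obj X n). diff X (n + 1) (diff X n x) = \<zero>\<^bsub>obj X (n + 2)\<^esub>)"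

text \<open>
  The grading shift \<open>X\<langle>k\<rangle>\<close> and the homological shift \<open>X[k]\<close>; the latter multiplies the
  differential by \<open>(-1)\<^sup>k\<close>. On underlying maps, \<open>f\<langle>k\<rangle>\<close> is \<open>f\<close> and \<open>f[k]\<^sup>n = f\<^sup>n\<^sup>+\<^sup>k\<close>.
\<close>

definition grshift :: "int \<Rightarrow> ('a, 'm) cochain \<Rightarrow> ('a, 'm) cochain" where
  "grshift k X = \<lparr> obj = (\<lambda>n. mshift k (obj X n)), diff = diff X \<rparr>"

definition hshift :: "int \<Rightarrow> ('a, 'm) cochain \<Rightarrow> ('a, 'm) cochain" where
  "hshift k X =
    \<lparr> obj = (\<lambda>n. obj X (n + k)),
      diff = (\<lambda>n. if even k then diff X (n + k)
        else (\<lambda>x \<in> carrier (obj X (n + k)). \<ominus>\<^bsub>obj X (n + k + 1)\<^esub> diff X (n + k) x)) \<rparr>"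

definition chain_maps ::
    "(complex, 'a) graded \<Rightarrow> ('a, 'm) cochain \<Rightarrow> ('a, 'n) cochain \<Rightarrow> (int \<Rightarrow> 'm \<Rightarrow> 'n) set" where
  "chain_maps A X Y = {f. \<forall>n. f n \<in> gr_hom A (obj X n) (obj Y n) \<and>
     (\<forall>x \<in> carrier (obj X n). f (n + 1) (diff X n x) = diff Y n (f n x))}"

definition htpy_rel ::
    "(complex, 'a) graded \<Rightarrow> ('a, 'm) cochain \<Rightarrow> ('a, 'n) cochain \<Rightarrow>
      ((int \<Rightarrow> 'm \<Rightarrow> 'n) \<times> (int \<Rightarrow> 'm \<Rightarrow> 'n)) set" where
  "htpy_rel A X Y = {(f, g). f \<in> chain_maps A X Y \<and> g \<in> chain_maps A X Y \<and>
     (\<exists>h. \<forall>n. h n \<in> gr_hom A (obj X n) (obj Y (n - 1)) \<and>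
       (\<forall>x \<in> carrier (obj X n).
          f n x \<ominus>\<^bsub>obj Y n\<^esub> g n x = diff Y (n - 1) (h n x) \<oplus>\<^bsub>obj Y n\<^esub> h (n + 1) (diff X n x)))}"

text \<open>
  The complex vector space of morphisms from \<open>X\<close> to \<open>Y\<close> in \<open>K\<^sup>b(A-fgproj)\<close>; there are none
  unless \<open>X\<close> and \<open>Y\<close> are objects of that category.
\<close>

definition Kb_Hom ::
    "(complex, 'a) graded \<Rightarrow> ('a, 'm) cochain \<Rightarrow> ('a, 'n) cochain \<Rightarrow>
      (complex, (int \<Rightarrow> 'm \<Rightarrow> 'n) set) module" where
  "Kb_Hom A X Y =
    \<lparr> carrier = {F. Kb_obj A X \<and> Kb_obj A Y \<and> F \<in> chain_maps A X Y // htpy_rel A X Y},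
      mult = undefined, one = undefined,
      zero = htpy_rel A X Y `` {\<lambda>n. \<lambda>x \<in> carrier (obj X n). \<zero>\<^bsub>obj Y n\<^esub>},
      add = (\<lambda>F G. \<Union>f\<in>F. \<Union>g\<in>G.
        htpy_rel A X Y `` {\<lambda>n. \<lambda>x \<in> carrier (obj X n). f n x \<oplus>\<^bsub>obj Y n\<^esub> g n x}),
      smult = (\<lambda>c F. \<Union>f\<in>F.
        htpy_rel A X Y `` {\<lambda>n. \<lambda>x \<in> carrier (obj X n). (c \<odot>\<^bsub>A\<^esub> \<one>\<^bsub>A\<^esub>) \<odot>\<^bsub>obj Y n\<^esub> f n x}) \<rparr>"

definition Kb_id :: "(complex, 'a) graded \<Rightarrow> ('a, 'm) cochain \<Rightarrow> (int \<Rightarrow> 'm \<Rightarrow> 'm) set" where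
  "Kb_id A X = htpy_rel A X X `` {\<lambda>n. \<lambda>x \<in> carrier (obj X n). x}"

text \<open>The composite \<open>G \<circ> F\<close>, a class of chain maps from \<open>X\<close> to \<open>Y\<close>.\<close>

definition Kb_comp ::
    "(complex, 'a) graded \<Rightarrow> ('a, 'm) cochain \<Rightarrow> ('a, 'n) cochain \<Rightarrow>
      (int \<Rightarrow> 'k \<Rightarrow> 'n) set \<Rightarrow> (int \<Rightarrow> 'm \<Rightarrow> 'k) set \<Rightarrow> (int \<Rightarrow> 'm \<Rightarrow> 'n) set" where
  "Kb_comp A X Y G F =
    (\<Union>g\<in>G. \<Union>f\<in>F. htpy_rel A X Y `` {\<lambda>n. compose (carrier (obj X n)) (g n) (f n)})"

text \<open>
  The total endomorphism algebra \<open>\<Oplus>\<^sub>i\<^sub>,\<^sub>j Hom(X, X\<langle>i\<rangle>[j])\<close>. The product of \<open>G\<close> and \<open>F\<close> is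
  composition after shifting: its component in bidegree \<open>(i, j)\<close> is the sum over the
  bidegrees \<open>(a, b)\<close> of the composites \<open>G\<^sub>i\<^sub>-\<^sub>a\<^sub>,\<^sub>j\<^sub>-\<^sub>b\<langle>a\<rangle>[b] \<circ> F\<^sub>a\<^sub>,\<^sub>b\<close>.
\<close>

definition bishift :: "int \<Rightarrow> int \<Rightarrow> ('a, 'm) cochain \<Rightarrow> ('a, 'm) cochain" where
  "bishift i j X = hshift j (grshift i X)"

definition Kb_End ::
    "(complex, 'a) graded \<Rightarrow> ('a, 'm) cochain \<Rightarrow>
      (complex, int \<Rightarrow> int \<Rightarrow> (int \<Rightarrow> 'm \<Rightarrow> 'm) set) module" where
  "Kb_End A X =
    (let H = (\<lambda>i j. Kb_Hom A X (bishift i j X)) in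
     \<lparr> carrier = {F. (\<forall>i j. F i j \<in> carrier (H i j)) \<and> finite {(i, j). F i j \<noteq> \<zero>\<^bsub>H i j\<^esub>}},
       mult = (\<lambda>G F i j. finsum (H i j)
         (\<lambda>(a, b). Kb_comp A X (bishift i j X)
            ((\<lambda>g n. g (n + b)) ` G (i - a) (j - b)) (F a b))
         {(a, b). F a b \<noteq> \<zero>\<^bsub>H a b\<^esub>}),
       one = (\<lambda>i j. if i = 0 \<and> j = 0 then Kb_id A X else \<zero>\<^bsub>H i j\<^esub>),
       zero = (\<lambda>i j. \<zero>\<^bsub>H i j\<^esub>),
       add = (\<lambda>F G i j. F i j \<oplus>\<^bsub>H i j\<^esub> G i j),
       smult = (\<lambda>c F i j. c \<odot>\<^bsub>H i j\<^esub> F i j) \<rparr>)"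

definition csum :: "'i set \<Rightarrow> ('i \<Rightarrow> ('a, 'm) cochain) \<Rightarrow> ('a, 'i \<Rightarrow> 'm) cochain" where
  "csum I X =
    \<lparr> obj = (\<lambda>n. msum I (\<lambda>i. obj (X i) n)),
      diff = (\<lambda>n. \<lambda>x \<in> carrier (msum I (\<lambda>i. obj (X i) n)). \<lambda>i\<in>I. diff (X i) n (x i)) \<rparr>"


section \<open>The complexes \<open>X\<^sub>0, \<dots>, X\<^sub>d\<^sub>-\<^sub>1\<close>\<close>

abbreviation Ze :: "nat \<Rightarrow> int \<Rightarrow> (zz, zz) graded" where
  "Ze d i \<equiv> left_mod (finite_zigzag d) (pth d [i])"

definition X_pos :: "nat \<Rightarrow> int \<Rightarrow> (zz, zz) cochain" where
  "X_pos d i =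
    (let M = (\<lambda>n::int. if n = 0 then Ze d i else zero_module (finite_zigzag d)) in
     \<lparr> obj = M, diff = (\<lambda>n. \<lambda>x \<in> carrier (M n). \<zero>\<^bsub>M (n + 1)\<^esub>) \<rparr>)"

definition X_zero :: "nat \<Rightarrow> (zz, zz) cochain" where
  "X_zero d =
    (let M = (\<lambda>n::int. if 0 \<le> n \<and> n \<le> int d - 2 then mshift (n + 1) (Ze d (int d - 1 - n))
                       else zero_module (finite_zigzag d)) in
     \<lparr> obj = M,
       diff = (\<lambda>n. \<lambda>x \<in> carrier (M n).
         if 0 \<le> n \<and> n < int d - 2
         then x \<otimes>\<^bsub>finite_zigzag d\<^esub> pth d [int d - n - 1, int d - n - 2]
         else \<zero>\<^bsub>M (n + 1)\<^esub>) \<rparr>)"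

definition X_cplx :: "nat \<Rightarrow> int \<Rightarrow> (zz, zz) cochain" where
  "X_cplx d i = (if i = 0 then X_zero d else X_pos d i)"

text \<open>
  Endomorphism algebras in the evaluation birepresentation with parameters \<open>r, s\<close>. Its
  underlying triangulated category is \<open>K\<^sup>b(Z-fgproj)\<close> for all \<open>r\<close> and \<open>s\<close>: the parameters only
  affect the action of the Soergel bimodules, which does not enter the algebra of morphisms.
\<close>

definition Ev_End :: "nat \<Rightarrow> int \<Rightarrow> int \<Rightarrow> (zz, 'm) cochain \<Rightarrow>
    (complex, int \<Rightarrow> int \<Rightarrow> (int \<Rightarrow> 'm \<Rightarrow> 'm) set) module" where
  "Ev_End d r s X = Kb_End (finite_zigzag d) X"

end

theory Submission
  imports Defs
begin

text \<open>
  A path of length at least 3 vanishes in the affine zigzag algebra, so its elements are given by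
  coordinates at triples (end, start, length). On the other side, each complex \<open>X\<^sub>i\<close> is built from
  shifts of the modules \<open>Ze\<^sub>v\<close>, and there is at most one nonzero path of \<open>Z\<close> of given end points and length. Hence a
  graded homomorphism between the terms is a matrix of complex numbers, and the chain condition and
  the homotopy relation become linear recursions for these numbers. The resulting cohomology has one
  generator for each triple: on the block \<open>X\<^sub>0 \<rightarrow> X\<^sub>0\<close> the loops at consecutive terms
  are homotopic up to the sign \<open>-1\<close>, so the \<open>d - 2\<close> steps from \<open>Ze\<^sub>1\<close> to \<open>Ze\<^sub>d\<^sub>-\<^sub>1\<close> produce the sign
  \<open>(-1)\<^sup>d\<close> of the relation at the vertex 0. Assigning to a path from \<open>k\<close> to \<open>l\<close> the corresponding
  map \<open>X\<^sub>k \<rightarrow> X\<^sub>l\<close> is then the isomorphism.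
\<close>

section \<open>The path algebra\<close>

text \<open>Two conventions decide the form of the isomorphism. A map from Ze_k to Ze_l is right
  multiplication by an element of e_k Z e_l, so the coefficient of an affine path from k to l is
  attached to the reversed path of Z. Right multiplication inverts products and reversal inverts
  them again, so no opposite algebra appears. The bidegrees, however, are not path lengths: 0|1
  becomes the identity of Ze_1 into the last term of X_0, in bidegree (1 - d, d - 2), and 1|0
  becomes the loop at 1 out of that term, in bidegree (d + 1, 2 - d). Only the sum (2, 0) is that of
  a loop, whence an isomorphism of ungraded algebras. The obstacle is that both algebras consist of
  sets: cosets of an ideal, and homotopy classes of families of functions. Each is replaced by a
  complete linear invariant with values in \<open>coord_fun\<close>, namely
  \<open>path_coord\<close> and \<open>symb\<close>, together with an explicit section,
  \<open>path_rep\<close> and \<open>canon\<close>; both products then have to be identified with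
  \<open>coord_mult\<close>.\<close>

lemma path_alg_sel:
  "carrier (path_alg d) = {f. finite {p. f p \<noteq> 0} \<and> (\<forall>p. f p \<noteq> 0 \<longrightarrow> is_path d p)}"
  "f \<otimes>\<^bsub>path_alg d\<^esub> g = (\<lambda>p. \<Sum>k<length p. f (take (Suc k) p) * g (drop k p))"
  "\<one>\<^bsub>path_alg d\<^esub> = (\<lambda>p. if \<exists>i \<in> {0..<int d}. p = [i] then 1 else 0)"
  "\<zero>\<^bsub>path_alg d\<^esub> = (\<lambda>p. 0)"
  "f \<oplus>\<^bsub>path_alg d\<^esub> g = (\<lambda>p. f p + g p)"
  "c \<odot>\<^bsub>path_alg d\<^esub> f = (\<lambda>p. c * f p)"
  by (simp_all add: path_alg_def)

definition path_fun :: "nat \<Rightarrow> (int list \<Rightarrow> complex) \<Rightarrow> bool" where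
  "path_fun d f \<longleftrightarrow> finite {p. f p \<noteq> 0} \<and> (\<forall>p. f p \<noteq> 0 \<longrightarrow> is_path d p)"

lemma carrier_path_alg: "f \<in> carrier (path_alg d) \<longleftrightarrow> path_fun d f"
  by (simp add: path_alg_sel path_fun_def)

lemma is_path_append:
  assumes "is_path d p" "is_path d q" "last p = hd q"
  shows "is_path d (p @ tl q)"
proof -
  obtain x qs where q: "q = x # qs" using assms(2) by (cases q) (auto simp: is_path_def)
  show ?thesis using assms
    by (cases qs) (auto simp: is_path_def q successively_append_iff)
qed

lemma path_mult_support:
  assumes "(\<Sum>k<length p. f (take (Suc k) p) * g (drop k p)) \<noteq> (0::complex)"
  shows "\<exists>a b. f a \<noteq> 0 \<and> g b \<noteq> 0 \<and> a \<noteq> [] \<and> b \<noteq> [] \<and> last a = hd b \<and> p = a @ tl b"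
proof -
  obtain k where k: "k < length p" "f (take (Suc k) p) * g (drop k p) \<noteq> 0"
    using assms by (meson lessThan_iff sum.not_neutral_contains_not_neutral)
  have "last (take (Suc k) p) = hd (drop k p)"
    using k(1) by (simp add: take_Suc_conv_app_nth hd_drop_conv_nth)
  moreover have "p = take (Suc k) p @ tl (drop k p)"
    by (simp add: drop_Suc[symmetric] tl_drop del: append_take_drop_id) (metis append_take_drop_id drop_Suc tl_drop)
  ultimately show ?thesis using k by (intro exI[of _ "take (Suc k) p"] exI[of _ "drop k p"]) auto
qed

lemma path_fun_mult:
  assumes "path_fun d f" "path_fun d g"
  shows "path_fun d (\<lambda>p. \<Sum>k<length p. f (take (Suc k) p) * g (drop k p))"
  unfolding path_fun_def
proof
  have "{p. (\<Sum>k<length p. f (take (Suc k) p) * g (drop k p)) \<noteq> 0} \<subseteq>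
     (\<lambda>(a,b). a @ tl b) ` ({p. f p \<noteq> 0} \<times> {p. g p \<noteq> 0})"
  proof safe
    fix p assume "(\<Sum>k<length p. f (take (Suc k) p) * g (drop k p)) \<noteq> 0"
    then obtain a b where "f a \<noteq> 0" "g b \<noteq> 0" "p = a @ tl b" using path_mult_support by blast
    then show "p \<in> (\<lambda>(a,b). a @ tl b) ` ({p. f p \<noteq> 0} \<times> {p. g p \<noteq> 0})"
      by (intro image_eqI[of _ _ "(a,b)"]) auto
  qed
  then show "finite {p. (\<Sum>k<length p. f (take (Suc k) p) * g (drop k p)) \<noteq> 0}"
    by (rule finite_subset) (use assms in \<open>auto simp: path_fun_def\<close>)
  show "\<forall>p. (\<Sum>k<length p. f (take (Suc k) p) * g (drop k p)) \<noteq> 0 \<longrightarrow> is_path d p"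
  proof safe
    fix p assume "(\<Sum>k<length p. f (take (Suc k) p) * g (drop k p)) \<noteq> 0"
    then obtain a b where "f a \<noteq> 0" "g b \<noteq> 0" "last a = hd b" "p = a @ tl b"
      using path_mult_support by blast
    then show "is_path d p" using is_path_append assms unfolding path_fun_def by blast
  qed
qed

text \<open>Serves associativity: both bracketings of a triple product sum over two cuts j <= k of a
  path. The left side lists them by the later cut, the right side by the earlier cut j and the
  distance m to the later one.\<close>

lemma sum_triangle_swap:
  fixes F :: "nat \<Rightarrow> nat \<Rightarrow> complex"
  shows "(\<Sum>k<n. \<Sum>j<Suc k. F j k) = (\<Sum>j<n. \<Sum>m<n - j. F j (j + m))"
proof -
  have "(\<Sum>j<n. \<Sum>m<n - j. F j (j + m)) = (\<Sum>j<n. \<Sum>k\<in>{j..<n}. F j k)"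
  proof (rule sum.cong[OF refl])
    fix j assume "j \<in> {..<n}"
    show "(\<Sum>m<n - j. F j (j + m)) = (\<Sum>k\<in>{j..<n}. F j k)"
      by (rule sum.reindex_bij_witness[of _ "\<lambda>k. k - j" "\<lambda>m. j + m"]) auto
  qed
  also have "\<dots> = (\<Sum>k<n. \<Sum>j<Suc k. F j k)"
    unfolding sum.Sigma[OF finite_lessThan ballI[OF finite_atLeastLessThan]]
      sum.Sigma[OF finite_lessThan ballI[OF finite_lessThan]]
    by (rule sum.reindex_bij_witness[of _ "\<lambda>(a,b). (b,a)" "\<lambda>(a,b). (b,a)"]) auto
  finally show ?thesis by simp
qed

lemma ring_path_alg: "ring (path_alg d)"
proof (rule ringI)
  show "abelian_group (path_alg d)"
  proof (rule abelian_groupI)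
    fix x y assume "x \<in> carrier (path_alg d)" "y \<in> carrier (path_alg d)"
    then have x: "path_fun d x" and y: "path_fun d y" by (auto simp: carrier_path_alg)
    have "{p. x p + y p \<noteq> 0} \<subseteq> {p. x p \<noteq> 0} \<union> {p. y p \<noteq> 0}" by auto
    then show "x \<oplus>\<^bsub>path_alg d\<^esub> y \<in> carrier (path_alg d)"
      using x y by (auto simp: carrier_path_alg path_alg_sel path_fun_def intro: finite_subset) 
  next
    fix x assume "x \<in> carrier (path_alg d)"
    then show "\<exists>y\<in>carrier (path_alg d). y \<oplus>\<^bsub>path_alg d\<^esub> x = \<zero>\<^bsub>path_alg d\<^esub>"
      by (intro bexI[of _ "\<lambda>p. - x p"]) (auto simp: path_alg_sel)
  qed (auto simp: path_alg_sel algebra_simps)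
  show "monoid (path_alg d)"
  proof (rule monoidI)
    fix x y assume "x \<in> carrier (path_alg d)" "y \<in> carrier (path_alg d)"
    then show "x \<otimes>\<^bsub>path_alg d\<^esub> y \<in> carrier (path_alg d)"
      using path_fun_mult[of d x y] by (simp add: carrier_path_alg path_alg_sel(2))
  next
    show "\<one>\<^bsub>path_alg d\<^esub> \<in> carrier (path_alg d)"
    proof -
      have "{p. (if \<exists>i \<in> {0..<int d}. p = [i] then 1 else 0) \<noteq> (0::complex)} \<subseteq> (\<lambda>i. [i]) ` {0..<int d}"
        by auto
      then show ?thesis
        by (auto simp: carrier_path_alg path_alg_sel path_fun_def is_path_def intro: finite_subset)
    qed
  next
    fix x y z
    show "x \<otimes>\<^bsub>path_alg d\<^esub> y \<otimes>\<^bsub>path_alg d\<^esub> z = x \<otimes>\<^bsub>path_alg d\<^esub> (y \<otimes>\<^bsub>path_alg d\<^esub> z)"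
    proof
      fix p :: "int list"
      have "(x \<otimes>\<^bsub>path_alg d\<^esub> y \<otimes>\<^bsub>path_alg d\<^esub> z) p =
        (\<Sum>k<length p. \<Sum>j<Suc k. x (take (Suc j) p) * y (drop j (take (Suc k) p)) * z (drop k p))"
        unfolding path_alg_sel sum_distrib_right
        by (intro sum.cong refl) (auto simp: min_def less_Suc_eq_le)
      also have "\<dots> = (\<Sum>j<length p. \<Sum>m<length p - j.
          x (take (Suc j) p) * y (drop j (take (Suc (j + m)) p)) * z (drop (j + m) p))"
        by (rule sum_triangle_swap)
      also have "\<dots> = (x \<otimes>\<^bsub>path_alg d\<^esub> (y \<otimes>\<^bsub>path_alg d\<^esub> z)) p"
        unfolding path_alg_sel sum_distrib_left
        by (intro sum.cong refl) (auto simp: drop_take add.commute mult.assoc Suc_diff_le)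
      finally show "(x \<otimes>\<^bsub>path_alg d\<^esub> y \<otimes>\<^bsub>path_alg d\<^esub> z) p =
        (x \<otimes>\<^bsub>path_alg d\<^esub> (y \<otimes>\<^bsub>path_alg d\<^esub> z)) p" .
    qed
  next
    fix x assume "x \<in> carrier (path_alg d)"
    then have x: "x p \<noteq> 0 \<Longrightarrow> is_path d p" for p by (auto simp: path_alg_sel)
    show "\<one>\<^bsub>path_alg d\<^esub> \<otimes>\<^bsub>path_alg d\<^esub> x = x"
    proof
      fix p
      show "(\<one>\<^bsub>path_alg d\<^esub> \<otimes>\<^bsub>path_alg d\<^esub> x) p = x p"
      proof (cases p)
        case Nil then show ?thesis using x[of "[]"] by (auto simp: path_alg_sel is_path_def)
      next
        case (Cons a q)
        have "(\<one>\<^bsub>path_alg d\<^esub> \<otimes>\<^bsub>path_alg d\<^esub> x) p = (\<Sum>k<length p. if k = 0 then x p else 0)"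
          unfolding path_alg_sel using x[of p]
          by (intro sum.cong refl) (auto simp: Cons is_path_def)
        then show ?thesis using Cons by (simp add: sum.delta)
      qed
    qed
    show "x \<otimes>\<^bsub>path_alg d\<^esub> \<one>\<^bsub>path_alg d\<^esub> = x"
    proof
      fix p
      show "(x \<otimes>\<^bsub>path_alg d\<^esub> \<one>\<^bsub>path_alg d\<^esub>) p = x p"
      proof (cases p rule: rev_cases)
        case Nil then show ?thesis using x[of "[]"] by (auto simp: path_alg_sel is_path_def)
      next
        case (snoc q a)
        have *: "(\<exists>i\<in>{0..<int d}. drop k p = [i]) \<longleftrightarrow> k = length q \<and> a \<in> {0..<int d}"
          if "k < length p" for k
        proof
          assume "\<exists>i\<in>{0..<int d}. drop k p = [i]"
          then obtain i where i: "i\<in>{0..<int d}" "drop k p = [i]" by auto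
          then have "length (drop k p) = 1" by simp
          then have "k = length q" using snoc by simp
          then show "k = length q \<and> a \<in> {0..<int d}" using i snoc by simp
        qed (auto simp: snoc)
        have "(x \<otimes>\<^bsub>path_alg d\<^esub> \<one>\<^bsub>path_alg d\<^esub>) p = (\<Sum>k<length p. if k = length q then x p else 0)"
          unfolding path_alg_sel using * x[of p]
          by (intro sum.cong refl) (auto simp: snoc is_path_def)
        then show ?thesis using snoc by (simp add: sum.delta)
      qed
    qed
  qed
qed (auto simp: path_alg_sel sum.distrib algebra_simps)

interpretation PA: ring "path_alg d" for d by (rule ring_path_alg)

lemma path_elem_closed: "is_path d p \<Longrightarrow> path_elem p \<in> carrier (path_alg d)"
  by (auto simp: path_alg_sel path_elem_def)

lemma path_smult_closed: "f \<in> carrier (path_alg d) \<Longrightarrow> c \<odot>\<^bsub>path_alg d\<^esub> f \<in> carrier (path_alg d)"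
  by (auto simp: path_alg_sel elim: rev_finite_subset)

lemma path_smult_mult:
  "(c \<odot>\<^bsub>path_alg d\<^esub> f) \<otimes>\<^bsub>path_alg d\<^esub> g = c \<odot>\<^bsub>path_alg d\<^esub> (f \<otimes>\<^bsub>path_alg d\<^esub> g)"
  "f \<otimes>\<^bsub>path_alg d\<^esub> (c \<odot>\<^bsub>path_alg d\<^esub> g) = c \<odot>\<^bsub>path_alg d\<^esub> (f \<otimes>\<^bsub>path_alg d\<^esub> g)"
  by (auto simp: path_alg_sel sum_distrib_left mult_ac intro!: sum.cong)

lemma path_a_inv: "f \<in> carrier (path_alg d) \<Longrightarrow> \<ominus>\<^bsub>path_alg d\<^esub> f = (\<lambda>p. - f p)"
  by (rule PA.minus_equality) (auto simp: path_alg_sel)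

lemma path_a_minus: "g \<in> carrier (path_alg d) \<Longrightarrow> f \<ominus>\<^bsub>path_alg d\<^esub> g = (\<lambda>p. f p - g p)"
  by (simp add: a_minus_def path_a_inv) (simp add: path_alg_sel)

text \<open>The common vertex belongs to both factors, hence the \<open>tl\<close>. The cut at the
  last entry of p is the only factorisation that meets both indicator functions.\<close>

lemma path_elem_mult:
  assumes "p \<noteq> []" "q \<noteq> []" "last p = hd q"
  shows "path_elem p \<otimes>\<^bsub>path_alg d\<^esub> path_elem q = path_elem (p @ tl q)"
proof
  fix r
  have *: "take (Suc k) r = p \<and> drop k r = q \<longleftrightarrow> r = p @ tl q \<and> Suc k = length p"
    if "k < length r" for k
  proof safe
    assume "p = take (Suc k) r" "q = drop k r"
    then show "r = take (Suc k) r @ tl (drop k r)"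
      by (metis append_take_drop_id drop_Suc tl_drop)
    show "Suc k = length (take (Suc k) r)" using that by simp
  next
    assume k: "Suc k = length p" "r = p @ tl q"
    then show "take (Suc k) (p @ tl q) = p" by simp
    show "drop k (p @ tl q) = q" using k assms
      by (cases p rule: rev_cases; cases q) auto
  qed
  have "(path_elem p \<otimes>\<^bsub>path_alg d\<^esub> path_elem q) r =
    (\<Sum>k<length r. if k = length p - 1 then (if r = p @ tl q then 1 else 0) else 0)"
    unfolding path_alg_sel
  proof (intro sum.cong refl)
    fix k assume "k \<in> {..<length r}"
    then have "k < length r" by simp
    then have "take (Suc k) r = p \<and> drop k r = q \<longleftrightarrow> r = p @ tl q \<and> k = length p - 1"
      using *[of k] assms(1) by (cases p) auto
    moreover have "path_elem p a * path_elem q b = (if a = p \<and> b = q then 1 else 0)" for a b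
      by (simp add: path_elem_def)
    ultimately show "path_elem p (take (Suc k) r) * path_elem q (drop k r) =
      (if k = length p - 1 then if r = p @ tl q then 1 else 0 else 0)"
      by simp
  qed
  also have "\<dots> = path_elem (p @ tl q) r"
    using assms(1) by (cases p) (auto simp: sum.delta path_elem_def)
  finally show "(path_elem p \<otimes>\<^bsub>path_alg d\<^esub> path_elem q) r = path_elem (p @ tl q) r" .
qed

text \<open>Induction over a finite set containing the support: one path is split off by setting its
  coefficient to 0.\<close>

lemma path_alg_induct [consumes 1, case_names zero elem add]:
  assumes "f \<in> carrier (path_alg d)"
    and "P \<zero>\<^bsub>path_alg d\<^esub>"
    and "\<And>c p. is_path d p \<Longrightarrow> P (c \<odot>\<^bsub>path_alg d\<^esub> path_elem p)"
    and "\<And>f g. \<lbrakk>f \<in> carrier (path_alg d); g \<in> carrier (path_alg d); P f; P g\<rbrakk> \<Longrightarrow> P (f \<oplus>\<^bsub>path_alg d\<^esub> g)"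
  shows "P f"
proof -
  have "finite S \<Longrightarrow> (\<forall>f\<in>carrier (path_alg d). {p. f p \<noteq> 0} \<subseteq> S \<longrightarrow> P f)" for S
  proof (induction S rule: finite_induct)
    case empty
    have "f = \<zero>\<^bsub>path_alg d\<^esub>" if "{p. f p \<noteq> 0} \<subseteq> {}" for f using that by (auto simp: path_alg_sel)
    then show ?case using assms(2) by blast
  next
    case (insert p S)
    show ?case
    proof (intro ballI impI)
      fix f assume f: "f \<in> carrier (path_alg d)" "{q. f q \<noteq> 0} \<subseteq> insert p S"
      show "P f"
      proof (cases "f p = 0")
        case True then show ?thesis using insert.IH f by (metis (mono_tags, lifting) insert_iff mem_Collect_eq subset_iff)
      next
        case False
        let ?g = "f(p := 0)"
        have p: "is_path d p" using False f by (auto simp: path_alg_sel)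
        have "{q. ?g q \<noteq> 0} \<subseteq> {q. f q \<noteq> 0}" by auto
        then have g: "?g \<in> carrier (path_alg d)" using f by (auto simp: path_alg_sel intro: finite_subset)
        have "{q. ?g q \<noteq> 0} \<subseteq> S" using f(2) by auto
        then have "P ?g" using insert.IH g by blast
        moreover have "f = f p \<odot>\<^bsub>path_alg d\<^esub> path_elem p \<oplus>\<^bsub>path_alg d\<^esub> ?g"
          by (auto simp: path_alg_sel path_elem_def)
        ultimately show ?thesis
          using assms(3)[OF p] assms(4) g path_smult_closed[OF path_elem_closed[OF p]] by metis
      qed
    qed
  qed
  then show ?thesis using assms(1) by (auto simp: path_alg_sel)
qed

section \<open>Coordinates on the affine zigzag algebra\<close>

text \<open>
  The triple \<open>(p, q, t)\<close> stands for the path of length \<open>t\<close> from \<open>q\<close> to \<open>p\<close>; the loop of length 2 at \<open>p\<close> is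
  normalised to \<open>p|p-1|p\<close>, so that \<open>p|p+1|p\<close> is \<open>loop_sign d p\<close> times the basis element.
\<close>

definition aff_idx :: "nat \<Rightarrow> int \<Rightarrow> int \<Rightarrow> int \<Rightarrow> bool" where
  "aff_idx d p q t \<longleftrightarrow> p \<in> {0..<int d} \<and> q \<in> {0..<int d} \<and>
     (t = 0 \<and> q = p \<or> t = 1 \<and> (q = (p + 1) mod int d \<or> q = (p - 1) mod int d) \<or> t = 2 \<and> q = p)"

definition loop_sign :: "nat \<Rightarrow> int \<Rightarrow> complex" where
  "loop_sign d p = (if p = 0 then (-1) ^ d else 1)"

text \<open>Both returning paths at p enter one coordinate, since they are proportional in the
  quotient. Paths of length 2 that do not return and paths of length at least 3 are not read at all,
  as they vanish there.\<close>

definition path_coord :: "nat \<Rightarrow> (int list \<Rightarrow> complex) \<Rightarrow> int \<Rightarrow> int \<Rightarrow> int \<Rightarrow> complex" where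
  "path_coord d f p q t = (if \<not> aff_idx d p q t then 0 else if t = 0 then f [p] else if t = 1 then f [p, q]
     else f [p, (p - 1) mod int d, p] + loop_sign d p * f [p, (p + 1) mod int d, p])"

text \<open>A linear section of \<open>path_coord\<close>: the normal form with given coordinates,
  supported on vertices, arrows and the loops p|p-1|p.\<close>

definition path_rep :: "nat \<Rightarrow> (int \<Rightarrow> int \<Rightarrow> int \<Rightarrow> complex) \<Rightarrow> int list \<Rightarrow> complex" where
  "path_rep d c p = (case p of [i] \<Rightarrow> c i i 0 | [i, j] \<Rightarrow> c i j 1
     | [i, j, k] \<Rightarrow> if k = i \<and> j = (i - 1) mod int d then c i i 2 else 0 | _ \<Rightarrow> 0)"

definition coord_fun :: "nat \<Rightarrow> (int \<Rightarrow> int \<Rightarrow> int \<Rightarrow> complex) set" where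
  "coord_fun d = {c. \<forall>p q t. c p q t \<noteq> 0 \<longrightarrow> aff_idx d p q t}"

text \<open>The structure constants of the affine zigzag algebra; the last two terms for t = 2 are
  the detours from p through its two neighbours. This is the meeting point of the proof: the
  products of both algebras are brought to this form.\<close>

definition coord_mult :: "nat \<Rightarrow> (int \<Rightarrow> int \<Rightarrow> int \<Rightarrow> complex) \<Rightarrow> (int \<Rightarrow> int \<Rightarrow> int \<Rightarrow> complex) \<Rightarrow>
    int \<Rightarrow> int \<Rightarrow> int \<Rightarrow> complex" where
  "coord_mult d c c' p q t = (if \<not> aff_idx d p q t then 0 else if t = 0 then c p p 0 * c' p p 0
     else if t = 1 then c p p 0 * c' p q 1 + c p q 1 * c' q q 0
     else c p p 0 * c' p p 2 + c p p 2 * c' p p 0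
       + c p ((p - 1) mod int d) 1 * c' ((p - 1) mod int d) p 1
       + loop_sign d p * (c p ((p + 1) mod int d) 1 * c' ((p + 1) mod int d) p 1))"

lemma mod_simps:
  fixes d :: nat and p :: int
  assumes "3 \<le> d" "0 \<le> p" "p < int d"
  shows "(p + 1) mod int d = (if p = int d - 1 then 0 else p + 1)"
    and "(p - 1) mod int d = (if p = 0 then int d - 1 else p - 1)"
    and "(1 + p) mod int d = (if p = int d - 1 then 0 else p + 1)"
    and "(p + 2) mod int d = (if p = int d - 1 then 1 else if p = int d - 2 then 0 else p + 2)"
    and "(p - 2) mod int d = (if p = 0 then int d - 2 else if p = 1 then int d - 1 else p - 2)"
proof -
  have C: "a mod int d = a + int d" if "- int d \<le> a" "a < 0" for a
    using that mod_pos_pos_trivial[of "a + int d" "int d"] by (metis add_0 add_le_cancel_right add.commute add_less_cancel_right add_uminus_conv_diff diff_add_cancel mod_add_self2)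
  have B: "a mod int d = a - int d" if "int d \<le> a" "a < 2 * int d" for a
    using that mod_pos_pos_trivial[of "a - int d" "int d"] minus_mod_self2[of a "int d"] by simp
  show 1: "(p + 1) mod int d = (if p = int d - 1 then 0 else p + 1)"
    using assms B[of "p+1"] by auto
  show "(p - 1) mod int d = (if p = 0 then int d - 1 else p - 1)"
    using assms C[of "p - 1"] by auto
  show "(1 + p) mod int d = (if p = int d - 1 then 0 else p + 1)" using 1 by (simp add: add.commute)
  show "(p + 2) mod int d = (if p = int d - 1 then 1 else if p = int d - 2 then 0 else p + 2)"
    using assms B[of "p+2"] by auto
  show "(p - 2) mod int d = (if p = 0 then int d - 2 else if p = 1 then int d - 1 else p - 2)"
    using assms C[of "p - 2"] by auto
qed

lemma aff_idx_neighbour: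
  assumes "p \<in> {0..<int d}"
  shows "aff_idx d p ((p + 1) mod int d) 1" "aff_idx d ((p + 1) mod int d) p 1"
    "aff_idx d p ((p - 1) mod int d) 1" "aff_idx d ((p - 1) mod int d) p 1" 
    "aff_idx d p p 0" "aff_idx d p p 2"
  using assms by (auto simp: aff_idx_def mod_diff_left_eq mod_add_left_eq)

lemma path_adjacent:
  assumes "i \<in> {0..<int d}" "j \<in> {0..<int d}"
  shows "i = (j + 1) mod int d \<longleftrightarrow> j = (i - 1) mod int d"
  using assms by (auto simp: mod_diff_left_eq mod_add_left_eq)

lemma path_coord_coord_fun: "path_coord d f \<in> coord_fun d"
  by (auto simp: coord_fun_def path_coord_def)

lemma path_coord_add: "path_coord d (f \<oplus>\<^bsub>path_alg d\<^esub> g) = (\<lambda>p q t. path_coord d f p q t + path_coord d g p q t)"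
  by (intro ext) (auto simp: path_coord_def path_alg_sel algebra_simps)

lemma path_coord_smult: "path_coord d (c \<odot>\<^bsub>path_alg d\<^esub> f) = (\<lambda>p q t. c * path_coord d f p q t)"
  by (intro ext) (auto simp: path_coord_def path_alg_sel algebra_simps)

lemma path_coord_zero: "path_coord d \<zero>\<^bsub>path_alg d\<^esub> = (\<lambda>p q t. 0)"
  by (intro ext) (auto simp: path_coord_def path_alg_sel)

lemma path_coord_minus: "g \<in> carrier (path_alg d) \<Longrightarrow>
    path_coord d (f \<ominus>\<^bsub>path_alg d\<^esub> g) = (\<lambda>p q t. path_coord d f p q t - path_coord d g p q t)"
  by (intro ext) (auto simp: path_coord_def path_a_minus algebra_simps)

lemma path_coord_one: "path_coord d \<one>\<^bsub>path_alg d\<^esub> = (\<lambda>p q t. if aff_idx d p q t \<and> t = 0 then 1 else 0)"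
  by (intro ext) (auto simp: path_coord_def path_alg_sel aff_idx_def)

text \<open>The factors of a path of length at most 2 are again that short, so the coefficients
  ignored by \<open>path_coord\<close> never enter. Cutting a returning path in the middle gives the
  two detours, the one through p + 1 with the sign that this path carries in
  \<open>path_coord\<close>.\<close>

lemma path_coord_mult: "path_coord d (f \<otimes>\<^bsub>path_alg d\<^esub> g) = coord_mult d (path_coord d f) (path_coord d g)"
proof (intro ext)
  fix p q t
  have 1: "(f \<otimes>\<^bsub>path_alg d\<^esub> g) [i] = f [i] * g [i]" for i by (simp add: path_alg_sel)
  have 2: "(f \<otimes>\<^bsub>path_alg d\<^esub> g) [i, j] = f [i] * g [i, j] + f [i, j] * g [j]" for i j
    by (simp add: path_alg_sel)
  have 3: "(f \<otimes>\<^bsub>path_alg d\<^esub> g) [i, j, k] = f [i] * g [i, j, k] + f [i, j] * g [j, k] + f [i, j, k] * g [k]" for i j k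
    by (simp add: path_alg_sel eval_nat_numeral)
  show "path_coord d (f \<otimes>\<^bsub>path_alg d\<^esub> g) p q t = coord_mult d (path_coord d f) (path_coord d g) p q t"
  proof (cases "aff_idx d p q t")
    case True
    then have p: "p \<in> {0..<int d}" and q: "q \<in> {0..<int d}" by (auto simp: aff_idx_def)
    show ?thesis using True aff_idx_neighbour[OF p] aff_idx_neighbour(5,6)[OF q]
      by (auto simp: path_coord_def coord_mult_def 1 2 3 algebra_simps)
  qed (simp add: path_coord_def coord_mult_def)
qed

lemma path_coord_returning:
  assumes "d \<ge> 3" "i \<in> {0..<int d}"
  shows "path_coord d (path_elem [i, (i - 1) mod int d, i]) = (\<lambda>p q t. if p = i \<and> q = i \<and> t = 2 then 1 else 0)"
    and "path_coord d (path_elem [i, (i + 1) mod int d, i]) = (\<lambda>p q t. if p = i \<and> q = i \<and> t = 2 then loop_sign d i else 0)"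
proof -
  \<comment> \<open>Here d >= 3 enters: for d = 2 the two returning paths at i would be the same
    list.\<close>
  have ne: "(i + 1) mod int d \<noteq> (i - 1) mod int d" using assms(2) mod_simps[OF assms(1), of i] assms(1) by auto
  have pe: "path_elem [i, j, i] [p] = 0" "path_elem [i, j, i] [p, q] = 0"
    "path_elem [i, j, i] [p, q, p] = (if p = i \<and> q = j then 1 else 0)" for j p q
    by (auto simp: path_elem_def)
  have AT2: "aff_idx d p q t \<longleftrightarrow> p = q \<and> p \<in> {0..<int d} \<and> t = 2" if "t \<noteq> 0" "t \<noteq> 1" for p q t
    using that by (auto simp: aff_idx_def)
  show "path_coord d (path_elem [i, (i - 1) mod int d, i]) = (\<lambda>p q t. if p = i \<and> q = i \<and> t = 2 then 1 else 0)"
    using ne assms(2) unfolding path_coord_def pe by (intro ext) (simp add: AT2)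
  show "path_coord d (path_elem [i, (i + 1) mod int d, i]) = (\<lambda>p q t. if p = i \<and> q = i \<and> t = 2 then loop_sign d i else 0)"
    using ne[symmetric] assms(2) unfolding path_coord_def pe by (intro ext) (simp add: AT2)
qed

lemma path_rep_returning:
  "path_rep d (\<lambda>p q t. if p = i \<and> q = i \<and> t = 2 then a else 0) = a \<odot>\<^bsub>path_alg d\<^esub> path_elem [i, (i - 1) mod int d, i]"
  by (rule ext) (auto simp: path_rep_def path_alg_sel path_elem_def split: list.split)

lemma path_rep_closed:
  assumes "c \<in> coord_fun d" "d \<ge> 3"
  shows "path_rep d c \<in> carrier (path_alg d)"
proof -
  have path: "is_path d p \<and> length p \<le> 3" if "path_rep d c p \<noteq> 0" for p
  proof -
    have aff_idx: "aff_idx d i j t" if "c i j t \<noteq> 0" for i j t using assms that by (auto simp: coord_fun_def)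
    show ?thesis using that
      by (auto simp: path_rep_def is_path_def split: list.splits if_splits dest!: aff_idx)
        (auto simp: aff_idx_def mod_simps[OF assms(2)] split: if_splits)
  qed
  have "finite {p. set p \<subseteq> {0..<int d} \<and> length p \<le> 3}" by (rule finite_lists_length_le) simp
  then have "finite {p. path_rep d c p \<noteq> 0}"
    by (rule finite_subset[rotated]) (use path in \<open>auto simp: is_path_def\<close>)
  then show ?thesis using path by (auto simp: path_alg_sel)
qed

lemma path_coord_path_rep:
  assumes "c \<in> coord_fun d" "d \<ge> 3"
  shows "path_coord d (path_rep d c) = c"
proof (intro ext)
  fix p q t
  show "path_coord d (path_rep d c) p q t = c p q t"
  proof (cases "aff_idx d p q t")
    case False then show ?thesis using assms(1) by (auto simp: path_coord_def coord_fun_def)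
  next
    case True
    then have "p \<in> {0..<int d}" by (auto simp: aff_idx_def)
    then have "(p + 1) mod int d \<noteq> (p - 1) mod int d" using mod_simps[OF assms(2), of p] assms(2) by auto
    then show ?thesis using True by (auto simp: path_coord_def path_rep_def aff_idx_def)
  qed
qed

lemma path_rep_add: "path_rep d (\<lambda>p q t. c p q t + c' p q t) = path_rep d c \<oplus>\<^bsub>path_alg d\<^esub> path_rep d c'"
  by (rule ext) (auto simp: path_rep_def path_alg_sel split: list.splits)

lemma path_rep_smult: "path_rep d (\<lambda>p q t. a * c p q t) = a \<odot>\<^bsub>path_alg d\<^esub> path_rep d c"
  by (rule ext) (auto simp: path_rep_def path_alg_sel split: list.splits)

section \<open>Normal forms modulo the zigzag relations\<close>

lemma zigzag_rels_closed:
  assumes "d \<ge> 3" shows "zigzag_rels d \<subseteq> carrier (path_alg d)"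
proof -
  have "is_path d [i, (i + 1) mod int d, (i + 2) mod int d]" "is_path d [i, (i - 1) mod int d, (i - 2) mod int d]"
    "is_path d [i, (i + 1) mod int d, i]" "is_path d [i, (i - 1) mod int d, i]"
    if "i \<in> {0..<int d}" for i
    using that assms mod_simps[OF assms, of i]
    by (auto simp: is_path_def mod_simps[OF assms] split: if_splits)
  moreover have "is_path d [i, i - 1, i]" if "1 \<le> i" "i < int d" for i
    using that assms by (auto simp: is_path_def mod_simps[OF assms])
  moreover have "is_path d [0, 1, 0]" "is_path d [0, int d - 1, 0]"
    using assms by (auto simp: is_path_def mod_simps[OF assms])
  ultimately show ?thesis
    unfolding zigzag_rels_def
    by (intro Un_least subsetI; elim CollectE exE conjE singletonE)
      (simp_all add: path_elem_closed path_smult_closed PA.minus_closed)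
qed

lemma zigzag_ideal: "d \<ge> 3 \<Longrightarrow> ideal (zigzag_ideal d) (path_alg d)"
  unfolding zigzag_ideal_def by (intro PA.genideal_ideal zigzag_rels_closed)

lemma zigzag_rels_in_ideal: "d \<ge> 3 \<Longrightarrow> f \<in> zigzag_rels d \<Longrightarrow> f \<in> zigzag_ideal d"
  unfolding zigzag_ideal_def using PA.genideal_self[OF zigzag_rels_closed] by blast

text \<open>Linear independence of the triples. The coordinates of a product depend on the factors
  bilinearly and only through their coordinates, so the kernel of \<open>path_coord\<close> is an
  ideal; it contains all relations, hence the ideal that they generate.\<close>

lemma path_coord_zigzag_ideal:
  assumes "d \<ge> 3" "f \<in> zigzag_ideal d" shows "path_coord d f = (\<lambda>p q t. 0)"
proof -
  let ?K = "{f \<in> carrier (path_alg d). path_coord d f = (\<lambda>p q t. 0)}"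
  have "subgroup ?K (add_monoid (path_alg d))"
  proof (rule PA.add.subgroupI)
    fix f assume "f \<in> ?K"
    then show "\<ominus>\<^bsub>path_alg d\<^esub> f \<in> ?K"
      using path_coord_minus[of f d "\<zero>\<^bsub>path_alg d\<^esub>"] by (auto simp: path_coord_zero a_minus_def)
  qed (auto simp: path_coord_add path_coord_zero intro!: exI[of _ "\<zero>\<^bsub>path_alg d\<^esub>"])
  then have "ideal ?K (path_alg d)"
    by (intro idealI ring_path_alg) (auto simp: path_coord_mult coord_mult_def fun_eq_iff)
  moreover have "zigzag_rels d \<subseteq> ?K"
  proof
    fix f assume f: "f \<in> zigzag_rels d"
    have ne: "(i + 2) mod int d \<noteq> i" "(i - 2) mod int d \<noteq> i" "(i + 1) mod int d \<noteq> (i - 1) mod int d"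
      if "i \<in> {0..<int d}" for i using that assms(1) mod_simps[OF assms(1), of i] by auto
    have 0: "(0 - 1) mod int d = int d - 1" "(0 + 1) mod int d = 1" using assms(1) mod_simps[OF assms(1), of 0] by auto
    consider i where "i \<in> {0..<int d}" "f = path_elem [i, (i + 1) mod int d, (i + 2) mod int d]"
      | i where "i \<in> {0..<int d}" "f = path_elem [i, (i - 1) mod int d, (i - 2) mod int d]"
      | i where "i \<in> {1..<int d}"
          "f = path_elem [i, (i + 1) mod int d, i] \<ominus>\<^bsub>path_alg d\<^esub> path_elem [i, (i - 1) mod int d, i]"
      | "f = path_elem [0, 1, 0] \<ominus>\<^bsub>path_alg d\<^esub> ((-1) ^ d \<odot>\<^bsub>path_alg d\<^esub> path_elem [0, int d - 1, 0])"
      using f unfolding zigzag_rels_def by blast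
    then have "path_coord d f = (\<lambda>p q t. 0)"
    proof cases
      case 1 then show ?thesis using ne[of i] by (auto simp: path_coord_def path_elem_def fun_eq_iff)
    next
      case 2 then show ?thesis using ne[of i] by (auto simp: path_coord_def path_elem_def fun_eq_iff)
    next
      case 3
      have "path_elem [i, (i - 1) mod int d, i] \<in> carrier (path_alg d)"
        using 3 by (intro path_elem_closed) (simp add: is_path_def mod_add_left_eq)
      note * = path_coord_minus[OF this]
      have i: "i \<in> {0..<int d}" using 3 by simp
      show ?thesis unfolding 3(2) * path_coord_returning[OF assms(1) i] using 3(1) by (simp add: loop_sign_def fun_eq_iff)
    next
      case 4
      have "path_elem [0, int d - 1, 0] \<in> carrier (path_alg d)"
        using assms(1) by (intro path_elem_closed) (auto simp: is_path_def mod_simps[OF assms(1)])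
      note * = path_coord_minus[OF path_smult_closed[OF this]]
      have i: "0 \<in> {0..<int d}" using assms(1) by simp
      show ?thesis using path_coord_returning[OF assms(1) i] unfolding 4 * path_coord_smult 0 by (simp add: loop_sign_def fun_eq_iff)
    qed
    then show "f \<in> ?K" using f zigzag_rels_closed[OF assms(1)] by auto
  qed
  ultimately have "zigzag_ideal d \<subseteq> ?K" unfolding zigzag_ideal_def by (rule PA.genideal_minimal)
  then show ?thesis using assms(2) by auto
qed

text \<open>The ideal is generated in the sense of rings; scaling by c stays inside because it is
  multiplication by c times the unit.\<close>

lemma zigzag_ideal_smult:
  assumes "d \<ge> 3" "f \<in> zigzag_ideal d" shows "c \<odot>\<^bsub>path_alg d\<^esub> f \<in> zigzag_ideal d"
proof -
  interpret I: ideal "zigzag_ideal d" "path_alg d" by (rule zigzag_ideal[OF assms(1)])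
  have f: "f \<in> carrier (path_alg d)" using assms(2) by auto
  have "(c \<odot>\<^bsub>path_alg d\<^esub> \<one>\<^bsub>path_alg d\<^esub>) \<otimes>\<^bsub>path_alg d\<^esub> f \<in> zigzag_ideal d"
    by (intro I.I_l_closed assms(2) path_smult_closed) simp
  then show ?thesis using f by (simp add: path_smult_mult)
qed

text \<open>Two steps that do not return go around the cycle in the same direction, which is what
  the first two families of relations kill.\<close>

lemma nonreturning_in_ideal:
  assumes "d \<ge> 3" "is_path d [i, j, k]" "i \<noteq> k"
  shows "path_elem [i, j, k] \<in> zigzag_ideal d"
proof (rule zigzag_rels_in_ideal[OF assms(1)])
  have r: "i \<in> {0..<int d}" "j \<in> {0..<int d}" "k \<in> {0..<int d}" using assms(2) by (auto simp: is_path_def)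
  have "j = (i + 1) mod int d \<and> k = (i + 2) mod int d \<or> j = (i - 1) mod int d \<and> k = (i - 2) mod int d"
  proof -
    have "j = (i + 1) mod int d \<or> j = (i - 1) mod int d" "k = (j + 1) mod int d \<or> k = (j - 1) mod int d"
      using assms(2) path_adjacent[OF r(1,2)] path_adjacent[OF r(2,3)] by (auto simp: is_path_def)
    moreover have "((i + 1) mod int d - 1) mod int d = i" "((i - 1) mod int d + 1) mod int d = i"
      using r(1) by (auto simp: mod_diff_left_eq mod_add_left_eq)
    moreover have "((i + 1) mod int d + 1) mod int d = (i + 2) mod int d"
        "((i - 1) mod int d - 1) mod int d = (i - 2) mod int d"
      using mod_add_left_eq[of "i + 1" "int d" 1] mod_diff_left_eq[of "i - 1" "int d" 1] by (simp_all add: add.commute[of i 2])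
    ultimately show ?thesis using assms(3) by metis
  qed
  then show "path_elem [i, j, k] \<in> zigzag_rels d"
    using r(1) unfolding zigzag_rels_def by blast
qed

text \<open>One formula for the loop relations at all vertices: the exceptional sign at 0 is
  absorbed in \<open>loop_sign\<close>, which is 1 elsewhere.\<close>

lemma returning_mod_ideal:
  assumes "d \<ge> 3" "i \<in> {0..<int d}"
  shows "path_elem [i, (i + 1) mod int d, i] \<ominus>\<^bsub>path_alg d\<^esub> (loop_sign d i \<odot>\<^bsub>path_alg d\<^esub> path_elem [i, (i - 1) mod int d, i])
    \<in> zigzag_ideal d"
proof (rule zigzag_rels_in_ideal[OF assms(1)])
  have one: "1 \<odot>\<^bsub>path_alg d\<^esub> f = f" for f by (simp add: path_alg_sel)
  have 0: "(0 - 1) mod int d = int d - 1" "(0 + 1) mod int d = 1"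
    using assms(1) mod_simps[OF assms(1), of 0] by auto
  show "path_elem [i, (i + 1) mod int d, i] \<ominus>\<^bsub>path_alg d\<^esub> (loop_sign d i \<odot>\<^bsub>path_alg d\<^esub> path_elem [i, (i - 1) mod int d, i])
    \<in> zigzag_rels d"
  proof (cases "i = 0")
    case True
    then show ?thesis unfolding zigzag_rels_def loop_sign_def True 0 by simp
  next
    case False
    then have "i \<in> {1..<int d}" using assms(2) by auto
    moreover have loop_sign: "loop_sign d i = 1" using False by (simp add: loop_sign_def)
    ultimately show ?thesis unfolding zigzag_rels_def loop_sign one by blast
  qed
qed

text \<open>Three steps are enough. Unless they oscillate, as i, j, i, j, two consecutive ones form
  a path that does not return. If they oscillate, the first loop is exchanged for the loop at i
  through the other neighbour, and the half of this loop next to j, followed by the step between i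
  and j, no longer returns.\<close>

lemma long_in_ideal:
  assumes d: "d \<ge> 3" and p: "is_path d (i # j # k # l # r)"
  shows "path_elem (i # j # k # l # r) \<in> zigzag_ideal d"
proof -
  interpret I: ideal "zigzag_ideal d" "path_alg d" by (rule zigzag_ideal[OF d])
  have pcl: "path_elem (l # r) \<in> carrier (path_alg d)" "path_elem (k # l # r) \<in> carrier (path_alg d)"
      "path_elem [i,j] \<in> carrier (path_alg d)" "path_elem [k,l] \<in> carrier (path_alg d)"
      "path_elem [i,j,k] \<in> carrier (path_alg d)" "path_elem [j,k,l] \<in> carrier (path_alg d)"
    by (intro path_elem_closed; use p in \<open>simp add: is_path_def\<close>)+
  have pths: "is_path d [i,j,k]" "is_path d [j,k,l]" using p by (simp_all add: is_path_def)
  consider "i \<noteq> k" | "j \<noteq> l" | "i = k" "j = l" by blast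
  then show ?thesis
  proof cases
    case 1
    have "path_elem (i # j # k # l # r) = path_elem [i,j,k] \<otimes>\<^bsub>path_alg d\<^esub> path_elem (k # l # r)"
      by (subst path_elem_mult) auto
    then show ?thesis using nonreturning_in_ideal[OF d pths(1) 1] I.I_r_closed pcl by auto
  next
    case 2
    have "path_elem (i # j # k # l # r) = path_elem [i,j] \<otimes>\<^bsub>path_alg d\<^esub> (path_elem [j,k,l] \<otimes>\<^bsub>path_alg d\<^esub> path_elem (l # r))"
      by (subst path_elem_mult, simp_all)+
    then show ?thesis using nonreturning_in_ideal[OF d pths(2) 2] I.I_r_closed I.I_l_closed pcl by auto
  next
    case 3
    define a where "a = (i + 1) mod int d"
    define b where "b = (i - 1) mod int d"
    have i: "i \<in> {0..<int d}" and j: "j \<in> {0..<int d}" using p by (auto simp: is_path_def)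
    have ab: "a \<in> {0..<int d}" "b \<in> {0..<int d}" using d by (auto simp: a_def b_def)
    have ne: "a \<noteq> b" using i mod_simps[OF d, of i] d by (auto simp: a_def b_def)
    have "j = (i + 1) mod int d \<or> i = (j + 1) mod int d" using p by (simp add: is_path_def)
    then have jab: "j = a \<or> j = b" unfolding path_adjacent[OF i j] a_def b_def .
    have adj: "is_path d [i, x, i]" "is_path d [x, i, y]" "is_path d [i, x]" if "x = a \<or> x = b" "y = a \<or> y = b" for x y
    proof -
      have a: "a = (i + 1) mod int d" by (rule a_def)
      have b: "i = (b + 1) mod int d"
        using i by (simp add: b_def mod_add_left_eq)
      have A: "x = (i + 1) mod int d \<or> i = (x + 1) mod int d" "i = (x + 1) mod int d \<or> x = (i + 1) mod int d"
        if "x = a \<or> x = b" for x using that a b by blast+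
      have X: "x \<in> {0..<int d}" "y \<in> {0..<int d}" using ab that by metis+
      show "is_path d [i, x, i]" "is_path d [x, i, y]" "is_path d [i, x]"
        using A[OF that(1)] A[OF that(2)] i X by (simp_all add: is_path_def)
    qed
    let ?D = "path_elem [i, a, i] \<ominus>\<^bsub>path_alg d\<^esub> (loop_sign d i \<odot>\<^bsub>path_alg d\<^esub> path_elem [i, b, i])"
    have D: "?D \<in> zigzag_ideal d" unfolding a_def b_def by (rule returning_mod_ideal[OF d i])
    have cl: "path_elem [i, a, i] \<in> carrier (path_alg d)" "path_elem [i, b, i] \<in> carrier (path_alg d)"
      using adj(1)[of a a] adj(1)[of b b] by (auto intro!: path_elem_closed)
    \<comment> \<open>The loop at i through x, continued to y, contains x|i|y, which does not return
      for distinct x and y.\<close>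
    have mx: "path_elem [i, x, i] \<otimes>\<^bsub>path_alg d\<^esub> path_elem [i, y] \<in> zigzag_ideal d"
      if "x = a \<or> x = b" "y = a \<or> y = b" "x \<noteq> y" for x y
    proof -
      have "path_elem [i, x, i] \<otimes>\<^bsub>path_alg d\<^esub> path_elem [i, y] = path_elem [i, x] \<otimes>\<^bsub>path_alg d\<^esub> path_elem [x, i, y]"
        by (simp add: path_elem_mult)
      also have "\<dots> \<in> zigzag_ideal d"
        using adj[OF that(1,2)] by (intro I.I_l_closed nonreturning_in_ideal[OF d] path_elem_closed that)
      finally show ?thesis .
    qed
    have ia: "path_elem [i, x] \<in> carrier (path_alg d)" if "x = a \<or> x = b" for x
      by (rule path_elem_closed[OF adj(3)[OF that that]])
    have 4: "path_elem [i, j, i] \<otimes>\<^bsub>path_alg d\<^esub> path_elem [i, j] \<in> zigzag_ideal d"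
    proof (cases "j = a")
      case True
      have "path_elem [i, a, i] \<otimes>\<^bsub>path_alg d\<^esub> path_elem [i, a] =
        ?D \<otimes>\<^bsub>path_alg d\<^esub> path_elem [i, a] \<oplus>\<^bsub>path_alg d\<^esub>
        loop_sign d i \<odot>\<^bsub>path_alg d\<^esub> (path_elem [i, b, i] \<otimes>\<^bsub>path_alg d\<^esub> path_elem [i, a])"
        unfolding path_smult_mult[symmetric]
        by (rule ext) (simp add: path_a_minus path_smult_closed cl, simp add: path_alg_sel sum.distrib[symmetric] algebra_simps)
      also have "\<dots> \<in> zigzag_ideal d"
        by (intro I.a_closed I.I_r_closed D ia zigzag_ideal_smult[OF d] mx) (use ne in auto)
      finally show ?thesis using True by simp
    next
      case False
      then have jb: "j = b" using jab by simp
      \<comment> \<open>For j = b the loop relation is read in the opposite direction; the sign is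
        its own inverse.\<close>
      have sg2: "loop_sign d i * loop_sign d i = 1" by (auto simp: loop_sign_def power_mult_distrib[symmetric] simp flip: power_add)
      have "path_elem [i, b, i] \<otimes>\<^bsub>path_alg d\<^esub> path_elem [i, b] =
        loop_sign d i \<odot>\<^bsub>path_alg d\<^esub> (path_elem [i, a, i] \<otimes>\<^bsub>path_alg d\<^esub> path_elem [i, b]
          \<ominus>\<^bsub>path_alg d\<^esub> ?D \<otimes>\<^bsub>path_alg d\<^esub> path_elem [i, b])"
      proof -
        have "path_elem [i, a, i] \<otimes>\<^bsub>path_alg d\<^esub> path_elem [i, b]
          \<ominus>\<^bsub>path_alg d\<^esub> ?D \<otimes>\<^bsub>path_alg d\<^esub> path_elem [i, b] =
          (path_elem [i, a, i] \<ominus>\<^bsub>path_alg d\<^esub> ?D) \<otimes>\<^bsub>path_alg d\<^esub> path_elem [i, b]"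
          using cl ia by (simp add: PA.l_distr PA.l_minus a_minus_def path_smult_closed)
        also have "path_elem [i, a, i] \<ominus>\<^bsub>path_alg d\<^esub> ?D = loop_sign d i \<odot>\<^bsub>path_alg d\<^esub> path_elem [i, b, i]"
        proof -
          have "?D \<in> carrier (path_alg d)" using D by auto
          then show ?thesis using cl by (simp add: path_a_minus path_smult_closed)
        qed
        finally show ?thesis by (simp add: path_smult_mult) (simp add: path_alg_sel(6) sg2 flip: mult.assoc)
      qed
      also have "\<dots> \<in> zigzag_ideal d"
        unfolding a_minus_def
        using mx[of a b] ne
        by (intro zigzag_ideal_smult[OF d] I.a_closed I.a_inv_closed I.I_r_closed[OF D[unfolded a_minus_def]] ia) auto
      finally show ?thesis using jb by simp
    qed
    have "path_elem (i # j # k # l # r) = path_elem [i, j, i] \<otimes>\<^bsub>path_alg d\<^esub> path_elem [i, j] \<otimes>\<^bsub>path_alg d\<^esub> path_elem (l # r)"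
      using 3 by (simp add: path_elem_mult)
    then show ?thesis using I.I_r_closed[OF 4] pcl by auto
  qed
qed

text \<open>The spanning half, path by path: the normal form is the path itself for length 0, length
  1 and the chosen loop, \<open>loop_sign\<close> times the chosen loop for the other loop, and 0 in
  all remaining cases.\<close>

lemma path_elem_reduce:
  assumes d: "d \<ge> 3" and p: "is_path d p"
  shows "path_elem p \<ominus>\<^bsub>path_alg d\<^esub> path_rep d (path_coord d (path_elem p)) \<in> zigzag_ideal d"
proof -
  interpret I: ideal "zigzag_ideal d" "path_alg d" by (rule zigzag_ideal[OF d])
  note cl = path_elem_closed[OF p] path_rep_closed[OF path_coord_coord_fun d, of "path_elem p"]
  have *: ?thesis if "path_rep d (path_coord d (path_elem p)) = path_elem p"
    using cl that by (simp add: PA.r_neg a_minus_def)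
  have **: ?thesis if "path_coord d (path_elem p) = (\<lambda>p q t. 0)" "path_elem p \<in> zigzag_ideal d"
  proof -
    have "path_rep d (\<lambda>p q t. 0) = \<zero>\<^bsub>path_alg d\<^esub>" by (auto simp: path_rep_def path_alg_sel fun_eq_iff split: list.splits)
    then show ?thesis using that cl by (simp add: a_minus_def)
  qed
  consider "p = []" | i where "p = [i]" | i j where "p = [i, j]" | i j k where "p = [i, j, k]" | i j k l r where "p = i # j # k # l # r"
    by (metis list.exhaust)
  then show ?thesis
  proof cases
    case 1 then show ?thesis using p by (simp add: is_path_def)
  next
    case (2 i)
    then show ?thesis using p
      by (intro *) (auto simp: fun_eq_iff path_rep_def path_coord_def path_elem_def aff_idx_def is_path_def split: list.splits)
  next
    case (3 i j)
    then have "aff_idx d i j 1" using p path_adjacent[of i d j] by (auto simp: is_path_def aff_idx_def)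
    with 3 show ?thesis
      by (intro *) (auto simp: fun_eq_iff path_rep_def path_coord_def path_elem_def split: list.splits)
  next
    case (4 i j k)
    have ij: "i \<in> {0..<int d}" "j \<in> {0..<int d}" and a: "j = (i + 1) mod int d \<or> j = (i - 1) mod int d"
      using 4 p path_adjacent[of i d j] by (auto simp: is_path_def)
    have ne: "(i + 1) mod int d \<noteq> (i - 1) mod int d" using ij mod_simps[OF d, of i] d by auto
    consider "i \<noteq> k" | "i = k" "j = (i - 1) mod int d" | "i = k" "j = (i + 1) mod int d" using a by blast
    then show ?thesis
    proof cases
      case 1
      then have "path_coord d (path_elem [i, j, k]) = (\<lambda>p q t. 0)"
        by (auto simp: path_coord_def path_elem_def fun_eq_iff)
      with 1 show ?thesis using 4 p by (intro ** ) (simp_all add: nonreturning_in_ideal[OF d])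
    next
      case 2
      have "1 \<odot>\<^bsub>path_alg d\<^esub> f = f" for f by (simp add: path_alg_sel)
      then show ?thesis
        by (intro *) (simp only: 4 2(1)[symmetric] 2(2) path_coord_returning[OF d ij(1)] path_rep_returning)
    next
      case 3
      then show ?thesis
        by (simp only: 4 3(1)[symmetric] 3(2) path_coord_returning[OF d ij(1)] path_rep_returning returning_mod_ideal[OF d ij(1)])
    qed
  next
    case (5 i j k l r)
    have "path_coord d (path_elem (i # j # k # l # r)) = (\<lambda>p q t. 0)"
      by (auto simp: path_coord_def path_elem_def fun_eq_iff)
    with 5 show ?thesis using long_in_ideal[OF d] p by (intro ** ) simp_all
  qed
qed

lemma path_reduce:
  assumes d: "d \<ge> 3" and "f \<in> carrier (path_alg d)"
  shows "f \<ominus>\<^bsub>path_alg d\<^esub> path_rep d (path_coord d f) \<in> zigzag_ideal d"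
  using assms(2)
proof (induction rule: path_alg_induct)
  interpret I: ideal "zigzag_ideal d" "path_alg d" by (rule zigzag_ideal[OF d])
  have cl: "path_rep d (path_coord d f) \<in> carrier (path_alg d)" for f by (rule path_rep_closed[OF path_coord_coord_fun d])
  case zero
  have "path_rep d (\<lambda>p q t. 0) = \<zero>\<^bsub>path_alg d\<^esub>" by (auto simp: path_rep_def path_alg_sel fun_eq_iff split: list.splits)
  then show ?case by (simp add: path_coord_zero a_minus_def)
next
  interpret I: ideal "zigzag_ideal d" "path_alg d" by (rule zigzag_ideal[OF d])
  have cl: "path_rep d (path_coord d f) \<in> carrier (path_alg d)" for f by (rule path_rep_closed[OF path_coord_coord_fun d])
  case (elem c p)
  have "c \<odot>\<^bsub>path_alg d\<^esub> path_elem p \<ominus>\<^bsub>path_alg d\<^esub> path_rep d (path_coord d (c \<odot>\<^bsub>path_alg d\<^esub> path_elem p)) =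
    c \<odot>\<^bsub>path_alg d\<^esub> (path_elem p \<ominus>\<^bsub>path_alg d\<^esub> path_rep d (path_coord d (path_elem p)))"
    unfolding path_coord_smult path_rep_smult
    by (simp add: path_a_minus path_smult_closed cl) (simp add: path_alg_sel algebra_simps)
  then show ?case using zigzag_ideal_smult[OF d path_elem_reduce[OF d elem]] by simp
next
  interpret I: ideal "zigzag_ideal d" "path_alg d" by (rule zigzag_ideal[OF d])
  have cl: "path_rep d (path_coord d f) \<in> carrier (path_alg d)" for f by (rule path_rep_closed[OF path_coord_coord_fun d])
  case (add f g)
  have "f \<oplus>\<^bsub>path_alg d\<^esub> g \<ominus>\<^bsub>path_alg d\<^esub> path_rep d (path_coord d (f \<oplus>\<^bsub>path_alg d\<^esub> g)) =
    (f \<ominus>\<^bsub>path_alg d\<^esub> path_rep d (path_coord d f)) \<oplus>\<^bsub>path_alg d\<^esub> (g \<ominus>\<^bsub>path_alg d\<^esub> path_rep d (path_coord d g))"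
    unfolding path_coord_add path_rep_add
    by (simp add: path_a_minus PA.a_closed cl) (simp add: path_alg_sel algebra_simps)
  then show ?case using I.a_closed add by simp
qed

text \<open>Independence and spanning combined: the ideal is the kernel of
  \<open>path_coord\<close>. Hence the quotient has the triples as a basis, of which there are d + 2
  d + d = 4 d.\<close>

lemma zigzag_ideal_iff:
  assumes "d \<ge> 3" "f \<in> carrier (path_alg d)"
  shows "f \<in> zigzag_ideal d \<longleftrightarrow> path_coord d f = (\<lambda>p q t. 0)"
proof
  assume "path_coord d f = (\<lambda>p q t. 0)"
  moreover have "path_rep d (\<lambda>p q t. 0) = \<zero>\<^bsub>path_alg d\<^esub>" by (auto simp: path_rep_def path_alg_sel fun_eq_iff split: list.splits)
  ultimately show "f \<in> zigzag_ideal d" using path_reduce[OF assms] assms(2) by (simp add: a_minus_def)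
qed (rule path_coord_zigzag_ideal[OF assms(1)])

section \<open>Coordinates on the quotient\<close>

text \<open>\<open>SOME\<close> makes the function total; on a coset all representatives have the
  same \<open>path_coord\<close>. On other sets the value carries no meaning, but it always lies in
  \<open>coord_fun\<close>.\<close>

definition coord :: "nat \<Rightarrow> zz \<Rightarrow> int \<Rightarrow> int \<Rightarrow> int \<Rightarrow> complex" where
  "coord d S = path_coord d (SOME f. f \<in> S)"

definition of_coord :: "nat \<Rightarrow> (int \<Rightarrow> int \<Rightarrow> int \<Rightarrow> complex) \<Rightarrow> zz" where
  "of_coord d c = zigzag_ideal d +>\<^bsub>path_alg d\<^esub> path_rep d c"

abbreviation cls :: "nat \<Rightarrow> (int list \<Rightarrow> complex) \<Rightarrow> zz" where
  "cls d f \<equiv> zigzag_ideal d +>\<^bsub>path_alg d\<^esub> f"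

lemma affine_carrier: "carrier (affine_zigzag d) = cls d ` carrier (path_alg d)"
  by (auto simp: affine_zigzag_def FactRing_def A_RCOSETS_def' )

context
  fixes d :: nat
  assumes d3: "d \<ge> 3"
begin

interpretation I: ideal "zigzag_ideal d" "path_alg d" by (rule zigzag_ideal[OF d3])

lemma cls_mem_path_coord:
  assumes "f \<in> carrier (path_alg d)" "g \<in> cls d f"
  shows "path_coord d g = path_coord d f" "g \<in> carrier (path_alg d)"
proof -
  obtain h where h: "h \<in> zigzag_ideal d" "g = h \<oplus>\<^bsub>path_alg d\<^esub> f"
    using assms(2) by (auto simp: a_r_coset_def')
  then show "path_coord d g = path_coord d f" by (simp add: path_coord_add path_coord_zigzag_ideal[OF d3])
  show "g \<in> carrier (path_alg d)" using h assms(1) by auto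
qed

lemma cls_self: "f \<in> carrier (path_alg d) \<Longrightarrow> f \<in> cls d f"
  by (rule I.a_rcos_self)

lemma cls_eq_iff:
  assumes "f \<in> carrier (path_alg d)" "g \<in> carrier (path_alg d)"
  shows "cls d f = cls d g \<longleftrightarrow> path_coord d f = path_coord d g"
proof
  assume "cls d f = cls d g"
  then show "path_coord d f = path_coord d g" using cls_self[OF assms(1)] cls_mem_path_coord[OF assms(2)] by blast
next
  assume "path_coord d f = path_coord d g"
  then have "f \<ominus>\<^bsub>path_alg d\<^esub> g \<in> zigzag_ideal d"
    using assms by (simp add: zigzag_ideal_iff[OF d3] path_coord_minus)
  moreover have "f = (f \<ominus>\<^bsub>path_alg d\<^esub> g) \<oplus>\<^bsub>path_alg d\<^esub> g"
    using assms by (simp add: a_minus_def PA.a_assoc PA.l_neg)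
  ultimately have "f \<in> cls d g" by (auto simp: a_r_coset_def')
  then show "cls d f = cls d g"
    using PA.a_repr_independence[OF _ assms(2) I.a_subgroup] by simp
qed

lemma coord_cls: "f \<in> carrier (path_alg d) \<Longrightarrow> coord d (cls d f) = path_coord d f"
  unfolding coord_def using cls_mem_path_coord(1) someI[of "\<lambda>g. g \<in> cls d f"] cls_self by blast

lemma affine_ops:
  assumes "f \<in> carrier (path_alg d)" "g \<in> carrier (path_alg d)"
  shows "cls d f \<oplus>\<^bsub>affine_zigzag d\<^esub> cls d g = cls d (f \<oplus>\<^bsub>path_alg d\<^esub> g)"
    and "cls d f \<otimes>\<^bsub>affine_zigzag d\<^esub> cls d g = cls d (f \<otimes>\<^bsub>path_alg d\<^esub> g)"
    and "c \<odot>\<^bsub>affine_zigzag d\<^esub> cls d f = cls d (c \<odot>\<^bsub>path_alg d\<^esub> f)"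
proof -
  show "cls d f \<oplus>\<^bsub>affine_zigzag d\<^esub> cls d g = cls d (f \<oplus>\<^bsub>path_alg d\<^esub> g)"
    using assms by (simp add: affine_zigzag_def FactRing_def I.a_rcos_sum)
  show "cls d f \<otimes>\<^bsub>affine_zigzag d\<^esub> cls d g = cls d (f \<otimes>\<^bsub>path_alg d\<^esub> g)"
    using assms by (simp add: affine_zigzag_def FactRing_def I.rcoset_mult_add)
  have "cls d (c \<odot>\<^bsub>path_alg d\<^esub> h) = cls d (c \<odot>\<^bsub>path_alg d\<^esub> f)" if "h \<in> cls d f" for h
    using cls_mem_path_coord[OF assms(1) that] assms(1)
    by (simp add: cls_eq_iff path_smult_closed path_coord_smult)
  then have "(\<Union>h\<in>cls d f. cls d (c \<odot>\<^bsub>path_alg d\<^esub> h)) = cls d (c \<odot>\<^bsub>path_alg d\<^esub> f)"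
    using cls_self[OF assms(1)] by blast
  then show "c \<odot>\<^bsub>affine_zigzag d\<^esub> cls d f = cls d (c \<odot>\<^bsub>path_alg d\<^esub> f)"
    by (simp add: affine_zigzag_def Let_def)
qed

lemma affine_one_zero: "\<one>\<^bsub>affine_zigzag d\<^esub> = cls d \<one>\<^bsub>path_alg d\<^esub>" "\<zero>\<^bsub>affine_zigzag d\<^esub> = cls d \<zero>\<^bsub>path_alg d\<^esub>"
proof -
  show "\<one>\<^bsub>affine_zigzag d\<^esub> = cls d \<one>\<^bsub>path_alg d\<^esub>" by (simp add: affine_zigzag_def FactRing_def)
  have "zigzag_ideal d = cls d \<zero>\<^bsub>path_alg d\<^esub>"
    by (simp add: I.a_rcos_const)
  then show "\<zero>\<^bsub>affine_zigzag d\<^esub> = cls d \<zero>\<^bsub>path_alg d\<^esub>"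
    by (simp add: affine_zigzag_def FactRing_def)
qed

text \<open>\<open>affine_zigzag\<close> is a record of its own with the operations of the quotient,
  so the ring axioms are carried over along the surjection from the path algebra.\<close>

lemma ring_affine: "ring (affine_zigzag d)"
proof -
  have "cls d \<in> ring_hom (path_alg d) (affine_zigzag d)"
    by (rule ring_hom_memI) (auto simp: affine_carrier affine_ops affine_one_zero)
  from PA.ring_hom_imp_img_ring[OF this] show ?thesis
    by (simp add: affine_carrier[symmetric] affine_one_zero(2)[symmetric])
qed

lemma coord_coord_fun: "coord d x \<in> coord_fun d" by (simp add: coord_def path_coord_coord_fun)

lemma coord_inj: "\<lbrakk>x \<in> carrier (affine_zigzag d); y \<in> carrier (affine_zigzag d); coord d x = coord d y\<rbrakk> \<Longrightarrow> x = y"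
  unfolding affine_carrier by (elim imageE) (simp add: coord_cls cls_eq_iff)

lemma coord_add: "\<lbrakk>x \<in> carrier (affine_zigzag d); y \<in> carrier (affine_zigzag d)\<rbrakk> \<Longrightarrow>
    coord d (x \<oplus>\<^bsub>affine_zigzag d\<^esub> y) = (\<lambda>p q t. coord d x p q t + coord d y p q t)"
  by (auto simp: affine_carrier coord_cls affine_ops path_coord_add)

lemma coord_mult: "\<lbrakk>x \<in> carrier (affine_zigzag d); y \<in> carrier (affine_zigzag d)\<rbrakk> \<Longrightarrow>
    coord d (x \<otimes>\<^bsub>affine_zigzag d\<^esub> y) = coord_mult d (coord d x) (coord d y)"
  by (auto simp: affine_carrier coord_cls affine_ops path_coord_mult)

lemma coord_smult: "x \<in> carrier (affine_zigzag d) \<Longrightarrow>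
    coord d (c \<odot>\<^bsub>affine_zigzag d\<^esub> x) = (\<lambda>p q t. c * coord d x p q t)"
  by (auto simp: affine_carrier coord_cls affine_ops path_coord_smult path_smult_closed)

lemma affine_smult_closed: "x \<in> carrier (affine_zigzag d) \<Longrightarrow> c \<odot>\<^bsub>affine_zigzag d\<^esub> x \<in> carrier (affine_zigzag d)"
  by (auto simp: affine_carrier affine_ops path_smult_closed)

lemma coord_one: "coord d \<one>\<^bsub>affine_zigzag d\<^esub> = (\<lambda>p q t. if aff_idx d p q t \<and> t = 0 then 1 else 0)"
  by (simp add: affine_one_zero coord_cls path_coord_one)

lemma coord_zero: "coord d \<zero>\<^bsub>affine_zigzag d\<^esub> = (\<lambda>p q t. 0)"
  by (simp add: affine_one_zero coord_cls path_coord_zero)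

lemma of_coord_closed: "c \<in> coord_fun d \<Longrightarrow> of_coord d c \<in> carrier (affine_zigzag d)"
  using path_rep_closed[OF _ d3] by (simp add: of_coord_def affine_carrier)

lemma coord_of_coord: "c \<in> coord_fun d \<Longrightarrow> coord d (of_coord d c) = c"
  using path_rep_closed[OF _ d3] by (simp add: of_coord_def coord_cls path_coord_path_rep d3)

lemma pth_closed: "is_path d p \<Longrightarrow> pth d p \<in> carrier (affine_zigzag d)"
  by (simp add: pth_def affine_carrier path_elem_closed)

lemma coord_pth: "is_path d p \<Longrightarrow> coord d (pth d p) = path_coord d (path_elem p)"
  by (simp add: pth_def coord_cls path_elem_closed)

interpretation A: ring "affine_zigzag d" by (rule ring_affine)

section \<open>The corner algebra without the vertex 0\<close>

lemma coord_finsum: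
  assumes "finite S" "f \<in> S \<rightarrow> carrier (affine_zigzag d)"
  shows "coord d (finsum (affine_zigzag d) f S) p q t = (\<Sum>s\<in>S. coord d (f s) p q t)"
  using assms
  by (induction S rule: finite_induct) (auto simp: coord_zero coord_add A.finsum_insert)

text \<open>Between the vertices 1, ..., d - 1 the neighbours are taken in the integers: the steps
  that wrap around the cycle have an end at 0 and are gone. The loops at 1 and at d - 1 remain, as
  each of these vertices keeps one neighbour.\<close>

definition fin_idx :: "int \<Rightarrow> int \<Rightarrow> int \<Rightarrow> bool" where
  "fin_idx p q t \<longleftrightarrow> p \<in> {1..<int d} \<and> q \<in> {1..<int d} \<and>
     (t = 0 \<and> q = p \<or> t = 1 \<and> (q = p + 1 \<or> q = p - 1) \<or> t = 2 \<and> q = p)"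

lemma fin_idx_aff_idx: "fin_idx p q t \<longleftrightarrow> aff_idx d p q t \<and> p \<ge> 1 \<and> q \<ge> 1"
proof (cases "p \<in> {0..<int d}")
  case True then show ?thesis using mod_simps[OF d3, of p] d3 by (auto simp: fin_idx_def aff_idx_def split: if_splits)
qed (auto simp: fin_idx_def aff_idx_def)

abbreviation "Zd \<equiv> finite_zigzag d"
abbreviation "Ad \<equiv> affine_zigzag d"
abbreviation "ed \<equiv> finsum Ad (\<lambda>i. pth d [i]) {1..<int d}"

lemma is_path_singleton: "i \<in> {0..<int d} \<Longrightarrow> is_path d [i]" by (simp add: is_path_def)

lemma ed_closed: "ed \<in> carrier Ad"
  by (auto intro!: A.finsum_closed pth_closed is_path_singleton)

lemma coord_idem:
  assumes "i \<in> {0..<int d}"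
  shows "coord d (pth d [i]) = (\<lambda>p q t. if p = i \<and> q = i \<and> t = 0 then 1 else 0)"
  using assms is_path_singleton[OF assms]
  by (intro ext) (auto simp: coord_pth path_coord_def path_elem_def aff_idx_def)

lemma coord_ed: "coord d ed = (\<lambda>p q t. if p = q \<and> t = 0 \<and> p \<in> {1..<int d} then 1 else 0)"
proof (intro ext)
  fix p q t
  have "coord d ed p q t = (\<Sum>i\<in>{1..<int d}. coord d (pth d [i]) p q t)"
    by (intro coord_finsum) (auto intro!: pth_closed is_path_singleton)
  also have "\<dots> = (\<Sum>i\<in>{1..<int d}. if i = p then (if p = q \<and> t = 0 then 1 else 0) else 0)"
    by (intro sum.cong) (auto simp: coord_idem)
  also have "\<dots> = (if p = q \<and> t = 0 \<and> p \<in> {1..<int d} then 1 else 0)"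
    by (simp add: sum.delta)
  finally show "coord d ed p q t = (if p = q \<and> t = 0 \<and> p \<in> {1..<int d} then 1 else 0)" .
qed

text \<open>The sum of the idempotents in P projects on the end points in P from the left and on the
  starting points in P from the right; the two cuts together give the corner.\<close>

lemma coord_mult_idem:
  assumes "c \<in> coord_fun d"
  shows "coord_mult d (\<lambda>p q t. if p = q \<and> t = 0 \<and> P p then 1 else 0) c = (\<lambda>p q t. if P p then c p q t else 0)"
    and "coord_mult d c (\<lambda>p q t. if p = q \<and> t = 0 \<and> P p then 1 else 0) = (\<lambda>p q t. if P q then c p q t else 0)"
proof -
  have c: "c p q t = 0" if "\<not> aff_idx d p q t" for p q t using that assms by (auto simp: coord_fun_def)
  have aff_idx: "q = p" "t = 2" if "aff_idx d p q t" "t \<noteq> 1" "t \<noteq> 0" for p q t using that by (auto simp: aff_idx_def)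
  have AT0: "q = p" if "aff_idx d p q 0" for p q using that by (auto simp: aff_idx_def)
  show "coord_mult d (\<lambda>p q t. if p = q \<and> t = 0 \<and> P p then 1 else 0) c = (\<lambda>p q t. if P p then c p q t else 0)"
  proof (intro ext)
    fix p q t
    show "coord_mult d (\<lambda>p q t. if p = q \<and> t = 0 \<and> P p then 1 else 0) c p q t = (if P p then c p q t else 0)"
      using c[of p q t] aff_idx[of p q t] AT0[of p q] unfolding coord_mult_def
      by (cases "t = 0"; cases "t = 1") (auto split: if_splits)
  qed
  show "coord_mult d c (\<lambda>p q t. if p = q \<and> t = 0 \<and> P p then 1 else 0) = (\<lambda>p q t. if P q then c p q t else 0)"
  proof (intro ext)
    fix p q t
    show "coord_mult d c (\<lambda>p q t. if p = q \<and> t = 0 \<and> P p then 1 else 0) p q t = (if P q then c p q t else 0)"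
      using c[of p q t] aff_idx[of p q t] AT0[of p q] unfolding coord_mult_def
      by (cases "t = 0"; cases "t = 1") (auto split: if_splits)
  qed
qed

lemma coord_corner:
  assumes "x \<in> carrier Ad"
  shows "coord d (ed \<otimes>\<^bsub>Ad\<^esub> x \<otimes>\<^bsub>Ad\<^esub> ed) =
    (\<lambda>p q t. if p \<in> {1..<int d} \<and> q \<in> {1..<int d} then coord d x p q t else 0)"
proof -
  have "coord d (ed \<otimes>\<^bsub>Ad\<^esub> x \<otimes>\<^bsub>Ad\<^esub> ed) = coord_mult d (coord_mult d (coord d ed) (coord d x)) (coord d ed)"
    by (simp add: coord_mult A.m_closed ed_closed assms)
  also have "coord_mult d (coord d ed) (coord d x) = (\<lambda>p q t. if p \<in> {1..<int d} then coord d x p q t else 0)"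
    unfolding coord_ed by (rule coord_mult_idem(1)[OF coord_coord_fun])
  also have "coord_mult d \<dots> (coord d ed) = (\<lambda>p q t. if p \<in> {1..<int d} \<and> q \<in> {1..<int d} then coord d x p q t else 0)"
  proof -
    have "(\<lambda>p q t. if p \<in> {1..<int d} then coord d x p q t else 0) \<in> coord_fun d"
      using coord_coord_fun[of x] by (auto simp: coord_fun_def)
    from coord_mult_idem(2)[OF this] show ?thesis unfolding coord_ed by (auto simp: fun_eq_iff)
  qed
  finally show ?thesis .
qed

lemma finite_sel:
  "carrier Zd = {ed \<otimes>\<^bsub>Ad\<^esub> x \<otimes>\<^bsub>Ad\<^esub> ed | x. x \<in> carrier Ad}"
  "x \<otimes>\<^bsub>Zd\<^esub> y = x \<otimes>\<^bsub>Ad\<^esub> y" "\<one>\<^bsub>Zd\<^esub> = ed" "\<zero>\<^bsub>Zd\<^esub> = \<zero>\<^bsub>Ad\<^esub>" "x \<oplus>\<^bsub>Zd\<^esub> y = x \<oplus>\<^bsub>Ad\<^esub> y"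
  "a \<odot>\<^bsub>Zd\<^esub> x = a \<odot>\<^bsub>Ad\<^esub> x"
  "homog Zd n = carrier Zd \<inter> {cls d f | f. f \<in> carrier (path_alg d) \<and> (\<forall>p. f p \<noteq> 0 \<longrightarrow> int (length p) = n + 1)}"
  by (simp_all add: finite_zigzag_def Let_def)

lemma finite_carrier: "x \<in> carrier Zd \<longleftrightarrow> x \<in> carrier Ad \<and> (\<forall>p q t. coord d x p q t \<noteq> 0 \<longrightarrow> fin_idx p q t)"
proof
  assume "x \<in> carrier Zd"
  then obtain y where y: "y \<in> carrier Ad" "x = ed \<otimes>\<^bsub>Ad\<^esub> y \<otimes>\<^bsub>Ad\<^esub> ed" by (auto simp: finite_sel)
  then show "x \<in> carrier Ad \<and> (\<forall>p q t. coord d x p q t \<noteq> 0 \<longrightarrow> fin_idx p q t)"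
    using coord_coord_fun[of y] by (auto simp: ed_closed coord_corner coord_fun_def fin_idx_aff_idx)
next
  assume x: "x \<in> carrier Ad \<and> (\<forall>p q t. coord d x p q t \<noteq> 0 \<longrightarrow> fin_idx p q t)"
  then have "coord d x p q t = 0" if "\<not> (p \<in> {1..<int d} \<and> q \<in> {1..<int d})" for p q t
    using that unfolding fin_idx_def by blast
  then have "x = ed \<otimes>\<^bsub>Ad\<^esub> x \<otimes>\<^bsub>Ad\<^esub> ed"
    using x by (intro coord_inj) (auto simp: ed_closed coord_corner fun_eq_iff)
  then show "x \<in> carrier Zd" using x by (auto simp: finite_sel)
qed

lemma finite_homog: "homog Zd n = {x \<in> carrier Zd. \<forall>p q t. coord d x p q t \<noteq> 0 \<longrightarrow> t = n}"
proof safe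
  fix x p q t assume x: "x \<in> homog Zd n" and nz: "coord d x p q t \<noteq> 0"
  obtain f where f: "f \<in> carrier (path_alg d)" "\<And>p. f p \<noteq> 0 \<Longrightarrow> int (length p) = n + 1" "x = cls d f"
    using x unfolding finite_sel(7) by blast
  have aff_idx: "aff_idx d p q t" and c: "path_coord d f p q t \<noteq> 0"
    using nz f coord_coord_fun[of x] by (auto simp: coord_fun_def coord_cls)
  have f0: "f [p] \<noteq> 0 \<Longrightarrow> n = 0" "f [p, q] \<noteq> 0 \<Longrightarrow> n = 1" "f [p, r, p] \<noteq> 0 \<Longrightarrow> n = 2" for r
    using f(2)[of "[p]"] f(2)[of "[p,q]"] f(2)[of "[p,r,p]"] by auto
  show "t = n" using c aff_idx f0 unfolding path_coord_def aff_idx_def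
    by (metis (no_types, lifting) add_cancel_right_left mult_zero_right)
next
  fix x assume x: "x \<in> carrier Zd" and t: "\<forall>p q t. coord d x p q t \<noteq> 0 \<longrightarrow> t = n"
  have xA: "x \<in> carrier Ad" using x by (simp add: finite_carrier)
  \<comment> \<open>Homogeneity of a coset asks for one homogeneous representative; the normal form
    is one, since all its terms come from nonzero coordinates.\<close>
  let ?f = "path_rep d (coord d x)"
  have f: "?f \<in> carrier (path_alg d)" by (rule path_rep_closed[OF coord_coord_fun d3])
  have "x = cls d ?f"
    using xA f by (intro coord_inj) (simp_all add: affine_carrier coord_cls path_coord_path_rep[OF coord_coord_fun d3])
  moreover have "int (length p) = n + 1" if "?f p \<noteq> 0" for p
    using that t by (auto simp: path_rep_def split: list.splits if_splits)
  ultimately show "x \<in> homog Zd n" using x f unfolding finite_sel(7) by blast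
qed (auto simp: finite_sel(7))

lemma ring_finite: "ring Zd"
proof (rule ringI)
  have cl: "x \<in> carrier Zd \<Longrightarrow> x \<in> carrier Ad" for x by (simp add: finite_carrier)
  have mcl: "x \<otimes>\<^bsub>Ad\<^esub> y \<in> carrier Zd" if x: "x \<in> carrier Zd" and y: "y \<in> carrier Zd" for x y
  proof -
    have ex: "\<exists>a. a \<in> carrier Ad \<and> x = ed \<otimes>\<^bsub>Ad\<^esub> a \<otimes>\<^bsub>Ad\<^esub> ed" if "x \<in> carrier Zd" for x
      using that unfolding finite_sel(1) mem_Collect_eq by (elim exE conjE) (intro exI conjI)
    obtain a where a: "a \<in> carrier Ad" "x = ed \<otimes>\<^bsub>Ad\<^esub> a \<otimes>\<^bsub>Ad\<^esub> ed" using ex[OF x] by (elim exE conjE)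
    obtain b where b: "b \<in> carrier Ad" "y = ed \<otimes>\<^bsub>Ad\<^esub> b \<otimes>\<^bsub>Ad\<^esub> ed" using ex[OF y] by (elim exE conjE)
    have "x \<otimes>\<^bsub>Ad\<^esub> y = ed \<otimes>\<^bsub>Ad\<^esub> (a \<otimes>\<^bsub>Ad\<^esub> ed \<otimes>\<^bsub>Ad\<^esub> (ed \<otimes>\<^bsub>Ad\<^esub> b)) \<otimes>\<^bsub>Ad\<^esub> ed"
      using a b ed_closed by (simp add: A.m_assoc)
    moreover have "a \<otimes>\<^bsub>Ad\<^esub> ed \<otimes>\<^bsub>Ad\<^esub> (ed \<otimes>\<^bsub>Ad\<^esub> b) \<in> carrier Ad"
      using a b ed_closed by (intro A.m_closed)
    ultimately show ?thesis unfolding finite_sel(1) mem_Collect_eq by (intro exI conjI)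
  qed
  have e: "ed \<otimes>\<^bsub>Ad\<^esub> ed = ed" 
  proof (rule coord_inj)
    have "coord d (ed \<otimes>\<^bsub>Ad\<^esub> ed) = coord_mult d (coord d ed) (coord d ed)" by (intro coord_mult ed_closed)
    also have "\<dots> = (\<lambda>p q t. if p \<in> {1..<int d} then coord d ed p q t else 0)"
      using coord_mult_idem(1)[OF coord_coord_fun, of "\<lambda>p. p \<in> {1..<int d}" ed] unfolding coord_ed .
    also have "\<dots> = coord d ed" unfolding coord_ed by (simp add: fun_eq_iff)
    finally show "coord d (ed \<otimes>\<^bsub>Ad\<^esub> ed) = coord d ed" .
  qed (simp_all add: ed_closed)
  have e1: "ed \<otimes>\<^bsub>Ad\<^esub> x = x" "x \<otimes>\<^bsub>Ad\<^esub> ed = x" if "x \<in> carrier Zd" for x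
    using that A.m_assoc[OF ed_closed ed_closed] e
    by (auto simp: finite_sel ed_closed A.m_assoc)
  show "abelian_group Zd"
  proof (rule abelian_groupI)
    fix x assume x: "x \<in> carrier Zd"
    have xA: "x \<in> carrier Ad" by (rule cl[OF x])
    have mA: "(-1) \<odot>\<^bsub>Ad\<^esub> x \<in> carrier Ad" by (rule affine_smult_closed[OF xA])
    have "(-1) \<odot>\<^bsub>Ad\<^esub> x \<oplus>\<^bsub>Ad\<^esub> x = \<zero>\<^bsub>Ad\<^esub>"
      by (rule coord_inj) (simp_all add: mA xA coord_add coord_smult coord_zero)
    moreover have "(-1) \<odot>\<^bsub>Ad\<^esub> x \<in> carrier Zd"
      using x mA unfolding finite_carrier by (simp add: coord_smult)
    ultimately show "\<exists>y\<in>carrier Zd. y \<oplus>\<^bsub>Zd\<^esub> x = \<zero>\<^bsub>Zd\<^esub>"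
      unfolding finite_sel(4,5) by (rule bexI)
  next
    fix x y assume x: "x \<in> carrier Zd" and y: "y \<in> carrier Zd"
    have "fin_idx p q t" if "coord d (x \<oplus>\<^bsub>Ad\<^esub> y) p q t \<noteq> 0" for p q t
    proof -
      have "coord d x p q t \<noteq> 0 \<or> coord d y p q t \<noteq> 0"
        using that unfolding coord_add[OF cl[OF x] cl[OF y]] by auto
      then show ?thesis using x y unfolding finite_carrier by blast
    qed
    then show "x \<oplus>\<^bsub>Zd\<^esub> y \<in> carrier Zd"
      using cl[OF x] cl[OF y] unfolding finite_carrier finite_sel(5) by (intro conjI allI impI A.a_closed)
  next
    show "\<zero>\<^bsub>Zd\<^esub> \<in> carrier Zd" unfolding finite_carrier finite_sel(4) by (simp add: coord_zero)
  qed (auto simp: finite_sel(4,5) cl A.a_ac)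
  have e_cl: "ed \<in> carrier Zd" 
    unfolding finite_carrier coord_ed by (simp add: ed_closed fin_idx_def)
  show "monoid Zd"
    by (rule monoidI) (auto simp: finite_sel(2,3) mcl e1 A.m_assoc cl e_cl)
qed (auto simp: finite_carrier finite_sel(2,5) A.l_distr A.r_distr)

text \<open>Away from 0 all signs are 1. Passing from residues to the integers p - 1 and p + 1 is
  harmless: the two forms differ only in terms that involve one of the vertices 0, -1 or d, and
  these vanish.\<close>

lemma coord_mult_finite:
  assumes "\<And>p q t. c p q t \<noteq> 0 \<Longrightarrow> fin_idx p q t" "\<And>p q t. c' p q t \<noteq> 0 \<Longrightarrow> fin_idx p q t"
  shows "coord_mult d c c' p q t = (if t = 0 \<and> q = p then c p p 0 * c' p p 0
     else if t = 1 then c p p 0 * c' p q 1 + c p q 1 * c' q q 0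
     else if t = 2 \<and> q = p then c p p 0 * c' p p 2 + c p p 2 * c' p p 0
       + c p (p - 1) 1 * c' (p - 1) p 1 + c p (p + 1) 1 * c' (p + 1) p 1 else 0)"
proof (cases "p \<in> {0..<int d}")
  case False
  then have "c p q t = 0" for q t using assms(1)[of p q t] unfolding fin_idx_def by (cases "c p q t = 0") auto
  moreover have "\<not> aff_idx d p q t" using False by (auto simp: aff_idx_def)
  ultimately show ?thesis by (simp add: coord_mult_def)
next
  case True
  have z: "c p q t = 0" "c' p q t = 0" if "\<not> fin_idx p q t" for p q t using that assms by blast+
  have z0: "c p 0 t = 0" "c 0 p t = 0" "c' p 0 t = 0" "c' 0 p t = 0" "c p (-1) t = 0"
    "c' (-1) p t = 0" "c' (int d) p t = 0" "c p (int d) t = 0" for t p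
    by (rule z; simp add: fin_idx_def)+
  show ?thesis
  proof (cases "aff_idx d p q t")
    case aff_idx: True
    show ?thesis
      using aff_idx mod_simps[OF d3, of p] True d3 by (auto simp: coord_mult_def aff_idx_def loop_sign_def z0 split: if_splits)
  next
    case False
    then have nFT: "c p q t = 0" "c' p q t = 0" by (auto intro!: z simp: fin_idx_aff_idx)
    have "\<not> (t = 0 \<and> q = p)" "\<not> (t = 2 \<and> q = p)" using False True by (auto simp: aff_idx_def)
    moreover have "coord_mult d c c' p q t = 0" using False by (simp add: coord_mult_def)
    ultimately show ?thesis using nFT by auto
  qed
qed

end

section \<open>Sums of shifted indecomposable projectives\<close>

text \<open>Modules and complexes use the finite zigzag algebra only through these axioms, so that
  cosets do not appear again before the locale is instantiated. Injectivity and surjectivity of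
  \<kappa> say that the triples form a basis.\<close>

locale zigzag_coords = ring A for A :: "(complex, 'a) graded" (structure) +
  fixes d :: nat and \<kappa> :: "'a \<Rightarrow> int \<Rightarrow> int \<Rightarrow> int \<Rightarrow> complex"
  assumes d3: "d \<ge> 3"
    and kappa_fin_idx: "\<lbrakk>x \<in> carrier A; \<kappa> x p q t \<noteq> 0\<rbrakk> \<Longrightarrow> fin_idx d p q t"
    and kappa_inj: "\<lbrakk>x \<in> carrier A; y \<in> carrier A; \<kappa> x = \<kappa> y\<rbrakk> \<Longrightarrow> x = y"
    and kappa_surj: "(\<And>p q t. c p q t \<noteq> 0 \<Longrightarrow> fin_idx d p q t) \<Longrightarrow> \<exists>x\<in>carrier A. \<kappa> x = c"
    and kappa_add: "\<lbrakk>x \<in> carrier A; y \<in> carrier A\<rbrakk> \<Longrightarrow> \<kappa> (x \<oplus> y) p q t = \<kappa> x p q t + \<kappa> y p q t"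
    and kappa_mult: "\<lbrakk>x \<in> carrier A; y \<in> carrier A\<rbrakk> \<Longrightarrow> \<kappa> (x \<otimes> y) p q t =
      (if t = 0 \<and> q = p then \<kappa> x p p 0 * \<kappa> y p p 0
       else if t = 1 then \<kappa> x p p 0 * \<kappa> y p q 1 + \<kappa> x p q 1 * \<kappa> y q q 0
       else if t = 2 \<and> q = p then \<kappa> x p p 0 * \<kappa> y p p 2 + \<kappa> x p p 2 * \<kappa> y p p 0
         + \<kappa> x p (p - 1) 1 * \<kappa> y (p - 1) p 1 + \<kappa> x p (p + 1) 1 * \<kappa> y (p + 1) p 1 else 0)"
    and smult_cl: "x \<in> carrier A \<Longrightarrow> a \<odot> x \<in> carrier A"
    and kappa_smult: "x \<in> carrier A \<Longrightarrow> \<kappa> (a \<odot> x) p q t = a * \<kappa> x p q t"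
    and homog_A: "homog A n = {x \<in> carrier A. \<forall>p q t. \<kappa> x p q t \<noteq> 0 \<longrightarrow> t = n}"
begin

abbreviation "F \<equiv> fin_idx d"

lemma kappa_zero: "\<kappa> \<zero> p q t = 0"
  using kappa_add[of \<zero> \<zero> p q t] by simp

lemma kappa_minus: "x \<in> carrier A \<Longrightarrow> \<kappa> (\<ominus> x) p q t = - \<kappa> x p q t"
  using kappa_add[of x "\<ominus> x" p q t] by (simp add: r_neg kappa_zero add_eq_0_iff)

lemma kappa_eqI: "\<lbrakk>x \<in> carrier A; y \<in> carrier A; \<And>p q t. \<kappa> x p q t = \<kappa> y p q t\<rbrakk> \<Longrightarrow> x = y"
  by (rule kappa_inj) (auto simp: fun_eq_iff)

lemma kappa_finsum: "\<lbrakk>finite S; f \<in> S \<rightarrow> carrier A\<rbrakk> \<Longrightarrow>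
    \<kappa> (finsum A f S) p q t = (\<Sum>s\<in>S. \<kappa> (f s) p q t)"
  by (induction S rule: finite_induct) (auto simp: kappa_zero kappa_add)

lemma smult_mult:
  assumes "x \<in> carrier A" "y \<in> carrier A"
  shows "(a \<odot> x) \<otimes> y = a \<odot> (x \<otimes> y)" "x \<otimes> (a \<odot> y) = a \<odot> (x \<otimes> y)"
proof -
  note cl = assms smult_cl[OF assms(1)] smult_cl[OF assms(2)] smult_cl[OF m_closed[OF assms]]
  have eq: "\<kappa> ((a \<odot> x) \<otimes> y) p q t = a * \<kappa> (x \<otimes> y) p q t"
    "\<kappa> (x \<otimes> (a \<odot> y)) p q t = a * \<kappa> (x \<otimes> y) p q t" for p q t
    unfolding kappa_mult[OF cl(3) cl(2)] kappa_mult[OF cl(1) cl(4)] kappa_mult[OF cl(1,2)]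
      kappa_smult[OF cl(1)] kappa_smult[OF cl(2)] by (simp_all add: distrib_left)
  show "(a \<odot> x) \<otimes> y = a \<odot> (x \<otimes> y)" "x \<otimes> (a \<odot> y) = a \<odot> (x \<otimes> y)"
    by (rule kappa_eqI; simp add: cl eq kappa_smult)+
qed

lemma smult_one_mult: "x \<in> carrier A \<Longrightarrow> (a \<odot> \<one>) \<otimes> x = a \<odot> x"
  by (simp add: smult_mult)

text \<open>
  The basis element at \<open>(p, q, t)\<close>, or 0 if there is no such triple.
\<close>

definition W :: "int \<Rightarrow> int \<Rightarrow> int \<Rightarrow> 'a" where
  "W p q t = (SOME x. x \<in> carrier A \<and> \<kappa> x = (\<lambda>p' q' t'. if p' = p \<and> q' = q \<and> t' = t \<and> F p q t then 1 else 0))"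

lemma W_props: "W p q t \<in> carrier A \<and> \<kappa> (W p q t) = (\<lambda>p' q' t'. if p' = p \<and> q' = q \<and> t' = t \<and> F p q t then 1 else 0)"
proof -
  let ?c = "\<lambda>p' q' t'. if p' = p \<and> q' = q \<and> t' = t \<and> F p q t then 1 else 0 :: complex"
  have F1: "F p' q' t'" if "?c p' q' t' \<noteq> 0" for p' q' t'
    using that by (cases "p' = p \<and> q' = q \<and> t' = t \<and> F p q t") simp_all
  have "\<exists>x\<in>carrier A. \<kappa> x = ?c" by (rule kappa_surj, rule F1)
  then obtain x where "x \<in> carrier A" "\<kappa> x = ?c" by (elim bexE)
  then have "\<exists>x. x \<in> carrier A \<and> \<kappa> x = ?c" by (intro exI conjI)
  then show ?thesis unfolding W_def by (rule someI_ex)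
qed

lemma W_closed [simp]: "W p q t \<in> carrier A"
  and kappa_W: "\<kappa> (W p q t) p' q' t' = (if p' = p \<and> q' = q \<and> t' = t \<and> F p q t then 1 else 0)"
  using W_props by auto

lemma F_deg: "F p q t \<Longrightarrow> t = 0 \<or> t = 1 \<or> t = 2" by (auto simp: fin_idx_def[OF d3])

lemma F_0: "F p q 0 \<longleftrightarrow> q = p \<and> p \<in> {1..<int d}"
  and F_2: "F p q 2 \<longleftrightarrow> q = p \<and> p \<in> {1..<int d}"
  by (auto simp: fin_idx_def[OF d3])

lemma F_range: "F p q t \<Longrightarrow> p \<in> {1..<int d} \<and> q \<in> {1..<int d}" by (simp add: fin_idx_def[OF d3])

lemma kappa_right_idem:
  assumes "x \<in> carrier A"
  shows "\<kappa> (x \<otimes> W v v 0) p q t = (if q = v then \<kappa> x p q t else 0)"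
proof -
  note * = kappa_mult[OF assms W_closed] kappa_W
  show ?thesis
  proof (cases "F p q t \<and> q = v")
    case True
    then consider "t = 0" "q = p" | "t = 1" | "t = 2" "q = p" using F_deg F_0 F_2 by blast
    moreover have "F v v 0" using True F_range[of p q t] F_0 by blast
    ultimately show ?thesis using True by cases (simp_all add: *)
  next
    case False
    have "\<kappa> x p v 2 = 0" if "v \<noteq> p" using kappa_fin_idx[OF assms, of p v 2] that F_2 by blast
    then show ?thesis using False kappa_fin_idx[OF assms, of p q t] by (auto simp: * F_0)
  qed
qed

lemma kappa_left_idem:
  assumes "x \<in> carrier A"
  shows "\<kappa> (W v v 0 \<otimes> x) p q t = (if p = v then \<kappa> x p q t else 0)"
proof -
  note * = kappa_mult[OF W_closed assms] kappa_W
  show ?thesis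
  proof (cases "F p q t \<and> p = v")
    case True
    then consider "t = 0" "q = p" | "t = 1" | "t = 2" "q = p" using F_deg F_0 F_2 by blast
    moreover have "F v v 0" using True F_range[of p q t] F_0 by blast
    ultimately show ?thesis using True by cases (simp_all add: *)
  next
    case False
    then show ?thesis using kappa_fin_idx[OF assms, of p q t] by (auto simp: * F_0)
  qed
qed

text \<open>No coefficients occur, since the two loops at a vertex p >= 1 agree without a sign. The
  right side can be 0 even if both triples exist: \<open>W p r (t + u)\<close> is 0 when (p, r, t +
  u) is not a triple, as for two arrows in the same direction.\<close>

lemma W_mult: "W p q t \<otimes> W q r u = (if F p q t \<and> F q r u then W p r (t + u) else \<zero>)"
proof (rule kappa_eqI)
  fix p' q' t'
  show "\<kappa> (W p q t \<otimes> W q r u) p' q' t' = \<kappa> (if F p q t \<and> F q r u then W p r (t + u) else \<zero>) p' q' t'"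
  proof (cases "F p q t \<and> F q r u")
    case False
    then have "\<kappa> (W p q t) a b c * \<kappa> (W q r u) a' b' c' = 0" for a b c a' b' c' by (auto simp: kappa_W)
    then show ?thesis using False by (simp only: kappa_mult[OF W_closed W_closed]) (simp add: kappa_zero)
  next
    case True
    then consider "t = 0" "q = p" | "t = 1" "u = 0" "q = r" | "t = 1" "u = 1" | "t = 1" "u = 2" "q = r"
      | "t = 2" "q = p" using F_deg F_0 F_2 by metis
    then show ?thesis using True
      by cases (auto simp: kappa_mult[OF W_closed W_closed] kappa_W fin_idx_def[OF d3])
  qed
qed auto

lemma homog_mult:
  assumes "x \<in> homog A m" "y \<in> homog A n" shows "x \<otimes> y \<in> homog A (m + n)"
proof -
  have xy: "x \<in> carrier A" "y \<in> carrier A" "\<And>p q t. \<kappa> x p q t \<noteq> 0 \<Longrightarrow> t = m" "\<And>p q t. \<kappa> y p q t \<noteq> 0 \<Longrightarrow> t = n"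
    using assms by (auto simp: homog_A)
  have "t = m + n" if "\<kappa> (x \<otimes> y) p q t \<noteq> 0" for p q t
  proof (rule ccontr)
    assume ne: "t \<noteq> m + n"
    have z: "\<kappa> x p q' u * \<kappa> y q' q u' = 0" if "u + u' = t" for q' u u'
    proof (rule ccontr)
      assume "\<not> ?thesis"
      then have "u = m" "u' = n" using xy(3)[of p q' u] xy(4)[of q' q u'] by auto
      then show False using ne that by simp
    qed
    have "\<kappa> (x \<otimes> y) p q t = 0" unfolding kappa_mult[OF xy(1,2)]
      using z[of 0 0 p] z[of 0 1 p] z[of 1 0 q] z[of 0 2 p] z[of 2 0 p] z[of 1 1 "p - 1"] z[of 1 1 "p + 1"]
      by (cases "q = p") (simp_all del: mult_eq_0_iff)
    then show False using that by simp
  qed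
  then show ?thesis using xy by (simp add: homog_A)
qed

lemma W_homog: "W p q t \<in> homog A t"
  by (auto simp: homog_A kappa_W)

text \<open>
  The carrier of \<open>Ze\<^sub>v\<close>. The vertex 0 does not occur in \<open>Z\<close>, hence \<open>C 0\<close> is the zero module and stands for the
  missing terms of the complexes.
\<close>

definition C :: "int \<Rightarrow> 'a set" where
  "C v = {x \<in> carrier A. \<forall>p q t. \<kappa> x p q t \<noteq> 0 \<longrightarrow> q = v}"

lemma C_carrier: "x \<in> C v \<Longrightarrow> x \<in> carrier A" by (simp add: C_def)

lemma C_zero [simp]: "\<zero> \<in> C v" by (simp add: C_def kappa_zero)

lemma C_add: "\<lbrakk>x \<in> C v; y \<in> C v\<rbrakk> \<Longrightarrow> x \<oplus> y \<in> C v"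
proof -
  assume xy: "x \<in> C v" "y \<in> C v"
  have "q = v" if "\<kappa> (x \<oplus> y) p q t \<noteq> 0" for p q t
  proof -
    have "\<kappa> x p q t \<noteq> 0 \<or> \<kappa> y p q t \<noteq> 0" using that xy by (auto simp: kappa_add C_carrier)
    then show ?thesis using xy unfolding C_def by blast
  qed
  then show "x \<oplus> y \<in> C v" using a_closed[OF C_carrier[OF xy(1)] C_carrier[OF xy(2)]] unfolding C_def by blast
qed

lemma C_minus: "x \<in> C v \<Longrightarrow> \<ominus> x \<in> C v"
  by (auto simp: C_def kappa_minus)

lemma C_iff: "x \<in> C v \<longleftrightarrow> x \<in> carrier A \<and> x \<otimes> W v v 0 = x"
proof safe
  assume x: "x \<in> C v"
  then have "\<kappa> x p q t = 0" if "q \<noteq> v" for p q t using that by (auto simp: C_def)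
  then show "x \<otimes> W v v 0 = x" using x
    by (intro kappa_eqI) (auto simp: kappa_right_idem C_carrier)
next
  assume x: "x \<in> carrier A" "x \<otimes> W v v 0 = x"
  have "\<kappa> x p q t = (if q = v then \<kappa> x p q t else 0)" for p q t using kappa_right_idem[OF x(1), of v p q t] x(2) by simp
  then show "x \<in> C v" using x(1) by (auto simp: C_def) metis
qed (auto simp: C_carrier)

lemma C_mult: "\<lbrakk>a \<in> carrier A; x \<in> C v\<rbrakk> \<Longrightarrow> a \<otimes> x \<in> C v"
  by (auto simp: C_iff m_assoc)

lemma C_smult: "x \<in> C v \<Longrightarrow> a \<odot> x \<in> C v"
  by (auto simp: C_iff smult_cl smult_mult)

lemma W_C: "W p v t \<in> C v" by (auto simp: C_def kappa_W)

lemma C_0: "C 0 = {\<zero>}"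
proof -
  have "x = \<zero>" if "x \<in> C 0" for x
  proof (rule kappa_eqI)
    fix p q t
    have "\<kappa> x p q t = 0"
    proof (rule ccontr)
      assume nz: "\<kappa> x p q t \<noteq> 0"
      then have "q = 0" using that by (auto simp: C_def)
      then show False using kappa_fin_idx[OF C_carrier[OF that] nz] F_range[of p q t] by simp
    qed
    then show "\<kappa> x p q t = \<kappa> \<zero> p q t" by (simp add: kappa_zero)
  qed (use that C_carrier in auto)
  then show ?thesis by auto
qed

lemma carrier_left_mod: "carrier (left_mod A (W v v 0)) = C v"
proof -
  have 1: "x \<otimes> W v v 0 \<in> C v" if "x \<in> carrier A" for x using that by (intro C_mult W_C)
  have 2: "x \<in> carrier A \<and> x = x \<otimes> W v v 0" if "x \<in> C v" for x
    using that C_iff[of x v] by metis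
  have "carrier (left_mod A (W v v 0)) = {x \<otimes> W v v 0 | x. x \<in> carrier A}"
    by (simp add: left_mod_def Let_def)
  also have "\<dots> = C v"
  proof (rule Set.set_eqI)
    fix y
    show "y \<in> {x \<otimes> W v v 0 | x. x \<in> carrier A} \<longleftrightarrow> y \<in> C v"
      unfolding mem_Collect_eq using 1 2[of y] by metis
  qed
  finally show ?thesis .
qed

text \<open>A graded module that is Ze_v shifted by s, with the operations prescribed on the carrier
  only. Degree n of the module is path length n + s. The zero module fits in as v = 0 with any s, so
  absent terms of a complex need no separate treatment.\<close>

definition brick :: "('a, 'a) graded \<Rightarrow> int \<Rightarrow> int \<Rightarrow> bool" where
  "brick N v s \<longleftrightarrow> carrier N = C v \<and> \<zero>\<^bsub>N\<^esub> = \<zero> \<and> (\<forall>x\<in>C v. \<forall>y\<in>C v. x \<oplus>\<^bsub>N\<^esub> y = x \<oplus> y) \<and>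
     (\<forall>a\<in>carrier A. \<forall>x\<in>C v. a \<odot>\<^bsub>N\<^esub> x = a \<otimes> x) \<and>
     (\<forall>n. homog N n = {x \<in> C v. \<forall>p q t. \<kappa> x p q t \<noteq> 0 \<longrightarrow> t = n + s})"

lemma brick_left_mod: "brick (left_mod A (W v v 0)) v 0"
  unfolding brick_def carrier_left_mod
proof (intro conjI)
  have "homog (left_mod A (W v v 0)) n = homog A n \<inter> carrier (left_mod A (W v v 0))" for n
    by (simp add: left_mod_def Let_def)
  then show "\<forall>n. homog (left_mod A (W v v 0)) n = {x \<in> C v. \<forall>p q t. \<kappa> x p q t \<noteq> 0 \<longrightarrow> t = n + 0}"
    unfolding carrier_left_mod homog_A by (auto dest: C_carrier)
qed (auto simp: left_mod_def Let_def)

lemma brick_zero_module: "brick (zero_module A) 0 s"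
  by (auto simp: brick_def C_0 zero_module_def kappa_zero)

lemma brick_mshift: "brick N v s \<Longrightarrow> brick (mshift k N) v (s + k)"
  by (auto simp: brick_def mshift_def add_ac)

end

section \<open>Direct sums of d bricks\<close>

context zigzag_coords
begin

abbreviation "I \<equiv> {0..<int d}"

lemma homog_add: "\<lbrakk>x \<in> homog A n; y \<in> homog A n\<rbrakk> \<Longrightarrow> x \<oplus> y \<in> homog A n"
proof -
  assume xy: "x \<in> homog A n" "y \<in> homog A n"
  then have c: "x \<in> carrier A" "y \<in> carrier A" by (auto simp: homog_A)
  have "t = n" if "\<kappa> (x \<oplus> y) p q t \<noteq> 0" for p q t
  proof -
    have "\<kappa> x p q t \<noteq> 0 \<or> \<kappa> y p q t \<noteq> 0" using that unfolding kappa_add[OF c] by auto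
    then show ?thesis using xy unfolding homog_A by blast
  qed
  then show "x \<oplus> y \<in> homog A n" using a_closed[OF c] unfolding homog_A by blast
qed

definition bricks :: "(int \<Rightarrow> ('a, 'a) graded) \<Rightarrow> (int \<Rightarrow> int) \<Rightarrow> (int \<Rightarrow> int) \<Rightarrow> bool" where
  "bricks N v s \<longleftrightarrow> (\<forall>k\<in>I. brick (N k) (v k) (s k))"

definition MC :: "(int \<Rightarrow> int) \<Rightarrow> (int \<Rightarrow> 'a) set" where
  "MC v = (\<Pi>\<^sub>E k\<in>I. C (v k))"

lemma MC_C: "x \<in> MC v \<Longrightarrow> k \<in> I \<Longrightarrow> x k \<in> C (v k)" by (auto simp: MC_def)

lemma MC_carrier: "x \<in> MC v \<Longrightarrow> k \<in> I \<Longrightarrow> x k \<in> carrier A" using MC_C C_carrier by blast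

lemma MC_I: "(\<And>k. k \<in> I \<Longrightarrow> f k \<in> C (v k)) \<Longrightarrow> (\<lambda>k\<in>I. f k) \<in> MC v" by (simp add: MC_def)

lemma MC_eqI:
  assumes "x \<in> MC v" "y \<in> MC v" "\<And>k p q t. k \<in> I \<Longrightarrow> \<kappa> (x k) p q t = \<kappa> (y k) p q t"
  shows "x = y"
proof (rule PiE_ext[of _ I "\<lambda>k. C (v k)"])
  fix k assume "k \<in> I"
  then show "x k = y k" using assms by (intro kappa_eqI) (auto intro: MC_carrier)
qed (use assms in \<open>auto simp: MC_def\<close>)

lemma M_carrier: "bricks N v s \<Longrightarrow> carrier (msum I N) = MC v"
  by (auto simp: msum_def MC_def bricks_def brick_def intro!: PiE_cong)

lemma M_zero: "bricks N v s \<Longrightarrow> \<zero>\<^bsub>msum I N\<^esub> = (\<lambda>k\<in>I. \<zero>)"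
  by (auto simp: msum_def bricks_def brick_def)

lemma M_add: "\<lbrakk>bricks N v s; x \<in> MC v; y \<in> MC v\<rbrakk> \<Longrightarrow> x \<oplus>\<^bsub>msum I N\<^esub> y = (\<lambda>k\<in>I. x k \<oplus> y k)"
  by (auto simp: msum_def bricks_def brick_def MC_C)

lemma M_smult: "\<lbrakk>bricks N v s; a \<in> carrier A; x \<in> MC v\<rbrakk> \<Longrightarrow> a \<odot>\<^bsub>msum I N\<^esub> x = (\<lambda>k\<in>I. a \<otimes> x k)"
  by (auto simp: msum_def bricks_def brick_def MC_C)

lemma M_homog: "bricks N v s \<Longrightarrow> x \<in> homog (msum I N) n \<longleftrightarrow> x \<in> MC v \<and> (\<forall>k\<in>I. x k \<in> homog A (n + s k))"
  by (auto simp: msum_def MC_def bricks_def brick_def PiE_iff homog_A C_carrier)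

lemma MC_zero: "(\<lambda>k\<in>I. \<zero>) \<in> MC v" by (rule MC_I) simp

lemma MC_add: "\<lbrakk>x \<in> MC v; y \<in> MC v\<rbrakk> \<Longrightarrow> (\<lambda>k\<in>I. x k \<oplus> y k) \<in> MC v"
  by (rule MC_I) (intro C_add MC_C)

lemma MC_minus: "x \<in> MC v \<Longrightarrow> (\<lambda>k\<in>I. \<ominus> x k) \<in> MC v"
  by (rule MC_I) (intro C_minus MC_C)

lemma MC_smult: "\<lbrakk>a \<in> carrier A; x \<in> MC v\<rbrakk> \<Longrightarrow> (\<lambda>k\<in>I. a \<otimes> x k) \<in> MC v"
  by (rule MC_I) (intro C_mult MC_C)

lemma M_abelian:
  assumes B: "bricks N v s" shows "abelian_group (msum I N)"
proof (rule abelian_groupI, unfold M_carrier[OF B] M_zero[OF B])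
  fix x assume x: "x \<in> MC v"
  show "\<exists>y\<in>MC v. y \<oplus>\<^bsub>msum I N\<^esub> x = (\<lambda>k\<in>I. \<zero>)"
    using MC_minus[OF x] x
    by (intro bexI[of _ "\<lambda>k\<in>I. \<ominus> x k"]) (auto simp: M_add[OF B] l_neg MC_carrier intro!: restrict_ext)
  show "(\<lambda>k\<in>I. \<zero>) \<oplus>\<^bsub>msum I N\<^esub> x = x"
    unfolding M_add[OF B MC_zero x]
    by (rule MC_eqI[OF MC_add[OF MC_zero x] x]) (simp add: MC_carrier[OF x])
  fix y assume y: "y \<in> MC v"
  show "x \<oplus>\<^bsub>msum I N\<^esub> y \<in> MC v" using x y by (simp add: M_add[OF B] MC_add)
  show "x \<oplus>\<^bsub>msum I N\<^esub> y = y \<oplus>\<^bsub>msum I N\<^esub> x"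
    using x y by (auto simp: M_add[OF B] MC_carrier a_comm intro!: restrict_ext)
  fix z assume z: "z \<in> MC v"
  show "x \<oplus>\<^bsub>msum I N\<^esub> y \<oplus>\<^bsub>msum I N\<^esub> z = x \<oplus>\<^bsub>msum I N\<^esub> (y \<oplus>\<^bsub>msum I N\<^esub> z)"
    using x y z by (auto simp: M_add[OF B] MC_add MC_carrier a_assoc intro!: restrict_ext)
qed (rule MC_zero)

lemma M_minus:
  assumes B: "bricks N v s" and x: "x \<in> MC v"
  shows "\<ominus>\<^bsub>msum I N\<^esub> x = (\<lambda>k\<in>I. \<ominus> x k)"
proof -
  interpret M: abelian_group "msum I N" by (rule M_abelian[OF B])
  have "(\<lambda>k\<in>I. \<ominus> x k) \<oplus>\<^bsub>msum I N\<^esub> x = \<zero>\<^bsub>msum I N\<^esub>"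
    using x MC_minus[OF x] by (auto simp: M_add[OF B] M_zero[OF B] l_neg MC_carrier intro!: restrict_ext)
  then show ?thesis using M.minus_equality x MC_minus[OF x] by (simp add: M_carrier[OF B])
qed

lemma M_finsum:
  assumes B: "bricks N v s" and S: "finite S" and f: "\<And>i. i \<in> S \<Longrightarrow> f i \<in> MC v"
  shows "finsum (msum I N) f S = (\<lambda>k\<in>I. finsum A (\<lambda>i. f i k) S)" "finsum (msum I N) f S \<in> MC v"
proof -
  interpret M: abelian_group "msum I N" by (rule M_abelian[OF B])
  have "finsum (msum I N) f S = (\<lambda>k\<in>I. finsum A (\<lambda>i. f i k) S) \<and> finsum (msum I N) f S \<in> MC v"
    using S f
  proof (induction S rule: finite_induct)
    case empty show ?case unfolding M.finsum_empty finsum_empty M_zero[OF B] using MC_zero by blast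
  next
    case (insert i S)
    have fS: "f \<in> S \<rightarrow> carrier (msum I N)" and fi: "f i \<in> carrier (msum I N)"
      using insert.prems by (auto simp: M_carrier[OF B])
    have IH: "finsum (msum I N) f S = (\<lambda>k\<in>I. finsum A (\<lambda>i. f i k) S)" "finsum (msum I N) f S \<in> MC v"
      using insert by auto
    have fiM: "f i \<in> MC v" using insert.prems by auto
    have "finsum (msum I N) f (insert i S) = f i \<oplus>\<^bsub>msum I N\<^esub> finsum (msum I N) f S"
      by (rule M.finsum_insert[OF insert(1,2) fS fi])
    also have "\<dots> = (\<lambda>k\<in>I. f i k \<oplus> finsum A (\<lambda>i. f i k) S)"
      unfolding M_add[OF B fiM IH(2)] by (rule restrict_ext) (simp add: IH(1))
    also have "\<dots> = (\<lambda>k\<in>I. finsum A (\<lambda>i. f i k) (insert i S))"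
    proof (rule restrict_ext)
      fix k assume k: "k \<in> I"
      show "f i k \<oplus> finsum A (\<lambda>i. f i k) S = finsum A (\<lambda>i. f i k) (insert i S)"
        by (rule finsum_insert[symmetric]) (use insert k MC_carrier in \<open>auto simp: Pi_iff\<close>)
    qed
    finally show ?case
      using MC_add[OF fiM IH(2)] IH(1) M_add[OF B fiM IH(2)]
        M.finsum_insert[OF insert(1,2) fS fi] by metis
  qed
  then show "finsum (msum I N) f S = (\<lambda>k\<in>I. finsum A (\<lambda>i. f i k) S)" "finsum (msum I N) f S \<in> MC v" by auto
qed

lemma kappa_M_finsum:
  assumes B: "bricks N v s" and S: "finite S" and f: "\<And>i. i \<in> S \<Longrightarrow> f i \<in> MC v" and k: "k \<in> I"
  shows "\<kappa> (finsum (msum I N) f S k) p q t = (\<Sum>i\<in>S. \<kappa> (f i k) p q t)"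
  using k MC_carrier[OF f] by (simp add: M_finsum(1)[OF B S f] kappa_finsum[OF S] Pi_iff)

definition deg_part :: "int \<Rightarrow> 'a \<Rightarrow> 'a" where
  "deg_part n x = (SOME y. y \<in> carrier A \<and> \<kappa> y = (\<lambda>p q t. if t = n then \<kappa> x p q t else 0))"

lemma deg_part: assumes "x \<in> carrier A"
  shows "deg_part n x \<in> carrier A" "\<kappa> (deg_part n x) p q t = (if t = n then \<kappa> x p q t else 0)"
proof -
  have "\<exists>y\<in>carrier A. \<kappa> y = (\<lambda>p q t. if t = n then \<kappa> x p q t else 0)"
  proof (rule kappa_surj)
    fix p q t assume "(if t = n then \<kappa> x p q t else 0) \<noteq> 0"
    then show "F p q t" using kappa_fin_idx[OF assms] by (cases "t = n") simp_all
  qed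
  then have "\<exists>y. y \<in> carrier A \<and> \<kappa> y = (\<lambda>p q t. if t = n then \<kappa> x p q t else 0)" by metis
  from someI_ex[OF this] show "deg_part n x \<in> carrier A" "\<kappa> (deg_part n x) p q t = (if t = n then \<kappa> x p q t else 0)"
    unfolding deg_part_def by simp_all
qed

text \<open>Uniqueness of the homogeneous decomposition: in the summand k a vector of degree n has
  path length n + s k only, so the coordinates of that length single out one component of the
  sum.\<close>

lemma M_decomp_coord:
  assumes B: "bricks N v s" and c: "\<And>n. c n \<in> homog (msum I N) n" and fin: "finite {n. c n \<noteq> \<zero>\<^bsub>msum I N\<^esub>}"
    and x: "x = finsum (msum I N) c {n. c n \<noteq> \<zero>\<^bsub>msum I N\<^esub>}" and k: "k \<in> I"
  shows "\<kappa> (c n k) p q t = (if t = n + s k then \<kappa> (x k) p q t else 0)"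
proof -
  let ?S = "{n. c n \<noteq> \<zero>\<^bsub>msum I N\<^esub>}"
  have cM: "c n \<in> MC v" and chain: "\<And>p q t. \<kappa> (c n k) p q t \<noteq> 0 \<Longrightarrow> t = n + s k" for n
    using c[of n] k unfolding M_homog[OF B] homog_A by blast+
  have 0: "\<kappa> (c n k) p q t = 0" if "n \<notin> ?S" for n p q t
    using that k by (simp add: M_zero[OF B] kappa_zero)
  have "\<kappa> (x k) p q (n + s k) = (\<Sum>m\<in>?S. \<kappa> (c m k) p q (n + s k))"
    unfolding x by (rule kappa_M_finsum[OF B fin cM k])
  also have "\<dots> = (\<Sum>m\<in>?S. if m = n then \<kappa> (c n k) p q (n + s k) else 0)"
    using chain by (intro sum.cong refl) (metis add_right_cancel)
  also have "\<dots> = \<kappa> (c n k) p q (n + s k)"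
    using 0 fin by (simp add: sum.delta)
  finally show ?thesis using chain[of n p q t] by auto
qed

lemma M_graded_module:
  assumes B: "bricks N v s" shows "graded_left_module A (msum I N)"
proof -
  interpret M: abelian_group "msum I N" by (rule M_abelian[OF B])
  show ?thesis
  proof (intro graded_left_module.intro graded_left_module_axioms.intro ring_axioms M.abelian_group_axioms,
      unfold M_carrier[OF B])
    fix a x assume ax: "a \<in> carrier A" "x \<in> MC v"
    then show "a \<odot>\<^bsub>msum I N\<^esub> x \<in> MC v" by (simp add: M_smult[OF B] MC_smult)
    fix b assume b: "b \<in> carrier A"
    show "(a \<oplus> b) \<odot>\<^bsub>msum I N\<^esub> x = a \<odot>\<^bsub>msum I N\<^esub> x \<oplus>\<^bsub>msum I N\<^esub> b \<odot>\<^bsub>msum I N\<^esub> x"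
      using ax b by (auto simp: M_smult[OF B] M_add[OF B] MC_smult l_distr MC_carrier intro!: restrict_ext)
    show "(a \<otimes> b) \<odot>\<^bsub>msum I N\<^esub> x = a \<odot>\<^bsub>msum I N\<^esub> (b \<odot>\<^bsub>msum I N\<^esub> x)"
      using ax b by (auto simp: M_smult[OF B] MC_smult m_assoc MC_carrier intro!: restrict_ext)
  next
    fix a x y assume ax: "a \<in> carrier A" "x \<in> MC v" "y \<in> MC v"
    show "a \<odot>\<^bsub>msum I N\<^esub> (x \<oplus>\<^bsub>msum I N\<^esub> y) = a \<odot>\<^bsub>msum I N\<^esub> x \<oplus>\<^bsub>msum I N\<^esub> a \<odot>\<^bsub>msum I N\<^esub> y"
      using ax by (auto simp: M_smult[OF B] M_add[OF B] MC_smult MC_add r_distr MC_carrier intro!: restrict_ext)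
  next
    fix x assume x: "x \<in> MC v"
    show "\<one> \<odot>\<^bsub>msum I N\<^esub> x = x"
      using x by (intro MC_eqI[of _ v]) (auto simp: M_smult[OF B] MC_smult MC_carrier)
    show "\<exists>!c. (\<forall>n. c n \<in> homog (msum I N) n) \<and> finite {n. c n \<noteq> \<zero>\<^bsub>msum I N\<^esub>} \<and>
          x = (\<Oplus>\<^bsub>msum I N\<^esub> n \<in> {n. c n \<noteq> \<zero>\<^bsub>msum I N\<^esub>}. c n)"
    proof (rule ex1I)
      let ?c = "\<lambda>n. \<lambda>k\<in>I. deg_part (n + s k) (x k)"
      have xk: "x k \<in> carrier A" if "k \<in> I" for k using MC_carrier[OF x that] .
      have cM: "?c n \<in> MC v" for n
      proof (rule MC_I)
        fix k assume k: "k \<in> I"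
        have "q = v k" if "\<kappa> (deg_part (n + s k) (x k)) p q t \<noteq> 0" for p q t
          using MC_C[OF x k] that unfolding C_def deg_part(2)[OF xk[OF k]] by (cases "t = n + s k") auto
        then show "deg_part (n + s k) (x k) \<in> C (v k)" using deg_part(1)[OF xk[OF k]] unfolding C_def by blast
      qed
      have chain: "?c n \<in> homog (msum I N) n" for n
        unfolding M_homog[OF B] using cM deg_part[OF xk] by (auto simp: homog_A)
      \<comment> \<open>Path lengths are 0, 1 or 2, so each summand contributes at most three
        degrees.\<close>
      have "{n. ?c n \<noteq> \<zero>\<^bsub>msum I N\<^esub>} \<subseteq> (\<lambda>(k, t). t - s k) ` (I \<times> {0, 1, 2})"
      proof
        fix n assume "n \<in> {n. ?c n \<noteq> \<zero>\<^bsub>msum I N\<^esub>}"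
        then have "\<exists>k\<in>I. deg_part (n + s k) (x k) \<noteq> \<zero>" unfolding M_zero[OF B] by (auto intro!: restrict_ext)
        then obtain k where k: "k \<in> I" "deg_part (n + s k) (x k) \<noteq> \<zero>" by blast
        have "\<exists>p q t. \<kappa> (deg_part (n + s k) (x k)) p q t \<noteq> 0"
        proof (rule ccontr)
          assume "\<not> ?thesis"
          then have "deg_part (n + s k) (x k) = \<zero>"
            using deg_part[OF xk[OF k(1)]] by (intro kappa_eqI) (auto simp: kappa_zero)
          then show False using k by simp
        qed
        then obtain p q t where "\<kappa> (deg_part (n + s k) (x k)) p q t \<noteq> 0" by blast
        then have "t = n + s k" "F p q t" using deg_part(2)[OF xk[OF k(1)]] kappa_fin_idx[OF xk[OF k(1)]] by (auto split: if_splits)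
        then have "n = t - s k" "t \<in> {0,1,2}" using F_deg by auto
        then show "n \<in> (\<lambda>(k, t). t - s k) ` (I \<times> {0, 1, 2})" using k(1) by (intro image_eqI[of _ _ "(k, t)"]) auto
      qed
      then have fin: "finite {n. ?c n \<noteq> \<zero>\<^bsub>msum I N\<^esub>}" by (rule finite_subset) auto
      have "x = (\<Oplus>\<^bsub>msum I N\<^esub> n \<in> {n. ?c n \<noteq> \<zero>\<^bsub>msum I N\<^esub>}. ?c n)"
      proof (rule MC_eqI[OF x M_finsum(2)[OF B fin cM]])
        fix k p q t assume k: "k \<in> I"
        let ?S = "{n. ?c n \<noteq> \<zero>\<^bsub>msum I N\<^esub>}"
        have "\<kappa> ((\<Oplus>\<^bsub>msum I N\<^esub> n \<in> ?S. ?c n) k) p q t = (\<Sum>n\<in>?S. \<kappa> (?c n k) p q t)"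
          by (rule kappa_M_finsum[OF B fin cM k])
        also have "\<dots> = (\<Sum>n\<in>?S. if n = t - s k then \<kappa> (x k) p q t else 0)"
          using k deg_part(2)[OF xk[OF k]] by (intro sum.cong refl) auto
        also have "\<dots> = (if t - s k \<in> ?S then \<kappa> (x k) p q t else 0)"
          using fin by (simp add: sum.delta)
        also have "\<dots> = \<kappa> (x k) p q t"
        proof (cases "t - s k \<in> ?S")
          case False
          then have "?c (t - s k) k = \<zero>" using k by (simp add: M_zero[OF B])
          then have "\<kappa> (x k) p q t = 0" using k deg_part(2)[OF xk[OF k], of t p q t] by (simp add: kappa_zero)
          then show ?thesis using False by simp
        qed simp
        finally show "\<kappa> (x k) p q t = \<kappa> ((\<Oplus>\<^bsub>msum I N\<^esub> n \<in> ?S. ?c n) k) p q t" by simp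
      qed
      then show "(\<forall>n. ?c n \<in> homog (msum I N) n) \<and> finite {n. ?c n \<noteq> \<zero>\<^bsub>msum I N\<^esub>} \<and>
          x = (\<Oplus>\<^bsub>msum I N\<^esub> n \<in> {n. ?c n \<noteq> \<zero>\<^bsub>msum I N\<^esub>}. ?c n)"
        using chain fin by blast
      fix c assume c: "(\<forall>n. c n \<in> homog (msum I N) n) \<and> finite {n. c n \<noteq> \<zero>\<^bsub>msum I N\<^esub>} \<and>
          x = (\<Oplus>\<^bsub>msum I N\<^esub> n \<in> {n. c n \<noteq> \<zero>\<^bsub>msum I N\<^esub>}. c n)"
      have cm: "c n \<in> MC v" for n using c unfolding M_homog[OF B] by blast
      show "c = ?c"
      proof
        fix n
        show "c n = ?c n"
        proof (rule MC_eqI[OF cm cM])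
          fix k p q t assume k: "k \<in> I"
          have "\<kappa> (c n k) p q t = (if t = n + s k then \<kappa> (x k) p q t else 0)"
            using c by (intro M_decomp_coord[OF B _ _ _ k]) auto
          then show "\<kappa> (c n k) p q t = \<kappa> (?c n k) p q t" using k deg_part(2)[OF xk[OF k]] by simp
        qed
      qed
    qed
  next
    fix n
    show "additive_subgroup (homog (msum I N) n) (msum I N)"
    proof (rule additive_subgroupI, rule M.add.subgroupI)
      show "homog (msum I N) n \<subseteq> carrier (msum I N)" using M_homog[OF B] by (auto simp: M_carrier[OF B])
      have "(\<lambda>k\<in>I. \<zero>) \<in> homog (msum I N) n" unfolding M_homog[OF B] using MC_zero by (auto simp: homog_A kappa_zero)
      then show "homog (msum I N) n \<noteq> {}" by blast
    next
      fix x assume "x \<in> homog (msum I N) n"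
      then show "\<ominus>\<^bsub>msum I N\<^esub> x \<in> homog (msum I N) n"
        using M_minus[OF B, of x] MC_minus[of x v] unfolding M_homog[OF B]
        by (auto simp: homog_A kappa_minus)
      fix y assume "y \<in> homog (msum I N) n"
      with \<open>x \<in> homog (msum I N) n\<close> show "x \<oplus>\<^bsub>msum I N\<^esub> y \<in> homog (msum I N) n"
        using M_add[OF B, of x y] MC_add[of x v y] unfolding M_homog[OF B]
        by (auto intro: homog_add)
    qed
  next
    fix a m x n assume "a \<in> homog A m" "x \<in> homog (msum I N) n"
    then show "a \<odot>\<^bsub>msum I N\<^esub> x \<in> homog (msum I N) (m + n)"
      using M_smult[OF B, of a x] MC_smult[of a x v] homog_mult[of a m] unfolding M_homog[OF B]
      by (auto simp: homog_A add.assoc)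
  qed
qed

lemma homog_smult_A: "x \<in> homog A n \<Longrightarrow> a \<odot> x \<in> homog A n"
  by (auto simp: homog_A smult_cl kappa_smult)

lemma homog_zero: "\<zero> \<in> homog A n" by (simp add: homog_A kappa_zero)

lemma homog_finsum: "\<lbrakk>finite S; \<And>i. i \<in> S \<Longrightarrow> f i \<in> homog A n\<rbrakk> \<Longrightarrow> finsum A f S \<in> homog A n"
proof (induction S rule: finite_induct)
  case (insert i S)
  have "f i \<in> carrier A" "f \<in> S \<rightarrow> carrier A" using insert.prems by (auto simp: homog_A)
  then show ?case using insert by (simp add: homog_add)
qed (simp add: homog_zero)

lemma C_finsum: "\<lbrakk>finite S; \<And>i. i \<in> S \<Longrightarrow> f i \<in> C v\<rbrakk> \<Longrightarrow> finsum A f S \<in> C v"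
proof (induction S rule: finite_induct)
  case (insert i S)
  have "f i \<in> carrier A" "f \<in> S \<rightarrow> carrier A" using insert.prems C_carrier by auto
  then show ?case using insert by (simp add: C_add)
qed simp

lemma C_left_mult: "x \<in> C v \<Longrightarrow> x \<otimes> W v v 0 = x" by (simp add: C_iff)

definition slot :: "int \<Rightarrow> 'a \<Rightarrow> int \<Rightarrow> 'a" where
  "slot k x = (\<lambda>l\<in>I. if l = k then x else \<zero>)"

lemma slot_MC: "x \<in> C (v k) \<Longrightarrow> slot k x \<in> MC v"
  unfolding slot_def by (rule MC_I) auto

lemma M_fin_dim:
  assumes B: "bricks N v s" shows "fin_dim A (msum I N)"
proof -
  interpret M: abelian_group "msum I N" by (rule M_abelian[OF B])
  let ?J = "{(k, p, t). k \<in> I \<and> F p (v k) t}"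
  let ?g = "\<lambda>(k, p, t). slot k (W p (v k) t)"
  have fJ: "finite ?J"
    by (rule finite_subset[of _ "I \<times> I \<times> {0, 1, 2}"]) (auto dest: F_range F_deg)
  have gM: "?g j \<in> MC v" if "j \<in> ?J" for j using that by (auto intro!: slot_MC W_C)
  have kg: "\<kappa> (?g (k, p, t) k') p' q' t' = (if k' = k \<and> p' = p \<and> q' = v k \<and> t' = t then 1 else 0)"
    if "(k, p, t) \<in> ?J" "k' \<in> I" for k p t k' p' q' t'
    using that by (simp add: slot_def kappa_W kappa_zero)
  have inj: "inj_on ?g ?J"
  proof (rule inj_onI)
    fix j j' assume j: "j \<in> ?J" "j' \<in> ?J" and eq: "?g j = ?g j'"
    obtain k p t k' p' t' where jj: "j = (k, p, t)" "j' = (k', p', t')" by (metis prod.exhaust)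
    have "\<kappa> (?g j k) p (v k) t = 1" using kg[of k p t k p "v k" t] j jj by simp
    then have "\<kappa> (?g j' k) p (v k) t = 1" using eq by simp
    then show "j = j'" using kg[of k' p' t' k p "v k" t] j jj by (auto split: if_splits)
  qed
  show ?thesis unfolding fin_dim_def M_carrier[OF B]
  proof (intro exI[of _ "?g ` ?J"] conjI ballI)
    fix x assume x: "x \<in> MC v"
    \<comment> \<open>The coefficients are indexed by the vectors of the spanning set and not by
      triples; injectivity of \<open>?g\<close> recovers the index of a vector.\<close>
    let ?c = "\<lambda>b. case inv_into ?J ?g b of (k, p, t) \<Rightarrow> \<kappa> (x k) p (v k) t"
    let ?f = "\<lambda>b. (?c b \<odot> \<one>) \<odot>\<^bsub>msum I N\<^esub> b"
    have fM: "?f (?g j) \<in> MC v" if "j \<in> ?J" for j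
      using gM[OF that] by (simp add: M_smult[OF B] MC_smult smult_cl)
    have "finsum (msum I N) ?f (?g ` ?J) = finsum (msum I N) (\<lambda>j. ?f (?g j)) ?J"
      by (rule M.finsum_reindex[OF _ inj]) (use fM in \<open>auto simp: M_carrier[OF B]\<close>)
    also have "\<dots> = x"
    proof (rule MC_eqI[OF M_finsum(2)[OF B fJ fM] x])
      fix k' p' q' t' assume k': "k' \<in> I"
      have xk: "x k' \<in> carrier A" by (rule MC_carrier[OF x k'])
      have "\<kappa> (finsum (msum I N) (\<lambda>j. ?f (?g j)) ?J k') p' q' t' = (\<Sum>j\<in>?J. \<kappa> (?f (?g j) k') p' q' t')"
        by (rule kappa_M_finsum[OF B fJ fM k'])
      also have "\<dots> = (\<Sum>j\<in>?J. if j = (k', p', t') then (if q' = v k' then \<kappa> (x k') p' q' t' else 0) else 0)"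
      proof (rule sum.cong[OF refl])
        fix j assume j: "j \<in> ?J"
        obtain k p t where jj: "j = (k, p, t)" by (metis prod.exhaust)
        have e1: "\<kappa> (?f (?g j) k') p' q' t' = ?c (?g j) * \<kappa> (?g j k') p' q' t'"
          using gM[OF j] k' MC_carrier[OF gM[OF j] k'] by (simp add: M_smult[OF B] smult_cl smult_one_mult kappa_smult)
        have e2: "?c (?g j) = \<kappa> (x k) p (v k) t"
          using inv_into_f_f[OF inj j] jj by simp
        have e3: "\<kappa> (?g j k') p' q' t' = (if k' = k \<and> p' = p \<and> q' = v k \<and> t' = t then 1 else 0)"
          unfolding jj by (rule kg) (use j jj k' in auto)
        have e4: "\<kappa> (x k) p (v k) t * (if k' = k \<and> p' = p \<and> q' = v k \<and> t' = t then 1 else 0) =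
            (if j = (k', p', t') then (if q' = v k' then \<kappa> (x k') p' q' t' else 0) else 0)"
          using jj by simp
        show "\<kappa> (?f (?g j) k') p' q' t' =
            (if j = (k', p', t') then (if q' = v k' then \<kappa> (x k') p' q' t' else 0) else 0)"
          by (rule trans[OF trans[OF e1 arg_cong2[where f = "(*)", OF e2 e3]] e4])
      qed
      also have "\<dots> = (if (k', p', t') \<in> ?J then (if q' = v k' then \<kappa> (x k') p' q' t' else 0) else 0)"
        using fJ by (simp add: sum.delta)
      also have "\<dots> = \<kappa> (x k') p' q' t'"
      proof (cases "\<kappa> (x k') p' q' t' = 0")
        case False
        then have "q' = v k'" using MC_C[OF x k'] unfolding C_def by blast
        then show ?thesis using kappa_fin_idx[OF xk False] k' by simp
      qed auto
      finally show "\<kappa> (finsum (msum I N) (\<lambda>j. ?f (?g j)) ?J k') p' q' t' = \<kappa> (x k') p' q' t'" .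
    qed
    finally have "finsum (msum I N) ?f (?g ` ?J) = x" .
    then show "\<exists>c. x = (\<Oplus>\<^bsub>msum I N\<^esub>b\<in>?g ` ?J. (c b \<odot> \<one>) \<odot>\<^bsub>msum I N\<^esub> b)"
      by (intro exI[of _ ?c], rule sym)
  next
    show "?g ` ?J \<subseteq> MC v" using gM by (rule image_subsetI)
  qed (rule finite_imageI[OF fJ])
qed

text \<open>The sum is a retract of d shifted copies of the regular module: each summand is included
  as it stands, and right multiplication by the idempotent at v k projects back. For an absent term
  the idempotent is 0 and the copy is killed.\<close>

lemma M_projective:
  assumes B: "bricks N v s" shows "gr_projective A (msum I N)"
proof -
  let ?F = "msum {..<d} (\<lambda>j. mshift (s (int j)) (left_mod A \<one>))"
  have carr1: "{x \<otimes> \<one> | x. x \<in> carrier A} = carrier A" by force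
  have Fc: "carrier ?F = (\<Pi>\<^sub>E j\<in>{..<d}. carrier A)"
    by (simp add: msum_def mshift_def left_mod_def Let_def carr1)
  have Fa: "x \<oplus>\<^bsub>?F\<^esub> y = (\<lambda>j\<in>{..<d}. x j \<oplus> y j)" for x y
    by (simp add: msum_def mshift_def left_mod_def Let_def)
  have Fs: "a \<odot>\<^bsub>?F\<^esub> y = (\<lambda>j\<in>{..<d}. a \<otimes> y j)" for a y
    by (simp add: msum_def mshift_def left_mod_def Let_def)
  have Fh: "homog ?F n = (\<Pi>\<^sub>E j\<in>{..<d}. homog A (n + s (int j)))" for n
  proof -
    have "homog A m \<inter> carrier A = homog A m" for m by (auto simp: homog_A)
    then show ?thesis by (simp add: msum_def mshift_def left_mod_def Let_def carr1)
  qed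
  let ?i = "\<lambda>x\<in>carrier (msum I N). \<lambda>j\<in>{..<d}. x (int j)"
  let ?p = "\<lambda>y\<in>carrier ?F. \<lambda>k\<in>I. y (nat k) \<otimes> W (v k) (v k) 0"
  have jI: "int j \<in> I" if "j \<in> {..<d}" for j using that by auto
  have kn: "nat k \<in> {..<d}" if "k \<in> I" for k using that by auto
  have i: "?i \<in> gr_hom A (msum I N) ?F"
    unfolding gr_hom_def mem_Collect_eq
  proof (intro conjI ballI allI)
    show "?i \<in> carrier (msum I N) \<rightarrow>\<^sub>E carrier ?F"
      unfolding Fc M_carrier[OF B] using MC_carrier jI by (auto simp: PiE_iff)
  next
    fix x y assume "x \<in> carrier (msum I N)" "y \<in> carrier (msum I N)"
    then show "?i (x \<oplus>\<^bsub>msum I N\<^esub> y) = ?i x \<oplus>\<^bsub>?F\<^esub> ?i y"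
      unfolding Fa M_carrier[OF B] by (auto simp: M_add[OF B] MC_add intro!: restrict_ext)
  next
    fix a x assume "a \<in> carrier A" "x \<in> carrier (msum I N)"
    then show "?i (a \<odot>\<^bsub>msum I N\<^esub> x) = a \<odot>\<^bsub>?F\<^esub> ?i x"
      unfolding Fs M_carrier[OF B] by (auto simp: M_smult[OF B] MC_smult intro!: restrict_ext)
  next
    fix n
    show "?i ` homog (msum I N) n \<subseteq> homog ?F n"
      unfolding Fh using M_homog[OF B] M_carrier[OF B] jI by (auto simp: PiE_iff extensional_def split: if_splits)
  qed
  have p: "?p \<in> gr_hom A ?F (msum I N)"
    unfolding gr_hom_def mem_Collect_eq
  proof (intro conjI ballI allI)
    show "?p \<in> carrier ?F \<rightarrow>\<^sub>E carrier (msum I N)"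
      unfolding Fc M_carrier[OF B] using kn by (auto simp: PiE_iff intro!: MC_I C_mult W_C)
  next
    fix x y assume xy: "x \<in> carrier ?F" "y \<in> carrier ?F"
    have xA: "x (nat k) \<in> carrier A" "y (nat k) \<in> carrier A" if "k \<in> I" for k
      using xy kn[OF that] unfolding Fc by (auto simp: PiE_iff)
    have pM: "?p x \<in> MC v" "?p y \<in> MC v" using xy xA by (auto intro!: MC_I C_mult W_C)
    have "x \<oplus>\<^bsub>?F\<^esub> y \<in> carrier ?F" using xy unfolding Fa Fc by (auto simp: PiE_iff)
    then have "?p (x \<oplus>\<^bsub>?F\<^esub> y) = (\<lambda>k\<in>I. (x (nat k) \<oplus> y (nat k)) \<otimes> W (v k) (v k) 0)"
      using kn by (auto simp: Fa intro!: restrict_ext)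
    also have "\<dots> = ?p x \<oplus>\<^bsub>msum I N\<^esub> ?p y"
      unfolding M_add[OF B pM] using xy xA by (auto simp: l_distr intro!: restrict_ext)
    finally show "?p (x \<oplus>\<^bsub>?F\<^esub> y) = ?p x \<oplus>\<^bsub>msum I N\<^esub> ?p y" .
  next
    fix a x assume xy: "a \<in> carrier A" "x \<in> carrier ?F"
    have xA: "x (nat k) \<in> carrier A" if "k \<in> I" for k
      using xy kn[OF that] unfolding Fc by (auto simp: PiE_iff)
    have pM: "?p x \<in> MC v" using xy xA by (auto intro!: MC_I C_mult W_C)
    have "a \<odot>\<^bsub>?F\<^esub> x \<in> carrier ?F" using xy unfolding Fs Fc by (auto simp: PiE_iff)
    then have "?p (a \<odot>\<^bsub>?F\<^esub> x) = (\<lambda>k\<in>I. (a \<otimes> x (nat k)) \<otimes> W (v k) (v k) 0)"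
      using kn by (auto simp: Fs intro!: restrict_ext)
    also have "\<dots> = a \<odot>\<^bsub>msum I N\<^esub> ?p x"
      unfolding M_smult[OF B xy(1) pM] using xy xA by (auto simp: m_assoc intro!: restrict_ext)
    finally show "?p (a \<odot>\<^bsub>?F\<^esub> x) = a \<odot>\<^bsub>msum I N\<^esub> ?p x" .
  next
    fix n
    show "?p ` homog ?F n \<subseteq> homog (msum I N) n"
    proof
      fix y assume "y \<in> ?p ` homog ?F n"
      then obtain x where x: "x \<in> homog ?F n" "y = ?p x" by blast
      have xh: "x (nat k) \<in> homog A (n + s k)" if "k \<in> I" for k
        using PiE_mem[OF x(1)[unfolded Fh] kn[OF that]] that by simp
      have xA: "x (nat k) \<in> carrier A" if "k \<in> I" for k using xh[OF that] by (simp add: homog_A)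
      have "x \<in> carrier ?F" using x(1) unfolding Fh Fc by (auto simp: PiE_iff homog_A)
      then have y: "y = (\<lambda>k\<in>I. x (nat k) \<otimes> W (v k) (v k) 0)" using x(2) by simp
      have "y \<in> MC v" unfolding y by (intro MC_I C_mult W_C xA)
      moreover have "y k \<in> homog A (n + s k)" if "k \<in> I" for k
        using homog_mult[OF xh[OF that] W_homog[of "v k" "v k" 0]] that by (simp add: y)
      ultimately show "y \<in> homog (msum I N) n" unfolding M_homog[OF B] by blast
    qed
  qed
  have "?p (?i x) = x" if "x \<in> carrier (msum I N)" for x
  proof -
    have x: "x \<in> MC v" using that by (simp add: M_carrier[OF B])
    have "?i x \<in> carrier ?F" unfolding Fc using x MC_carrier jI that by (auto simp: PiE_iff)
    then have "?p (?i x) = (\<lambda>k\<in>I. x k \<otimes> W (v k) (v k) 0)"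
      using that kn by (auto intro!: restrict_ext)
    also have "\<dots> = (\<lambda>k\<in>I. x k)" by (rule restrict_ext) (rule C_left_mult[OF MC_C[OF x]])
    also have "\<dots> = x" using x unfolding MC_def by (metis PiE_restrict)
    finally show ?thesis .
  qed
  then show ?thesis unfolding gr_projective_def Let_def
    using i p by (intro exI[of _ d] exI[of _ "\<lambda>j. s (int j)"] bexI[of _ ?i] bexI[of _ ?p]) auto
qed

lemma M_fgproj: "bricks N v s \<Longrightarrow> fgproj A (msum I N)"
  unfolding fgproj_def using M_graded_module M_fin_dim M_projective by blast

end

section \<open>Graded homomorphisms as scalar matrices\<close>

context zigzag_coords
begin

definition act :: "(int \<Rightarrow> int) \<Rightarrow> (int \<Rightarrow> int) \<Rightarrow> (int \<Rightarrow> int) \<Rightarrow> (int \<Rightarrow> int) \<Rightarrow> (int \<Rightarrow> int \<Rightarrow> complex) \<Rightarrow>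
    (int \<Rightarrow> 'a) \<Rightarrow> int \<Rightarrow> 'a" where
  "act v s v' s' m x = (\<lambda>l\<in>I. finsum A (\<lambda>k. x k \<otimes> (m k l \<odot> W (v k) (v' l) (s' l - s k))) I)"

text \<open>
  The map with matrix \<open>m\<close>, where \<open>v\<close>, \<open>s\<close> (and \<open>v'\<close>, \<open>s'\<close>) are the vertices and the grading shifts of the summands
  of the source (and target). The entry \<open>m k l\<close> is irrelevant if the basis element is 0.
\<close>

definition hom :: "(int \<Rightarrow> int) \<Rightarrow> (int \<Rightarrow> int) \<Rightarrow> (int \<Rightarrow> int) \<Rightarrow> (int \<Rightarrow> int) \<Rightarrow> (int \<Rightarrow> int \<Rightarrow> complex) \<Rightarrow>
    (int \<Rightarrow> 'a) \<Rightarrow> int \<Rightarrow> 'a" where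
  "hom v s v' s' m = (\<lambda>x\<in>MC v. act v s v' s' m x)"

definition mat :: "(int \<Rightarrow> int) \<Rightarrow> (int \<Rightarrow> int) \<Rightarrow> (int \<Rightarrow> int) \<Rightarrow> (int \<Rightarrow> int) \<Rightarrow>
    ((int \<Rightarrow> 'a) \<Rightarrow> int \<Rightarrow> 'a) \<Rightarrow> int \<Rightarrow> int \<Rightarrow> complex" where
  "mat v s v' s' f k l = \<kappa> (f (slot k (W (v k) (v k) 0)) l) (v k) (v' l) (s' l - s k)"

lemma act_term_C: "x \<in> MC v \<Longrightarrow> k \<in> I \<Longrightarrow> x k \<otimes> (a \<odot> W p q t) \<in> C q"
  by (intro C_mult C_smult W_C MC_carrier)

lemma act_MC: "x \<in> MC v \<Longrightarrow> act v s v' s' m x \<in> MC v'"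
  unfolding act_def by (intro MC_I C_finsum act_term_C) auto

lemma hom_MC: "x \<in> MC v \<Longrightarrow> hom v s v' s' m x \<in> MC v'"
  by (simp add: hom_def act_MC)

lemma kappa_hom:
  assumes "x \<in> MC v" "l \<in> I"
  shows "\<kappa> (hom v s v' s' m x l) p q t =
    (\<Sum>k\<in>I. m k l * \<kappa> (x k \<otimes> W (v k) (v' l) (s' l - s k)) p q t)"
proof -
  have "\<kappa> (hom v s v' s' m x l) p q t = (\<Sum>k\<in>I. \<kappa> (x k \<otimes> (m k l \<odot> W (v k) (v' l) (s' l - s k))) p q t)"
    using assms act_term_C[OF assms(1), THEN C_carrier]
    by (simp add: hom_def act_def kappa_finsum Pi_iff)
  also have "\<dots> = (\<Sum>k\<in>I. m k l * \<kappa> (x k \<otimes> W (v k) (v' l) (s' l - s k)) p q t)"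
    using MC_carrier[OF assms(1)] by (intro sum.cong refl) (simp add: smult_mult kappa_smult)
  finally show ?thesis .
qed

lemma hom_cong:
  assumes "\<And>k l. \<lbrakk>k \<in> I; l \<in> I; F (v k) (v' l) (s' l - s k)\<rbrakk> \<Longrightarrow> m k l = m' k l"
  shows "hom v s v' s' m = hom v s v' s' m'"
proof -
  have "m k l \<odot> W (v k) (v' l) (s' l - s k) = m' k l \<odot> W (v k) (v' l) (s' l - s k)"
    if "k \<in> I" "l \<in> I" for k l
    using assms[OF that] by (intro kappa_eqI) (auto simp: smult_cl kappa_smult kappa_W)
  then have "act v s v' s' m x = act v s v' s' m' x" if "x \<in> MC v" for x
    unfolding act_def using act_term_C[OF that, THEN C_carrier]
    by (intro restrict_ext finsum_cong') auto
  then show ?thesis unfolding hom_def by (intro restrict_ext) auto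
qed

lemma mat_hom:
  assumes "k \<in> I" "l \<in> I"
  shows "mat v s v' s' (hom v s v' s' m) k l = (if F (v k) (v' l) (s' l - s k) then m k l else 0)"
proof -
  let ?t = "s' l - s k"
  have "mat v s v' s' (hom v s v' s' m) k l =
    (\<Sum>j\<in>I. m j l * \<kappa> (slot k (W (v k) (v k) 0) j \<otimes> W (v j) (v' l) (s' l - s j)) (v k) (v' l) ?t)"
    unfolding mat_def by (rule kappa_hom[OF slot_MC[of _ v, OF W_C] assms(2)])
  also have "\<dots> = (\<Sum>j\<in>I. if j = k then m k l * \<kappa> (W (v k) (v k) 0 \<otimes> W (v k) (v' l) ?t) (v k) (v' l) ?t else 0)"
    by (intro sum.cong refl) (auto simp: slot_def kappa_zero)
  also have "\<dots> = m k l * \<kappa> (W (v k) (v k) 0 \<otimes> W (v k) (v' l) ?t) (v k) (v' l) ?t"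
    using assms(1) by (simp add: sum.delta)
  also have "\<dots> = (if F (v k) (v' l) (s' l - s k) then m k l else 0)"
    by (simp add: kappa_left_idem kappa_W)
  finally show ?thesis .
qed

text \<open>Maps are right multiplications, so the first map contributes the left factor, and the
  lengths add up: (s' j - s k) + (s'' l - s' j) = s'' l - s k. By \<open>W_mult\<close> the
  composite is the matrix product, restricted to the middle positions j at which both basis elements
  exist.\<close>

lemma hom_comp:
  assumes "x \<in> MC v"
  shows "hom v' s' v'' s'' m' (hom v s v' s' m x) =
    hom v s v'' s'' (\<lambda>k l. \<Sum>j\<in>I. if F (v k) (v' j) (s' j - s k) \<and> F (v' j) (v'' l) (s'' l - s' j)
      then m k j * m' j l else 0) x" (is "_ = hom v s v'' s'' ?m x")
proof (rule MC_eqI[OF hom_MC[OF hom_MC[OF assms]] hom_MC[OF assms]])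
  fix l p q t assume l: "l \<in> I"
  let ?y = "hom v s v' s' m x"
  have xA: "x k \<in> carrier A" if "k \<in> I" for k using MC_carrier[OF assms that] .
  have summand: "\<kappa> (?y j \<otimes> W (v' j) (v'' l) (s'' l - s' j)) p q t =
    (\<Sum>k\<in>I. m k j * (if F (v k) (v' j) (s' j - s k) \<and> F (v' j) (v'' l) (s'' l - s' j)
       then \<kappa> (x k \<otimes> W (v k) (v'' l) (s'' l - s k)) p q t else 0))" if j: "j \<in> I" for j
  proof -
    let ?W = "W (v' j) (v'' l) (s'' l - s' j)"
    have cl: "(\<lambda>k. x k \<otimes> (m k j \<odot> W (v k) (v' j) (s' j - s k))) \<in> I \<rightarrow> carrier A"
      using act_term_C[OF assms, THEN C_carrier] by auto
    have "?y j = finsum A (\<lambda>k. x k \<otimes> (m k j \<odot> W (v k) (v' j) (s' j - s k))) I"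
      using assms j by (simp add: hom_def act_def)
    then have yW: "?y j \<otimes> ?W = finsum A (\<lambda>k. x k \<otimes> (m k j \<odot> W (v k) (v' j) (s' j - s k)) \<otimes> ?W) I"
      using finsum_ldistr[OF _ W_closed cl] by simp
    have "\<kappa> (?y j \<otimes> ?W) p q t = (\<Sum>k\<in>I. \<kappa> (x k \<otimes> (m k j \<odot> W (v k) (v' j) (s' j - s k)) \<otimes> ?W) p q t)"
      unfolding yW using cl by (intro kappa_finsum) (auto simp: Pi_iff)
    also have "\<dots> = (\<Sum>k\<in>I. m k j * (if F (v k) (v' j) (s' j - s k) \<and> F (v' j) (v'' l) (s'' l - s' j)
       then \<kappa> (x k \<otimes> W (v k) (v'' l) (s'' l - s k)) p q t else 0))"
    proof (rule sum.cong[OF refl])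
      fix k assume k: "k \<in> I"
      have "x k \<otimes> (m k j \<odot> W (v k) (v' j) (s' j - s k)) \<otimes> ?W =
        m k j \<odot> (x k \<otimes> (W (v k) (v' j) (s' j - s k) \<otimes> ?W))"
        using xA[OF k] by (simp add: smult_mult smult_cl m_assoc)
      moreover have "W (v k) (v' j) (s' j - s k) \<otimes> ?W =
        (if F (v k) (v' j) (s' j - s k) \<and> F (v' j) (v'' l) (s'' l - s' j) then W (v k) (v'' l) (s'' l - s k) else \<zero>)"
        unfolding W_mult by simp
      ultimately show "\<kappa> (x k \<otimes> (m k j \<odot> W (v k) (v' j) (s' j - s k)) \<otimes> ?W) p q t =
        m k j * (if F (v k) (v' j) (s' j - s k) \<and> F (v' j) (v'' l) (s'' l - s' j)
         then \<kappa> (x k \<otimes> W (v k) (v'' l) (s'' l - s k)) p q t else 0)"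
        using xA[OF k] by (simp add: kappa_smult kappa_zero)
    qed
    finally show ?thesis .
  qed
  have "\<kappa> (hom v' s' v'' s'' m' ?y l) p q t = (\<Sum>j\<in>I. m' j l * \<kappa> (?y j \<otimes> W (v' j) (v'' l) (s'' l - s' j)) p q t)"
    by (rule kappa_hom[OF hom_MC[OF assms] l])
  also have "\<dots> = (\<Sum>j\<in>I. \<Sum>k\<in>I. m' j l * (m k j * (if F (v k) (v' j) (s' j - s k) \<and> F (v' j) (v'' l) (s'' l - s' j)
       then \<kappa> (x k \<otimes> W (v k) (v'' l) (s'' l - s k)) p q t else 0)))"
    by (intro sum.cong refl) (simp only: summand sum_distrib_left)
  also have "\<dots> = (\<Sum>k\<in>I. ?m k l * \<kappa> (x k \<otimes> W (v k) (v'' l) (s'' l - s k)) p q t)"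
    by (subst sum.swap) (auto simp: sum_distrib_right intro!: sum.cong)
  also have "\<dots> = \<kappa> (hom v s v'' s'' ?m x l) p q t"
    by (rule kappa_hom[OF assms l, symmetric])
  finally show "\<kappa> (hom v' s' v'' s'' m' ?y l) p q t = \<kappa> (hom v s v'' s'' ?m x l) p q t" .
qed

lemma
  assumes B: "bricks N' v' s'" and x: "x \<in> MC v"
  shows hom_add: "hom v s v' s' m x \<oplus>\<^bsub>msum I N'\<^esub> hom v s v' s' m' x = hom v s v' s' (\<lambda>k l. m k l + m' k l) x"
    and hom_minus: "hom v s v' s' m x \<ominus>\<^bsub>msum I N'\<^esub> hom v s v' s' m' x = hom v s v' s' (\<lambda>k l. m k l - m' k l) x"
    and hom_uminus: "\<ominus>\<^bsub>msum I N'\<^esub> hom v s v' s' m x = hom v s v' s' (\<lambda>k l. - m k l) x"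
    and hom_smult: "(a \<odot> \<one>) \<odot>\<^bsub>msum I N'\<^esub> hom v s v' s' m x = hom v s v' s' (\<lambda>k l. a * m k l) x"
    and hom_zero: "hom v s v' s' (\<lambda>k l. 0) x = \<zero>\<^bsub>msum I N'\<^esub>"
proof -
  note M = hom_MC[OF x, of s v' s']
  note cl = MC_carrier[OF M]
  have a1: "a \<odot> \<one> \<in> carrier A" by (simp add: smult_cl)
  note k = kappa_hom[OF x]
  show "hom v s v' s' m x \<oplus>\<^bsub>msum I N'\<^esub> hom v s v' s' m' x = hom v s v' s' (\<lambda>k l. m k l + m' k l) x"
    unfolding M_add[OF B M M]
    by (rule MC_eqI[OF MC_add[OF M M] M]) (simp add: cl kappa_add k sum.distrib algebra_simps)
  show um: "\<ominus>\<^bsub>msum I N'\<^esub> hom v s v' s' m x = hom v s v' s' (\<lambda>k l. - m k l) x" for m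
    unfolding M_minus[OF B M]
    by (rule MC_eqI[OF MC_minus[OF M] M]) (simp add: cl kappa_minus k sum_negf)
  show "hom v s v' s' m x \<ominus>\<^bsub>msum I N'\<^esub> hom v s v' s' m' x = hom v s v' s' (\<lambda>k l. m k l - m' k l) x"
    unfolding a_minus_def um M_add[OF B M M]
    by (rule MC_eqI[OF MC_add[OF M M] M]) (simp add: cl kappa_add k sum.distrib[symmetric] algebra_simps)
  show "(a \<odot> \<one>) \<odot>\<^bsub>msum I N'\<^esub> hom v s v' s' m x = hom v s v' s' (\<lambda>k l. a * m k l) x"
    unfolding M_smult[OF B a1 M]
    by (rule MC_eqI[OF MC_smult[OF a1 M] M])
      (simp add: cl smult_one_mult kappa_smult k sum_distrib_left algebra_simps)
  show "hom v s v' s' (\<lambda>k l. 0) x = \<zero>\<^bsub>msum I N'\<^esub>"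
    unfolding M_zero[OF B]
    by (rule MC_eqI[OF M MC_zero]) (simp add: k kappa_zero)
qed

lemma hom_gr_hom:
  assumes B: "bricks N v s" and B': "bricks N' v' s'"
  shows "hom v s v' s' m \<in> gr_hom A (msum I N) (msum I N')"
  unfolding gr_hom_def mem_Collect_eq M_carrier[OF B] M_carrier[OF B']
proof (intro conjI ballI allI)
  show "hom v s v' s' m \<in> MC v \<rightarrow>\<^sub>E MC v'" by (auto simp: hom_def act_MC)
next
  fix x y assume x: "x \<in> MC v" and y: "y \<in> MC v"
  note M = hom_MC[of _ v s v' s' m]
  show "hom v s v' s' m (x \<oplus>\<^bsub>msum I N\<^esub> y) = hom v s v' s' m x \<oplus>\<^bsub>msum I N'\<^esub> hom v s v' s' m y"
    unfolding M_add[OF B x y] M_add[OF B' M[OF x] M[OF y]]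
  proof (rule MC_eqI[OF M[OF MC_add[OF x y]] MC_add[OF M[OF x] M[OF y]]])
    fix l p q t assume l: "l \<in> I"
    show "\<kappa> (hom v s v' s' m (\<lambda>k\<in>I. x k \<oplus> y k) l) p q t =
      \<kappa> ((\<lambda>l\<in>I. hom v s v' s' m x l \<oplus> hom v s v' s' m y l) l) p q t"
      unfolding kappa_hom[OF MC_add[OF x y] l]
      using l MC_carrier[OF x] MC_carrier[OF y] MC_carrier[OF M[OF x]] MC_carrier[OF M[OF y]]
      by (simp add: kappa_add kappa_hom[OF x l] kappa_hom[OF y l] sum.distrib[symmetric] l_distr algebra_simps)
  qed
next
  fix a x assume a: "a \<in> carrier A" and x: "x \<in> MC v"
  note M = hom_MC[of _ v s v' s' m]
  have "act v s v' s' m (\<lambda>k\<in>I. a \<otimes> x k) = (\<lambda>l\<in>I. a \<otimes> act v s v' s' m x l)"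
    unfolding act_def
  proof (rule restrict_ext)
    fix l assume l: "l \<in> I"
    have cl: "(\<lambda>k. x k \<otimes> (m k l \<odot> W (v k) (v' l) (s' l - s k))) \<in> I \<rightarrow> carrier A"
      using act_term_C[OF x, THEN C_carrier] by auto
    have "(\<Oplus>k\<in>I. (\<lambda>k\<in>I. a \<otimes> x k) k \<otimes> (m k l \<odot> W (v k) (v' l) (s' l - s k))) =
      (\<Oplus>k\<in>I. a \<otimes> (x k \<otimes> (m k l \<odot> W (v k) (v' l) (s' l - s k))))"
      using a MC_carrier[OF x] cl by (intro finsum_cong') (auto simp: m_assoc smult_cl Pi_iff)
    also have "\<dots> = a \<otimes> (\<Oplus>k\<in>I. x k \<otimes> (m k l \<odot> W (v k) (v' l) (s' l - s k)))"
      using finsum_rdistr[OF _ a cl] by simp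
    finally show "(\<Oplus>k\<in>I. (\<lambda>k\<in>I. a \<otimes> x k) k \<otimes> (m k l \<odot> W (v k) (v' l) (s' l - s k))) =
      a \<otimes> (\<lambda>l\<in>I. \<Oplus>k\<in>I. x k \<otimes> (m k l \<odot> W (v k) (v' l) (s' l - s k))) l" using l by simp
  qed
  then show "hom v s v' s' m (a \<odot>\<^bsub>msum I N\<^esub> x) = a \<odot>\<^bsub>msum I N'\<^esub> hom v s v' s' m x"
    using MC_smult[OF a x] x unfolding M_smult[OF B a x] M_smult[OF B' a M[OF x]] by (simp add: hom_def)
next
  fix n
  show "hom v s v' s' m ` homog (msum I N) n \<subseteq> homog (msum I N') n"
  proof
    fix y assume "y \<in> hom v s v' s' m ` homog (msum I N) n"
    then obtain x where x: "x \<in> MC v" "\<And>k. k \<in> I \<Longrightarrow> x k \<in> homog A (n + s k)" "y = hom v s v' s' m x"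
      unfolding image_iff Bex_def M_homog[OF B] by blast
    have "y l \<in> homog A (n + s' l)" if "l \<in> I" for l
    proof -
      have h: "x k \<otimes> (m k l \<odot> W (v k) (v' l) (s' l - s k)) \<in> homog A (n + s' l)" if "k \<in> I" for k
        using homog_mult[OF x(2)[OF that] homog_smult_A[OF W_homog[of "v k" "v' l" "s' l - s k"], of "m k l"]] by simp
      have yl: "y l = finsum A (\<lambda>k. x k \<otimes> (m k l \<odot> W (v k) (v' l) (s' l - s k))) I"
        using x that by (simp add: hom_def act_def)
      show ?thesis unfolding yl by (rule homog_finsum[OF finite_atLeastLessThan_int h])
    qed
    then show "y \<in> homog (msum I N') n" unfolding M_homog[OF B'] using hom_MC[OF x(1)] x(3) by blast
  qed
qed

lemma gr_hom_finsum:
  assumes B: "bricks N v s" and B': "bricks N' v' s'" and f: "f \<in> gr_hom A (msum I N) (msum I N')"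
    and S: "finite S" and g: "\<And>i. i \<in> S \<Longrightarrow> g i \<in> MC v"
  shows "f (finsum (msum I N) g S) = finsum (msum I N') (\<lambda>i. f (g i)) S"
proof -
  interpret M: abelian_group "msum I N" by (rule M_abelian[OF B])
  interpret M': abelian_group "msum I N'" by (rule M_abelian[OF B'])
  have fM: "f x \<in> carrier (msum I N')" if "x \<in> carrier (msum I N)" for x
    using f that unfolding gr_hom_def by (auto simp: PiE_iff)
  have fadd: "f (x \<oplus>\<^bsub>msum I N\<^esub> y) = f x \<oplus>\<^bsub>msum I N'\<^esub> f y"
    if "x \<in> carrier (msum I N)" "y \<in> carrier (msum I N)" for x y
    using f that unfolding gr_hom_def by blast
  have "f \<zero>\<^bsub>msum I N\<^esub> \<oplus>\<^bsub>msum I N'\<^esub> f \<zero>\<^bsub>msum I N\<^esub> = f \<zero>\<^bsub>msum I N\<^esub>"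
    using fadd[of "\<zero>\<^bsub>msum I N\<^esub>" "\<zero>\<^bsub>msum I N\<^esub>"] by simp
  then have f0: "f \<zero>\<^bsub>msum I N\<^esub> = \<zero>\<^bsub>msum I N'\<^esub>"
    using M'.add.l_cancel_one[OF fM[OF M.zero_closed] fM[OF M.zero_closed]] by blast
  show ?thesis using S g
  proof (induction S rule: finite_induct)
    case (insert i S)
    have g: "g i \<in> carrier (msum I N)" "g \<in> S \<rightarrow> carrier (msum I N)"
      using insert.prems by (auto simp: M_carrier[OF B])
    then have fg: "f (g i) \<in> carrier (msum I N')" "(\<lambda>i. f (g i)) \<in> S \<rightarrow> carrier (msum I N')" using fM by auto
    show ?case using insert g fg fadd[OF g(1) M.finsum_closed[OF g(2)]] by simp
  qed (simp add: f0)
qed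

text \<open>A map out of Ze_v is determined by the image of e_v. Since e_v is homogeneous and fixed
  by left multiplication with itself, the image in each summand has prescribed end points and
  length, which leaves a multiple of a single basis element.\<close>

lemma hom_mat:
  assumes B: "bricks N v s" and B': "bricks N' v' s'" and f: "f \<in> gr_hom A (msum I N) (msum I N')"
  shows "f = hom v s v' s' (mat v s v' s' f)"
proof
  fix x
  show "f x = hom v s v' s' (mat v s v' s' f) x"
  proof (cases "x \<in> MC v")
    case False
    then show ?thesis using f unfolding gr_hom_def hom_def M_carrier[OF B] by (auto simp: PiE_iff extensional_def)
  next
    case x: True
    let ?e = "\<lambda>k. slot k (W (v k) (v k) 0)"
    have eM: "?e k \<in> MC v" for k by (rule slot_MC[OF W_C])
    have fM: "f y \<in> MC v'" if "y \<in> MC v" for y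
      using f that unfolding gr_hom_def M_carrier[OF B] M_carrier[OF B'] by (auto simp: PiE_iff)
    have fs: "f (a \<odot>\<^bsub>msum I N\<^esub> y) = a \<odot>\<^bsub>msum I N'\<^esub> f y" if "a \<in> carrier A" "y \<in> MC v" for a y
      using f that unfolding gr_hom_def M_carrier[OF B] by blast
    have fh: "f y \<in> homog (msum I N') n" if "y \<in> homog (msum I N) n" for y n
      using f that unfolding gr_hom_def by blast
    have xA: "x k \<in> carrier A" if "k \<in> I" for k using MC_carrier[OF x that] .
    have xe: "x k \<odot>\<^bsub>msum I N\<^esub> ?e k \<in> MC v" if "k \<in> I" for k
      unfolding M_smult[OF B xA[OF that] eM] by (rule MC_smult[OF xA[OF that] eM])
    have fe: "f (?e k) l = mat v s v' s' f k l \<odot> W (v k) (v' l) (s' l - s k)" if k: "k \<in> I" and l: "l \<in> I" for k l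
    proof (rule kappa_eqI)
      let ?y = "f (?e k) l"
      show yA: "?y \<in> carrier A" by (rule MC_carrier[OF fM[OF eM] l])
      show "mat v s v' s' f k l \<odot> W (v k) (v' l) (s' l - s k) \<in> carrier A" by (simp add: smult_cl)
      \<comment> \<open>After the shift by s k the generator has degree - s k, so its image in the
        summand l has path length s' l - s k.\<close>
      have "?e k \<in> homog (msum I N) (- s k)"
        unfolding M_homog[OF B] using eM W_homog[of "v k" "v k" 0] by (auto simp: slot_def homog_zero)
      then have deg: "?y \<in> homog A (s' l - s k)" using fh l unfolding M_homog[OF B'] by fastforce
      have "W (v k) (v k) 0 \<odot>\<^bsub>msum I N\<^esub> ?e k = ?e k"
        unfolding M_smult[OF B W_closed eM]
        by (rule MC_eqI[OF MC_smult[OF W_closed eM] eM]) (auto simp: slot_def kappa_left_idem kappa_W kappa_zero)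
      then have "f (?e k) = W (v k) (v k) 0 \<odot>\<^bsub>msum I N'\<^esub> f (?e k)" using fs[OF W_closed eM] by metis
      then have "?y = (W (v k) (v k) 0 \<odot>\<^bsub>msum I N'\<^esub> f (?e k)) l" by (rule fun_cong)
      also have "\<dots> = W (v k) (v k) 0 \<otimes> ?y" unfolding M_smult[OF B' W_closed fM[OF eM]] using l by simp
      finally have yy: "?y = W (v k) (v k) 0 \<otimes> ?y" .
      fix p q t
      show "\<kappa> ?y p q t = \<kappa> (mat v s v' s' f k l \<odot> W (v k) (v' l) (s' l - s k)) p q t"
      proof (cases "\<kappa> ?y p q t = 0")
        case True
        then show ?thesis by (auto simp: kappa_smult kappa_W mat_def)
      next
        case False
        have "q = v' l" using False MC_C[OF fM[OF eM] l] unfolding C_def by blast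
        moreover have "t = s' l - s k" using False deg unfolding homog_A by blast
        moreover have "p = v k" using False kappa_left_idem[OF yA, of "v k" p q t] yy by (metis (full_types))
        ultimately show ?thesis using kappa_fin_idx[OF yA False] by (simp add: kappa_smult kappa_W mat_def)
      qed
    qed
    \<comment> \<open>Every vector is the sum of its components acting on the generators, because
      the components are fixed by the idempotents from the right.\<close>
    have "x = finsum (msum I N) (\<lambda>k. x k \<odot>\<^bsub>msum I N\<^esub> ?e k) I"
    proof (rule MC_eqI[OF x M_finsum(2)[OF B _ xe]])
      fix l p q t assume l: "l \<in> I"
      have "\<kappa> (finsum (msum I N) (\<lambda>k. x k \<odot>\<^bsub>msum I N\<^esub> ?e k) I l) p q t = (\<Sum>k\<in>I. \<kappa> ((x k \<odot>\<^bsub>msum I N\<^esub> ?e k) l) p q t)"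
        by (rule kappa_M_finsum[OF B _ xe l]) auto
      also have "\<dots> = (\<Sum>k\<in>I. if k = l then \<kappa> (x l) p q t else 0)"
      proof (rule sum.cong[OF refl])
        fix k assume k: "k \<in> I"
        show "\<kappa> ((x k \<odot>\<^bsub>msum I N\<^esub> ?e k) l) p q t = (if k = l then \<kappa> (x l) p q t else 0)"
          unfolding M_smult[OF B xA[OF k] eM]
          using l k xA C_left_mult[OF MC_C[OF x l]] by (auto simp: slot_def kappa_zero)
      qed
      also have "\<dots> = \<kappa> (x l) p q t" using l by (simp add: sum.delta)
      finally show "\<kappa> (x l) p q t = \<kappa> (finsum (msum I N) (\<lambda>k. x k \<odot>\<^bsub>msum I N\<^esub> ?e k) I l) p q t" by simp
    qed auto
    then have "f x = f (finsum (msum I N) (\<lambda>k. x k \<odot>\<^bsub>msum I N\<^esub> ?e k) I)" by simp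
    also have "\<dots> = finsum (msum I N') (\<lambda>k. f (x k \<odot>\<^bsub>msum I N\<^esub> ?e k)) I"
      by (rule gr_hom_finsum[OF B B' f _ xe]) auto
    finally have fx: "f x = finsum (msum I N') (\<lambda>k. f (x k \<odot>\<^bsub>msum I N\<^esub> ?e k)) I" .
    show ?thesis
    proof (rule MC_eqI[OF fM[OF x] hom_MC[OF x]])
      fix l p q t assume l: "l \<in> I"
      have "\<kappa> (f x l) p q t = (\<Sum>k\<in>I. \<kappa> (f (x k \<odot>\<^bsub>msum I N\<^esub> ?e k) l) p q t)"
        unfolding fx by (rule kappa_M_finsum[OF B' _ fM[OF xe] l]) auto
      also have "\<dots> = (\<Sum>k\<in>I. mat v s v' s' f k l * \<kappa> (x k \<otimes> W (v k) (v' l) (s' l - s k)) p q t)"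
      proof (rule sum.cong[OF refl])
        fix k assume k: "k \<in> I"
        have "f (x k \<odot>\<^bsub>msum I N\<^esub> ?e k) l = x k \<otimes> f (?e k) l"
          unfolding fs[OF xA[OF k] eM] M_smult[OF B' xA[OF k] fM[OF eM]] using l by simp
        then show "\<kappa> (f (x k \<odot>\<^bsub>msum I N\<^esub> ?e k) l) p q t = mat v s v' s' f k l * \<kappa> (x k \<otimes> W (v k) (v' l) (s' l - s k)) p q t"
          using xA[OF k] by (simp add: fe[OF k l] smult_mult kappa_smult)
      qed
      also have "\<dots> = \<kappa> (hom v s v' s' (mat v s v' s' f) x l) p q t" by (rule kappa_hom[OF x l, symmetric])
      finally show "\<kappa> (f x l) p q t = \<kappa> (hom v s v' s' (mat v s v' s' f) x l) p q t" .
    qed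
  qed
qed

end

section \<open>The scalar complex\<close>

text \<open>
  Vertex (0 if absent) and grading shift of the \<open>k\<close>-th summand of the term of degree \<open>n\<close>. The number
  \<open>m n k l\<close> is the matrix entry in degree \<open>n\<close> of a map \<open>X \<rightarrow> X\<langle>i\<rangle>[j]\<close>; it is significant only if \<open>adm d i j n k l\<close>.
\<close>

definition vert :: "nat \<Rightarrow> int \<Rightarrow> int \<Rightarrow> int" where
  "vert d n k = (if k = 0 then (if 0 \<le> n \<and> n \<le> int d - 2 then int d - 1 - n else 0) else if n = 0 then k else 0)"

definition gshift :: "int \<Rightarrow> int \<Rightarrow> int" where
  "gshift n k = (if k = 0 then n + 1 else 0)"

definition adm :: "nat \<Rightarrow> int \<Rightarrow> int \<Rightarrow> int \<Rightarrow> int \<Rightarrow> int \<Rightarrow> bool" where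
  "adm d i j n k l \<longleftrightarrow> k \<in> {0..<int d} \<and> l \<in> {0..<int d} \<and>
     fin_idx d (vert d n k) (vert d (n + j) l) (gshift (n + j) l + i - gshift n k)"

definition supp :: "nat \<Rightarrow> int \<Rightarrow> int \<Rightarrow> (int \<Rightarrow> int \<Rightarrow> int \<Rightarrow> complex) \<Rightarrow> bool" where
  "supp d i j m \<longleftrightarrow> (\<forall>n k l. m n k l \<noteq> 0 \<longrightarrow> adm d i j n k l)"

definition eps :: "int \<Rightarrow> complex" where "eps j = (if even j then 1 else - 1)"

text \<open>The condition that m commutes with the differentials, entry by entry. Only the summand 0
  has a differential, with entry 1 from each term to the next; the shift [j] contributes
  \<open>eps j\<close>. A position counts if the composite, of homological degree j + 1, has a
  nonzero basis element there.\<close>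

definition cocyc :: "nat \<Rightarrow> int \<Rightarrow> int \<Rightarrow> (int \<Rightarrow> int \<Rightarrow> int \<Rightarrow> complex) \<Rightarrow> bool" where
  "cocyc d i j m \<longleftrightarrow> (\<forall>n k l. adm d i (j + 1) n k l \<longrightarrow>
     (if k = 0 \<and> 0 \<le> n \<and> n < int d - 2 then m (n + 1) 0 l else 0) =
     (if l = 0 \<and> 0 \<le> n + j \<and> n + j < int d - 2 then eps j * m n k 0 else 0))"

text \<open>The shifted differential after h plus h after the differential of the source. The index
  n + j - 1 appears because h has homological degree j - 1, so that h n ends in the term n + j -
  1.\<close>

definition cobnd :: "nat \<Rightarrow> int \<Rightarrow> (int \<Rightarrow> int \<Rightarrow> int \<Rightarrow> complex) \<Rightarrow> int \<Rightarrow> int \<Rightarrow> int \<Rightarrow> complex" where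
  "cobnd d j h n k l = (if l = 0 \<and> 0 \<le> n + j - 1 \<and> n + j - 1 < int d - 2 then eps j * h n k 0 else 0)
     + (if k = 0 \<and> 0 \<le> n \<and> n < int d - 2 then h (n + 1) 0 l else 0)"

definition nullh :: "nat \<Rightarrow> int \<Rightarrow> int \<Rightarrow> (int \<Rightarrow> int \<Rightarrow> int \<Rightarrow> complex) \<Rightarrow> bool" where
  "nullh d i j m \<longleftrightarrow> (\<exists>h. supp d i (j - 1) h \<and> (\<forall>n k l. adm d i j n k l \<longrightarrow> m n k l = cobnd d j h n k l))"

text \<open>
  \<open>bideg d l k t\<close> is the bidegree of the map \<open>X\<^sub>k \<rightarrow> X\<^sub>l\<close> given by the path of length \<open>t\<close>, \<open>symb\<close> reads off
  its coefficient from a cocycle, and \<open>canon\<close> is a cocycle with prescribed coefficients. For \<open>X\<^sub>0 \<rightarrow> X\<^sub>0\<close> in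
  bidegree \<open>(2, 0)\<close> the alternating sum is the functional that vanishes on coboundaries.
\<close>

definition bideg :: "nat \<Rightarrow> int \<Rightarrow> int \<Rightarrow> int \<Rightarrow> int \<times> int" where
  "bideg d l k t = (if l = 0 \<and> k = 1 \<and> t = 1 then (1 - int d, int d - 2)
     else if l = 1 \<and> k = 0 \<and> t = 1 then (int d + 1, 2 - int d) else (t, 0))"

definition symb :: "nat \<Rightarrow> int \<Rightarrow> int \<Rightarrow> (int \<Rightarrow> int \<Rightarrow> int \<Rightarrow> complex) \<Rightarrow> int \<Rightarrow> int \<Rightarrow> int \<Rightarrow> complex" where
  "symb d i j m l k t = (if aff_idx d l k t \<and> bideg d l k t = (i, j) then
     (if l = 1 \<and> k = 0 then m (int d - 2) 0 1
      else if l = 0 \<and> k = 0 \<and> t = 2 then (\<Sum>n<d - 1. (-1) ^ n * m (int n) 0 0)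
      else m 0 k l) else 0)"

definition canon :: "nat \<Rightarrow> (int \<Rightarrow> int \<Rightarrow> int \<Rightarrow> complex) \<Rightarrow> int \<Rightarrow> int \<Rightarrow> int \<Rightarrow> int \<Rightarrow> int \<Rightarrow> complex" where
  "canon d c i j n k l =
    (if k \<notin> {0..<int d} \<or> l \<notin> {0..<int d} then 0
     else if k = 0 then
       (if l = 0 then (if j = 0 \<and> 0 \<le> n \<and> n \<le> int d - 2 then
          (if i = 0 then c 0 0 0 else if i = 2 \<and> n = 0 then c 0 0 2 else 0) else 0)
        else if l = int d - 1 \<and> n = 0 \<and> i = 1 \<and> j = 0 then c l 0 1
        else if l = 1 \<and> n = int d - 2 \<and> i = int d + 1 \<and> j = 2 - int d then c 1 0 1 else 0)
     else if l = 0 then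
       (if k = int d - 1 \<and> n = 0 \<and> i = 1 \<and> j = 0 then c 0 k 1
        else if k = 1 \<and> n = 0 \<and> i = 1 - int d \<and> j = int d - 2 then c 0 1 1 else 0)
     else if n = 0 \<and> j = 0 then c l k i else 0)"

section \<open>Cohomology of the scalar complex\<close>

context
  fixes d :: nat
  assumes d3: "d \<ge> 3"
begin

lemma fin_idx_iff: "fin_idx d p q t \<longleftrightarrow> 1 \<le> p \<and> p < int d \<and> 1 \<le> q \<and> q < int d \<and>
     (t = 0 \<and> q = p \<or> t = 1 \<and> (q = p + 1 \<or> q = p - 1) \<or> t = 2 \<and> q = p)"
  by (auto simp: fin_idx_def[OF d3])

lemma aff_idx_iff: "aff_idx d p q t \<longleftrightarrow> 0 \<le> p \<and> p < int d \<and> 0 \<le> q \<and> q < int d \<and>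
     (t = 0 \<and> q = p \<or> t = 1 \<and> (q = p + 1 \<or> q = p - 1 \<or> p = int d - 1 \<and> q = 0 \<or> p = 0 \<and> q = int d - 1) \<or> t = 2 \<and> q = p)"
proof (cases "0 \<le> p \<and> p < int d")
  case True
  then show ?thesis unfolding aff_idx_def using mod_simps(1,2)[OF d3, of p] d3 by auto
qed (auto simp: aff_idx_def)

lemma adm_pp: "k \<noteq> 0 \<Longrightarrow> l \<noteq> 0 \<Longrightarrow> adm d i j n k l \<longleftrightarrow> n = 0 \<and> j = 0 \<and> fin_idx d k l i"
  by (auto simp: adm_def vert_def gshift_def fin_idx_iff)

lemma adm_p0: "k \<noteq> 0 \<Longrightarrow> adm d i j n k 0 \<longleftrightarrow> n = 0 \<and> 0 \<le> j \<and> j \<le> int d - 2 \<and> fin_idx d k (int d - 1 - j) (j + 1 + i)"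
  by (auto simp: adm_def vert_def gshift_def fin_idx_iff)

lemma adm_0p: "l \<noteq> 0 \<Longrightarrow> adm d i j n 0 l \<longleftrightarrow> j = - n \<and> 0 \<le> n \<and> n \<le> int d - 2 \<and> fin_idx d (int d - 1 - n) l (i - n - 1)"
  by (auto simp: adm_def vert_def gshift_def fin_idx_iff algebra_simps)

text \<open>Between the terms n and n + j of X_0 the shifts differ by j, so an entry of bidegree (i,
  j) is a path of length i + j between vertices at distance |j|. This leaves identities and loops
  for j = 0, and arrows with i + j = 1 for j = 1 and j = -1.\<close>

lemma adm_00: "adm d i j n 0 0 \<longleftrightarrow> 0 \<le> n \<and> n \<le> int d - 2 \<and> 0 \<le> n + j \<and> n + j \<le> int d - 2 \<and>
    (j = 0 \<and> i = 0 \<or> j = 1 \<and> i = 0 \<or> j = -1 \<and> i = 2 \<or> j = 0 \<and> i = 2)"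
  by (auto simp: adm_def vert_def gshift_def fin_idx_iff)

lemma eps_simps: "eps 0 = 1" "eps 1 = -1" "eps (-1) = -1" "eps j * eps j = 1" "eps (a + b) = eps a * eps b"
  "eps (-j) = eps j" "eps (a - b) = eps a * eps b" "eps (int n) = (-1) ^ n"
  by (auto simp: eps_def minus_one_power_iff)

lemma coord_fun_aff_idx: "c \<in> coord_fun d \<Longrightarrow> c p q t \<noteq> 0 \<Longrightarrow> aff_idx d p q t" by (auto simp: coord_fun_def)

lemma canon_supp: "c \<in> coord_fun d \<Longrightarrow> supp d i j (canon d c i j)"
  unfolding supp_def
proof (intro allI impI)
  fix n k l assume c: "c \<in> coord_fun d" and nz: "canon d c i j n k l \<noteq> 0"
  show "adm d i j n k l"
  proof (cases "k = 0"; cases "l = 0")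
    assume "k = 0" "l = 0"
    then show ?thesis using nz d3 by (auto simp: canon_def adm_00 split: if_splits)
  next
    assume "k = 0" "l \<noteq> 0"
    then show ?thesis using nz d3 by (auto simp: canon_def adm_0p fin_idx_iff split: if_splits)
  next
    assume "k \<noteq> 0" "l = 0"
    then show ?thesis using nz d3 by (auto simp: canon_def adm_p0 fin_idx_iff split: if_splits)
  next
    assume kl: "k \<noteq> 0" "l \<noteq> 0"
    then have "n = 0" "j = 0" "c l k i \<noteq> 0" using nz by (auto simp: canon_def split: if_splits)
    then show ?thesis using kl coord_fun_aff_idx[OF c, of l k i] by (auto simp: adm_pp fin_idx_iff aff_idx_iff)
  qed
qed

text \<open>On X_0 the identity has the same scalar at every term and therefore commutes with the
  differential. The composites of all other entries with the differential have length 3 or leave the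
  complex, and impose no condition.\<close>

lemma canon_cocyc: "c \<in> coord_fun d \<Longrightarrow> cocyc d i j (canon d c i j)"
  unfolding cocyc_def
proof (intro allI impI)
  fix n k l assume c: "c \<in> coord_fun d" and adm: "adm d i (j + 1) n k l"
  show "(if k = 0 \<and> 0 \<le> n \<and> n < int d - 2 then canon d c i j (n + 1) 0 l else 0) =
     (if l = 0 \<and> 0 \<le> n + j \<and> n + j < int d - 2 then eps j * canon d c i j n k 0 else 0)"
  proof (cases "k = 0"; cases "l = 0")
    assume kl: "k = 0" "l = 0"
    then show ?thesis using adm d3 by (auto simp: canon_def adm_00 eps_simps)
  next
    assume "k = 0" "l \<noteq> 0"
    then show ?thesis using adm d3 by (auto simp: canon_def adm_0p fin_idx_iff)
  next
    assume "k \<noteq> 0" "l = 0"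
    then show ?thesis using adm d3 by (auto simp: canon_def adm_p0 fin_idx_iff)
  qed auto
qed

lemma symb_canon:
  assumes c: "c \<in> coord_fun d"
  shows "symb d i j (canon d c i j) l k t = (if bideg d l k t = (i, j) then c l k t else 0)"
proof (cases "aff_idx d l k t \<and> bideg d l k t = (i, j)")
  case False
  then show ?thesis using coord_fun_aff_idx[OF c, of l k t] by (auto simp: symb_def)
next
  case True
  show ?thesis
  proof (cases "l = 0 \<and> k = 0 \<and> t = 2")
    case T: True
    have "(\<Sum>n<d - 1. (-1) ^ n * canon d c 2 0 (int n) 0 0) = (\<Sum>n<d - 1. if n = 0 then c 0 0 2 else 0)"
      using d3 by (intro sum.cong refl) (auto simp: canon_def)
    also have "\<dots> = c 0 0 2" using d3 by (simp add: sum.delta)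
    finally show ?thesis using True T by (auto simp: symb_def bideg_def)
  next
    case F: False
    show ?thesis using True F d3 unfolding symb_def aff_idx_iff bideg_def
      by (auto simp: canon_def split: if_splits)
  qed
qed

text \<open>The single entries read by \<open>symb\<close> are out of reach of homotopies: a
  neighbouring homotopy entry would be a path of negative length or would use a term outside the
  complex. Loops on X_0 are reachable, but their alternating sum telescopes.\<close>

lemma symb_nullh:
  assumes "nullh d i j m" shows "symb d i j m l k t = 0"
proof (cases "aff_idx d l k t \<and> bideg d l k t = (i, j)")
  case False
  then show ?thesis by (auto simp: symb_def)
next
  case True
  obtain h where h: "supp d i (j - 1) h" "\<And>n k l. adm d i j n k l \<Longrightarrow> m n k l = cobnd d j h n k l"
    using assms unfolding nullh_def by blast
  have h0: "h n k l = 0" if "\<not> adm d i (j - 1) n k l" for n k l using h(1) that unfolding supp_def by blast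
  consider "l \<noteq> 0" "k \<noteq> 0" | "l = 0" "k = 0" "t = 0" | "l = 0" "k = 0" "t = 2" | "l = 0" "k = 1" "t = 1"
    | "l = 0" "k = int d - 1" "t = 1" "k \<noteq> 1" | "k = 0" "l = 1" "t = 1" | "k = 0" "l = int d - 1" "t = 1" "l \<noteq> 1"
  proof -
    have "l \<noteq> 0 \<and> k \<noteq> 0 \<or> l = 0 \<and> k = 0 \<and> t = 0 \<or> l = 0 \<and> k = 0 \<and> t = 2 \<or> l = 0 \<and> k = 1 \<and> t = 1
      \<or> l = 0 \<and> k = int d - 1 \<and> t = 1 \<and> k \<noteq> 1 \<or> k = 0 \<and> l = 1 \<and> t = 1 \<or> k = 0 \<and> l = int d - 1 \<and> t = 1 \<and> l \<noteq> 1"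
    proof (cases "l = 0")
      case l: True
      then show ?thesis using True d3 unfolding aff_idx_iff by (cases "k = 0") auto
    next
      case l: False
      then show ?thesis using True d3 unfolding aff_idx_iff by (cases "k = 0") auto
    qed
    then show ?thesis using that by blast
  qed
  then show ?thesis
  proof cases
    case 1
    then have "i = t" "j = 0" using True by (auto simp: bideg_def)
    moreover have "adm d t 0 0 k l" using True 1 by (auto simp: adm_pp aff_idx_iff fin_idx_iff)
    ultimately show ?thesis using h(2)[of 0 k l] 1 by (auto simp: symb_def cobnd_def)
  next
    case 2
    then have ij: "i = 0" "j = 0" using True by (auto simp: bideg_def)
    have "adm d 0 0 0 0 0" using d3 by (simp add: adm_00)
    then have "m 0 0 0 = h 1 0 0" using h(2)[of 0 0 0] ij d3 by (simp add: cobnd_def)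
    also have "\<dots> = 0" using h0[of 1 0 0] ij by (simp add: adm_00)
    finally show ?thesis using 2 by (simp add: symb_def)
  next
    case 3
    then have ij: "i = 2" "j = 0" using True by (auto simp: bideg_def)
    \<comment> \<open>\<open>T n\<close> is the homotopy entry from term n to term n - 1 with
      alternating sign. It is set to 0 at n = 0 and n = d - 1, where one of the two terms is
      missing, so both ends of the telescoping sum vanish.\<close>
    define T where "T n = (-1) ^ n * (if 1 \<le> n \<and> n \<le> d - 2 then h (int n) 0 0 else 0)" for n
    have "(\<Sum>n<d - 1. (-1) ^ n * m (int n) 0 0) = (\<Sum>n<d - 1. T n - T (Suc n))"
    proof (rule sum.cong[OF refl])
      fix n assume n: "n \<in> {..<d - 1}"
      have "adm d 2 0 (int n) 0 0" using n d3 by (auto simp: adm_00)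
      then have "m (int n) 0 0 = cobnd d 0 h (int n) 0 0" using h(2)[of "int n" 0 0] ij by simp
      also have "\<dots> = (if 1 \<le> n \<and> n \<le> d - 2 then h (int n) 0 0 else 0) + (if Suc n \<le> d - 2 then h (int (Suc n)) 0 0 else 0)"
        using n d3 by (auto simp: cobnd_def eps_simps algebra_simps)
      finally show "(-1) ^ n * m (int n) 0 0 = T n - T (Suc n)"
        by (simp add: T_def algebra_simps)
    qed
    also have "\<dots> = T 0 - T (d - 1)" by (rule sum_lessThan_telescope')
    also have "\<dots> = 0"
    proof -
      have "\<not> d - 1 \<le> d - 2" using d3 by linarith
      then show ?thesis by (simp add: T_def)
    qed
    finally show ?thesis using 3 by (simp add: symb_def)
  next
    case 4
    then have ij: "i = 1 - int d" "j = int d - 2" using True by (auto simp: bideg_def)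
    have "adm d i j 0 1 0" using d3 ij by (simp add: adm_p0 fin_idx_iff)
    then have "m 0 1 0 = eps j * h 0 1 0" using h(2)[of 0 1 0] ij d3 by (simp add: cobnd_def)
    moreover have "h 0 1 0 = 0" using h0[of 0 1 0] ij d3 by (simp add: adm_p0 fin_idx_iff)
    ultimately show ?thesis using 4 by (simp add: symb_def)
  next
    case 5
    then have ij: "i = 1" "j = 0" using True by (auto simp: bideg_def)
    have "adm d i j 0 k 0" using d3 ij 5 by (simp add: adm_p0 fin_idx_iff)
    then have "m 0 k 0 = 0" using h(2)[of 0 k 0] ij 5 d3 by (simp add: cobnd_def)
    then show ?thesis using 5 by (simp add: symb_def)
  next
    case 6
    then have ij: "i = int d + 1" "j = 2 - int d" using True by (auto simp: bideg_def)
    have "adm d i j (int d - 2) 0 1" using d3 ij by (simp add: adm_0p fin_idx_iff)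
    then have "m (int d - 2) 0 1 = 0" using h(2)[of "int d - 2" 0 1] by (simp add: cobnd_def)
    then show ?thesis using 6 by (simp add: symb_def)
  next
    case 7
    then have ij: "i = 1" "j = 0" using True by (auto simp: bideg_def)
    have "adm d i j 0 0 l" using d3 ij 7 by (simp add: adm_0p fin_idx_iff)
    then have "m 0 0 l = h 1 0 l" using h(2)[of 0 0 l] ij 7 d3 by (simp add: cobnd_def)
    also have "\<dots> = 0" using h0[of 1 0 l] ij 7 d3 by (simp add: adm_0p fin_idx_iff)
    finally show ?thesis using 7 by (simp add: symb_def)
  qed
qed

text \<open>Exactness away from the symbols, by an explicit homotopy. In the blocks with exactly one
  index 0 the differential matches the basis elements in pairs, up to sign; h inverts the matching,
  and the unmatched elements are those read by \<open>symb\<close>. In the block from X_0 to X_0 the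
  homotopy solves a recursion along the complex.\<close>

lemma nullh_of_symb:
  assumes cocyc: "cocyc d i j m" and supp: "supp d i j m" and symb: "\<And>l k t. symb d i j m l k t = 0"
  shows "nullh d i j m"
proof -
  \<comment> \<open>The solution of S (Suc n) = m n - \<open>eps j\<close> * S n with S 0 = 0, that
    is, of the homotopy equation on the block from X_0 to X_0, taken from the first term onwards.
    The exponent makes the signs alternate for even j and constant for odd j.\<close>
  define S where "S n = (\<Sum>r<n. eps ((j + 1) * int (n - Suc r)) * m (int r) 0 0)" for n
  have S0: "S 0 = 0" by (simp add: S_def)
  have SS: "S (Suc n) = m (int n) 0 0 - eps j * S n" for n
  proof -
    have "S (Suc n) = m (int n) 0 0 + (\<Sum>r<n. eps ((j + 1) * int (n - r)) * m (int r) 0 0)"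
      by (simp add: S_def eps_simps)
    also have "(\<Sum>r<n. eps ((j + 1) * int (n - r)) * m (int r) 0 0) = (\<Sum>r<n. - eps j * (eps ((j + 1) * int (n - Suc r)) * m (int r) 0 0))"
    proof (rule sum.cong[OF refl])
      fix r assume "r \<in> {..<n}"
      then have "int (n - r) = 1 + int (n - Suc r)" by simp
      then show "eps ((j + 1) * int (n - r)) * m (int r) 0 0 = - eps j * (eps ((j + 1) * int (n - Suc r)) * m (int r) 0 0)"
        by (simp only: distrib_left eps_simps) (simp add: eps_simps)
    qed
    finally show ?thesis by (simp add: S_def sum_distrib_left sum_negf)
  qed
  \<comment> \<open>In the blocks with exactly one index 0 the homotopy is m itself, moved back
    across the differential; it is cut down to the positions that exist.\<close>
  define h where "h n k l = (if \<not> adm d i (j - 1) n k l then 0 else if k = 0 then if l = 0 then S (nat n) else m (n - 1) 0 l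
    else if l = 0 then eps j * m n k 0 else 0)" for n k l
  have cycD: "(if k = 0 \<and> 0 \<le> n \<and> n < int d - 2 then m (n + 1) 0 l else 0) =
     (if l = 0 \<and> 0 \<le> n + j \<and> n + j < int d - 2 then eps j * m n k 0 else 0)" if "adm d i (j + 1) n k l" for n k l
    using cocyc that unfolding cocyc_def by blast
  have eps0: "eps j * x = 0 \<longleftrightarrow> x = 0" for x by (simp add: eps_def)
  show ?thesis unfolding nullh_def
  proof (intro exI[of _ h] conjI allI impI)
    show "supp d i (j - 1) h" by (auto simp: supp_def h_def)
    fix n k l assume adm: "adm d i j n k l"
    show "m n k l = cobnd d j h n k l"
    proof (cases "k = 0"; cases "l = 0")
      assume kl: "k \<noteq> 0" "l \<noteq> 0"
      then have nj: "n = 0" "j = 0" "fin_idx d k l i" using adm by (auto simp: adm_pp)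
      then have "aff_idx d l k i \<and> bideg d l k i = (i, j)" using kl by (auto simp: fin_idx_iff aff_idx_iff bideg_def)
      then have "m 0 k l = 0" using symb[of l k i] kl by (simp add: symb_def)
      then show ?thesis using kl nj by (simp add: cobnd_def)
    next
      assume kl: "k \<noteq> 0" "l = 0"
      have n: "n = 0" and j: "0 \<le> j" "j \<le> int d - 2" and F: "fin_idx d k (int d - 1 - j) (j + 1 + i)"
        using adm kl by (auto simp: adm_p0)
      have b: "cobnd d j h n k l = (if 1 \<le> j \<and> adm d i (j - 1) 0 k 0 then m 0 k 0 else 0)"
        using kl n j by (auto simp: cobnd_def h_def eps_simps simp flip: mult.assoc)
      show ?thesis
      proof (cases "1 \<le> j \<and> adm d i (j - 1) 0 k 0")
        case True then show ?thesis using b n kl by simp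
      next
        case False
        have kr: "1 \<le> k" "k < int d" using F by (simp_all add: fin_idx_iff)
        \<comment> \<open>If no homotopy entry precedes the position, either the differential
          carries the entry on to an admissible position and the cocycle condition kills it, or it
          is one of the two entries read by \<open>symb\<close>.\<close>
        have "j < int d - 2 \<and> adm d i (j + 1) 0 k 0 \<or> k = 1 \<and> j = int d - 2 \<and> i = 1 - int d \<or> k = int d - 1 \<and> j = 0 \<and> i = 1"
        proof -
          consider "j + 1 + i = 0" "k = int d - 1 - j" | "j + 1 + i = 1" "int d - 1 - j = k + 1"
            | "j + 1 + i = 1" "int d - 1 - j = k - 1" | "j + 1 + i = 2" "int d - 1 - j = k"
            using F unfolding fin_idx_iff by metis
          then show ?thesis
          proof cases
            case 1 then show ?thesis using kr j unfolding adm_p0[OF kl(1)] fin_idx_iff by (cases "j < int d - 2") auto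
          next
            case 2 then show ?thesis using kr j unfolding adm_p0[OF kl(1)] fin_idx_iff by auto
          next
            case 3 then show ?thesis using False kr j unfolding adm_p0[OF kl(1)] fin_idx_iff by auto
          next
            case 4 then show ?thesis using False kr j unfolding adm_p0[OF kl(1)] fin_idx_iff by (cases "j = 0") auto
          qed
        qed
        then consider "j < int d - 2" "adm d i (j + 1) 0 k 0" | "k = 1" "j = int d - 2" "i = 1 - int d" | "k = int d - 1" "j = 0" "i = 1"
          by blast
        then have "m 0 k 0 = 0"
        proof cases
          case 1 then show ?thesis using cycD[OF 1(2)] kl j eps0 by simp
        next
          case 2
          then show ?thesis using symb[of 0 1 1] d3 by (simp add: symb_def bideg_def aff_idx_iff)
        next
          case 3
          then show ?thesis using symb[of 0 k 1] d3 by (simp add: symb_def bideg_def aff_idx_iff)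
        qed
        then show ?thesis using b n kl False by simp
      qed
    next
      assume kl: "k = 0" "l \<noteq> 0"
      have n: "j = - n" "0 \<le> n" "n \<le> int d - 2" and F: "fin_idx d (int d - 1 - n) l (i - n - 1)"
        using adm kl by (auto simp: adm_0p)
      have b: "cobnd d j h n k l = (if n < int d - 2 \<and> adm d i (j - 1) (n + 1) 0 l then m n 0 l else 0)"
        using kl n by (auto simp: cobnd_def h_def)
      show ?thesis
      proof (cases "n < int d - 2 \<and> adm d i (j - 1) (n + 1) 0 l")
        case True then show ?thesis using b kl by simp
      next
        case False
        have lr: "1 \<le> l" "l < int d" using F by (simp_all add: fin_idx_iff)
        \<comment> \<open>The mirror image for maps out of X_0, where the cocycle condition is taken
          at the preceding term n - 1.\<close>
        have "1 \<le> n \<and> adm d i (j + 1) (n - 1) 0 l \<or> l = 1 \<and> n = int d - 2 \<and> i = int d + 1 \<or> l = int d - 1 \<and> n = 0 \<and> i = 1"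
        proof -
          consider "i - n - 1 = 0" "l = int d - 1 - n" | "i - n - 1 = 1" "l = int d - 1 - n + 1"
            | "i - n - 1 = 1" "l = int d - 1 - n - 1" | "i - n - 1 = 2" "l = int d - 1 - n"
            using F unfolding fin_idx_iff by metis
          then show ?thesis
          proof cases
            case 1 then show ?thesis using lr n unfolding adm_0p[OF kl(2)] fin_idx_iff by (cases "n = 0") auto
          next
            case 2 then show ?thesis using lr n unfolding adm_0p[OF kl(2)] fin_idx_iff by auto
          next
            case 3 then show ?thesis using False lr n unfolding adm_0p[OF kl(2)] fin_idx_iff by auto
          next
            case 4 then show ?thesis using False lr n unfolding adm_0p[OF kl(2)] fin_idx_iff by (cases "n < int d - 2") auto
          qed
        qed
        then consider "1 \<le> n" "adm d i (j + 1) (n - 1) 0 l" | "l = 1" "n = int d - 2" "i = int d + 1" | "l = int d - 1" "n = 0" "i = 1"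
          by blast
        then have "m n 0 l = 0"
        proof cases
          case 1 then show ?thesis using cycD[OF 1(2)] kl n by simp
        next
          case 2
          then show ?thesis using symb[of 1 0 1] d3 n by (simp add: symb_def bideg_def aff_idx_iff)
        next
          case 3
          then show ?thesis using symb[of l 0 1] d3 n by (simp add: symb_def bideg_def aff_idx_iff)
        qed
        then show ?thesis using b kl False by simp
      qed
    next
      assume kl: "k = 0" "l = 0"
      have n: "0 \<le> n" "n \<le> int d - 2" "0 \<le> n + j" "n + j \<le> int d - 2"
        and "j = 0 \<and> i = 0 \<or> j = 1 \<and> i = 0 \<or> j = -1 \<and> i = 2 \<or> j = 0 \<and> i = 2" using adm kl by (auto simp: adm_00)
      then consider "j = 0" "i = 0" | "j = 1" "i = 0" | "j = -1" "i = 2" | "j = 0" "i = 2" by blast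
      then show ?thesis
      proof cases
        case 1
        \<comment> \<open>The cocycle condition makes the scalars constant along X_0, and the first
          of them is the symbol.\<close>
        have z: "int a \<le> int d - 2 \<Longrightarrow> m (int a) 0 0 = 0" for a
        proof (induction a)
          case 0 show ?case using symb[of 0 0 0] 1 d3 by (simp add: symb_def bideg_def aff_idx_iff)
        next
          case (Suc a)
          have "adm d i (j + 1) (int a) 0 0" using 1 Suc.prems by (simp add: adm_00)
          from cycD[OF this] show ?case using Suc 1 by (simp add: eps_simps add.commute)
        qed
        have "m n 0 0 = 0" using z[of "nat n"] n by simp
        moreover have "h n' 0 0 = 0" for n' using 1 by (simp add: h_def adm_00)
        ultimately show ?thesis using kl by (simp add: cobnd_def)
      next
        case 2
        \<comment> \<open>For j = 1 and i = 0 all homotopy entries exist at the terms of X_0, so the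
          recursion is solvable without an end condition; no symbol lives in this bidegree.\<close>
        have "h n 0 0 = S (nat n)" "h (n + 1) 0 0 = S (Suc (nat n))"
          using 2 n by (auto simp: h_def adm_00 nat_add_distrib)
        then show ?thesis using kl 2 n SS[of "nat n"] by (simp add: cobnd_def eps_simps)
      next
        case 3
        \<comment> \<open>At the first term only one side of the cocycle condition is present, which
          gives m 1 = 0; the later conditions propagate this.\<close>
        have z: "1 \<le> a \<Longrightarrow> int a \<le> int d - 2 \<Longrightarrow> m (int a) 0 0 = 0" for a
        proof (induction a)
          case (Suc a)
          have "adm d i (j + 1) (int a) 0 0" using 3 Suc.prems by (simp add: adm_00)
          from cycD[OF this] show ?case using Suc 3 by (cases "a = 0") (simp_all add: add.commute)
        qed simp
        have "m n 0 0 = 0" using z[of "nat n"] n 3 by simp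
        moreover have "h n' 0 0 = 0" for n' using 3 by (simp add: h_def adm_00)
        ultimately show ?thesis using kl by (simp add: cobnd_def)
      next
        case 4
        have h1: "h n 0 0 = S (nat n)" if "1 \<le> n" using 4 n that by (auto simp: h_def adm_00)
        have h2: "h (n + 1) 0 0 = S (Suc (nat n))" if "n < int d - 2" using 4 n that by (auto simp: h_def adm_00 nat_add_distrib)
        \<comment> \<open>A homotopy entry S (d - 1) would start outside the complex, so this value
          has to be 0; up to a sign it is the alternating sum read by \<open>symb\<close>.\<close>
        have "S (d - 1) = eps (int (d - 2)) * (\<Sum>r<d - 1. (-1) ^ r * m (int r) 0 0)"
          unfolding S_def sum_distrib_left
        proof (rule sum.cong[OF refl])
          fix r assume r: "r \<in> {..<d - 1}"
          then have "int (d - 1 - Suc r) = int (d - 2) - int r" by auto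
          then have "eps (int (d - 1 - Suc r)) = eps (int (d - 2)) * (-1) ^ r" by (simp only: eps_simps)
          then show "eps ((j + 1) * int (d - 1 - Suc r)) * m (int r) 0 0 = eps (int (d - 2)) * ((-1) ^ r * m (int r) 0 0)"
            using 4 by simp
        qed
        also have "(\<Sum>r<d - 1. (-1) ^ r * m (int r) 0 0) = 0"
          using symb[of 0 0 2] 4 d3 by (simp add: symb_def bideg_def aff_idx_iff)
        finally have Sd: "S (d - 1) = 0" by simp
        have h0: "n = 0 \<Longrightarrow> S (nat n) = 0" using S0 by simp
        have b: "cobnd d j h n k l = (if 1 \<le> n then S (nat n) else 0) + (if n < int d - 2 then S (Suc (nat n)) else 0)"
          using h1 h2 4 n kl by (auto simp: cobnd_def eps_simps)
        show ?thesis
        proof (cases "n < int d - 2")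
          case True
          then show ?thesis using b SS[of "nat n"] 4 kl n h0 by (auto simp: eps_simps)
        next
          case False
          then have "Suc (nat n) = d - 1" using n d3 by auto
          then have "S (Suc (nat n)) = 0" using Sd by simp
          then show ?thesis using b SS[of "nat n"] 4 kl n False d3 by (auto simp: eps_simps)
        qed
      qed
    qed
  qed
qed

end

section \<open>Products of canonical cocycles\<close>

context
  fixes d :: nat
  assumes d3: "d \<ge> 3"
begin

text \<open>The bidegrees of the triples: lengths 0, 1, 2 in homological degree 0, and the two
  bidegrees of the arrows between 0 and 1. They reduce the double sum in the product of
  \<open>Kb_End\<close> to five terms.\<close>

definition bidegs :: "(int \<times> int) set" where
  "bidegs = {(0, 0), (1, 0), (2, 0), (1 - int d, int d - 2), (int d + 1, 2 - int d)}"

lemma bideg_bidegs: "aff_idx d l k t \<Longrightarrow> bideg d l k t \<in> bidegs"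
  by (auto simp: bideg_def bidegs_def aff_idx_iff[OF d3])

lemma canon_bidegs:
  assumes c: "c \<in> coord_fun d" and "(i, j) \<notin> bidegs"
  shows "canon d c i j n k l = 0"
proof (rule ccontr)
  assume nz: "canon d c i j n k l \<noteq> 0"
  consider "k = 0" | "l = 0" "k \<noteq> 0" | "k \<noteq> 0" "l \<noteq> 0" by blast
  then show False
  proof cases
    case 3
    then have "j = 0" "c l k i \<noteq> 0" using nz by (auto simp: canon_def split: if_splits)
    then show False using coord_fun_aff_idx[OF d3 c, of l k i] assms(2) by (auto simp: aff_idx_iff[OF d3] bidegs_def)
  qed (use nz assms(2) in \<open>auto simp: canon_def bidegs_def split: if_splits\<close>)
qed

text \<open>\<open>canon\<close> reads only those c l k t whose bidegree is (i, j); a zero component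
  of an endomorphism is therefore represented by the zero matrix.\<close>

lemma canon_outside:
  assumes c: "c \<in> coord_fun d" and z: "\<And>l k t. bideg d l k t = (i, j) \<Longrightarrow> c l k t = 0"
  shows "canon d c i j n k l = 0"
proof (cases "k \<noteq> 0 \<and> l \<noteq> 0 \<and> j = 0")
  case True
  then have "bideg d l k i = (i, j)" by (simp add: bideg_def)
  then show ?thesis using z[of l k i] True by (simp add: canon_def)
next
  case False
  have bds: "bideg d 0 0 0 = (0, 0)" "bideg d 0 0 2 = (2, 0)" "bideg d 0 1 1 = (1 - int d, int d - 2)"
    "bideg d 1 0 1 = (int d + 1, 2 - int d)" "bideg d (int d - 1) 0 1 = (1, 0)" "bideg d 0 (int d - 1) 1 = (1, 0)"
    using d3 by (auto simp: bideg_def)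
  have h: "i = 0 \<Longrightarrow> j = 0 \<Longrightarrow> c 0 0 0 = 0" "i = 2 \<Longrightarrow> j = 0 \<Longrightarrow> c 0 0 2 = 0"
    "i = 1 - int d \<Longrightarrow> j = int d - 2 \<Longrightarrow> c 0 1 1 = 0" "i = int d + 1 \<Longrightarrow> j = 2 - int d \<Longrightarrow> c 1 0 1 = 0"
    "i = 1 \<Longrightarrow> j = 0 \<Longrightarrow> c (int d - 1) 0 1 = 0" "i = 1 \<Longrightarrow> j = 0 \<Longrightarrow> c 0 (int d - 1) 1 = 0"
    by (rule z, simp add: bds)+
  consider "k = 0" "l = 0" | "k = 0" "l \<noteq> 0" | "k \<noteq> 0" "l = 0" | "k \<noteq> 0" "l \<noteq> 0" "j \<noteq> 0" using False by blast
  then show ?thesis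
    by cases (use h in \<open>auto simp: canon_def\<close>)
qed

definition mat_comp :: "int \<Rightarrow> (int \<Rightarrow> int \<Rightarrow> int \<Rightarrow> complex) \<Rightarrow> (int \<Rightarrow> int \<Rightarrow> int \<Rightarrow> complex) \<Rightarrow> int \<Rightarrow> int \<Rightarrow> int \<Rightarrow> complex" where
  "mat_comp b m' m n k l = (\<Sum>q\<in>{0..<int d}. m n k q * m' (n + b) q l)"

lemma canon_00: "c \<in> coord_fun d \<Longrightarrow> canon d c 0 0 n k l =
    (if k = l \<and> k \<in> {0..<int d} \<and> (if k = 0 then 0 \<le> n \<and> n \<le> int d - 2 else n = 0) then c k k 0 else 0)"
  using coord_fun_aff_idx[OF d3, of c l k 0] d3 by (auto simp: canon_def aff_idx_iff[OF d3])

lemma canon_20: "c \<in> coord_fun d \<Longrightarrow> canon d c 2 0 n k l =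
    (if k = l \<and> k \<in> {0..<int d} \<and> n = 0 then c k k 2 else 0)"
  using coord_fun_aff_idx[OF d3, of c l k 2] d3 by (auto simp: canon_def aff_idx_iff[OF d3])

text \<open>The arrows between 0 and 1 are excluded because they live in the two remaining
  bidegrees.\<close>

lemma canon_10: "c \<in> coord_fun d \<Longrightarrow> canon d c 1 0 n k l =
    (if n = 0 \<and> \<not> (k = 0 \<and> l = 1) \<and> \<not> (k = 1 \<and> l = 0) then c l k 1 else 0)"
  using coord_fun_aff_idx[OF d3, of c l k 1] d3 by (cases "c l k 1 = 0") (auto simp: canon_def aff_idx_iff[OF d3])

lemma canon_01: "canon d c (1 - int d) (int d - 2) n k l = (if n = 0 \<and> k = 1 \<and> l = 0 then c 0 1 1 else 0)"
  using d3 by (auto simp: canon_def)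

lemma canon_1d: "canon d c (int d + 1) (2 - int d) n k l = (if n = int d - 2 \<and> k = 0 \<and> l = 1 then c 1 0 1 else 0)"
  using d3 by (auto simp: canon_def)

lemma sum_bidegs: "(\<Sum>p\<in>bidegs. f p) = f (0, 0) + f (1, 0) + f (2, 0) + f (1 - int d, int d - 2) + f (int d + 1, 2 - int d)"
  for f :: "int \<times> int \<Rightarrow> complex"
  using d3 by (simp add: bidegs_def add.assoc)

lemma sum_one: "q0 \<in> {0..<int d} \<Longrightarrow> (\<And>q. q \<in> {0..<int d} \<Longrightarrow> q \<noteq> q0 \<Longrightarrow> f q = 0) \<Longrightarrow>
    (\<Sum>q\<in>{0..<int d}. f q) = f q0" for f :: "int \<Rightarrow> complex"
  by (subst sum.remove[of _ q0]) (auto intro!: sum.neutral)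

lemma sum_two: "\<lbrakk>a \<in> {0..<int d}; b \<in> {0..<int d}; a \<noteq> b; \<And>q. q \<in> {0..<int d} \<Longrightarrow> q \<noteq> a \<Longrightarrow> q \<noteq> b \<Longrightarrow> f q = 0\<rbrakk> \<Longrightarrow>
    (\<Sum>q\<in>{0..<int d}. f q) = f a + f b" for f :: "int \<Rightarrow> complex"
  by (subst sum.mono_neutral_right[of _ "{a, b}"]) auto

lemma mat_comp_zero1: "(\<And>q. m n k q = 0) \<Longrightarrow> mat_comp b m' m n k l = 0"
  and mat_comp_zero2: "(\<And>q. m' (n + b) q l = 0) \<Longrightarrow> mat_comp b m' m n k l = 0"
  by (simp_all add: mat_comp_def)

definition diff_mat :: "int \<Rightarrow> int \<Rightarrow> int \<Rightarrow> complex" where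
  "diff_mat n k l = (if k = 0 \<and> l = 0 \<and> 0 \<le> n \<and> n < int d - 2 then 1 else 0)"

lemma diff_mat_left:
  assumes s: "supp d i j m" and kl: "k \<in> {0..<int d}" "l \<in> {0..<int d}"
  shows "(\<Sum>q\<in>{0..<int d}. if fin_idx d (vert d n k) (vert d (n + 1) q) (gshift (n + 1) q - gshift n k) \<and>
      fin_idx d (vert d (n + 1) q) (vert d (n + 1 + j) l) (gshift (n + 1 + j) l + i - gshift (n + 1) q)
      then diff_mat n k q * m (n + 1) q l else 0) = (if k = 0 \<and> 0 \<le> n \<and> n < int d - 2 then m (n + 1) 0 l else 0)"
    (is "(\<Sum>q\<in>_. ?f q) = _")
proof -
  have "(\<Sum>q\<in>{0..<int d}. ?f q) = ?f 0"
    using d3 by (intro sum_one) (auto simp: diff_mat_def)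
  also have "\<dots> = (if k = 0 \<and> 0 \<le> n \<and> n < int d - 2 then m (n + 1) 0 l else 0)"
  proof (cases "k = 0 \<and> 0 \<le> n \<and> n < int d - 2 \<and> m (n + 1) 0 l \<noteq> 0")
    case True
    then have "adm d i j (n + 1) 0 l" using s unfolding supp_def by blast
    moreover have "fin_idx d (vert d n 0) (vert d (n + 1) 0) (gshift (n + 1) 0 - gshift n 0)"
      using True d3 by (auto simp: fin_idx_iff[OF d3] vert_def gshift_def)
    ultimately show ?thesis using True by (simp add: adm_def diff_mat_def)
  qed (auto simp: diff_mat_def)
  finally show ?thesis .
qed

lemma diff_mat_right:
  assumes s: "supp d i j m" and kl: "k \<in> {0..<int d}" "l \<in> {0..<int d}"
  shows "(\<Sum>q\<in>{0..<int d}. if fin_idx d (vert d n k) (vert d (n + j) q) (gshift (n + j) q + i - gshift n k) \<and>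
      fin_idx d (vert d (n + j) q) (vert d (n + j + 1) l) (gshift (n + j + 1) l + i - (gshift (n + j) q + i))
      then m n k q * (e * diff_mat (n + j) q l) else 0) = (if l = 0 \<and> 0 \<le> n + j \<and> n + j < int d - 2 then e * m n k 0 else 0)"
    (is "(\<Sum>q\<in>_. ?f q) = _")
proof -
  have "(\<Sum>q\<in>{0..<int d}. ?f q) = ?f 0"
    using d3 by (intro sum_one) (auto simp: diff_mat_def)
  also have "\<dots> = (if l = 0 \<and> 0 \<le> n + j \<and> n + j < int d - 2 then e * m n k 0 else 0)"
  proof (cases "l = 0 \<and> 0 \<le> n + j \<and> n + j < int d - 2 \<and> m n k 0 \<noteq> 0")
    case True
    then have "adm d i j n k 0" using s unfolding supp_def by blast
    moreover have "fin_idx d (vert d (n + j) 0) (vert d (n + j + 1) 0) (gshift (n + j + 1) 0 + i - (gshift (n + j) 0 + i))"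
      using True d3 by (auto simp: fin_idx_iff[OF d3] vert_def gshift_def)
    ultimately show ?thesis using True by (simp add: adm_def diff_mat_def)
  qed (auto simp: diff_mat_def)
  finally show ?thesis .
qed

lemma diff_mat_diff_mat:
  assumes kl: "k \<in> {0..<int d}" "l \<in> {0..<int d}" and F: "fin_idx d (vert d n k) (vert d (n + 2) l) (gshift (n + 2) l - gshift n k)"
  shows "diff_mat n k q * diff_mat (n + 1) q l = 0"
  using F d3 by (auto simp: diff_mat_def fin_idx_iff[OF d3] vert_def gshift_def)

lemma mat_comp_00_left:
  assumes "c \<in> coord_fun d" "l \<in> {0..<int d}" "b = 0 \<or> l \<noteq> 0" 
    and "if l = 0 then 0 \<le> n + b \<and> n + b \<le> int d - 2 else n + b = 0"
  shows "mat_comp b (canon d c 0 0) m n k l = m n k l * c l l 0"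
proof -
  have "mat_comp b (canon d c 0 0) m n k l = m n k l * canon d c 0 0 (n + b) l l"
    unfolding mat_comp_def by (rule sum_one) (use assms in \<open>auto simp: canon_00\<close>)
  also have "canon d c 0 0 (n + b) l l = c l l 0" using assms by (simp add: canon_00)
  finally show ?thesis .
qed

lemma mat_comp_00_right:
  assumes "c \<in> coord_fun d" "k \<in> {0..<int d}"
    and "if k = 0 then 0 \<le> n \<and> n \<le> int d - 2 else n = 0"
  shows "mat_comp 0 m (canon d c 0 0) n k l = c k k 0 * m n k l"
proof -
  have "mat_comp 0 m (canon d c 0 0) n k l = canon d c 0 0 n k k * m (n + 0) k l"
    unfolding mat_comp_def by (rule sum_one) (use assms in \<open>auto simp: canon_00\<close>)
  also have "canon d c 0 0 n k k = c k k 0" using assms by (simp add: canon_00)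
  finally show ?thesis by simp
qed

text \<open>The comparison of structure constants. A bidegree splits among the five in few ways. For
  t = 0 only (0, 0) + (0, 0) counts; for t = 1 one factor is an idempotent. A loop has the
  splittings with an idempotent and (1, 0) + (1, 0). The detour of the loop at 1 through 0, and that
  of the loop at 0 through 1, come from the bidegrees (1 - d, d - 2) and (d + 1, 2 - d), in one
  order or the other.\<close>

lemma symb_mat_comp:
  assumes c: "c \<in> coord_fun d" and c': "c' \<in> coord_fun d" and aff_idx: "aff_idx d l k t" and b: "bideg d l k t = (i, j)"
  shows "(\<Sum>(a, b)\<in>bidegs. symb d i j (mat_comp b (canon d c' (i - a) (j - b)) (canon d c a b)) l k t) = coord_mult d c' c l k t"
proof -
  let ?K = "\<lambda>a b. mat_comp b (canon d c' (i - a) (j - b)) (canon d c a b)"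
  have out: "symb d i j (?K a b) l k t = 0" if "(i - a, j - b) \<notin> bidegs" for a b
  proof -
    have "?K a b n k l = 0" for n k l by (rule mat_comp_zero2) (rule canon_bidegs[OF c' that])
    then show ?thesis by (simp add: symb_def)
  qed
  have rl: "l \<in> {0..<int d}" "k \<in> {0..<int d}" using aff_idx by (auto simp: aff_idx_def)
  consider "t = 0" "k = l" | "t = 1" | "t = 2" "k = l" "l \<noteq> 0" | "t = 2" "k = 0" "l = 0"
    using aff_idx by (auto simp: aff_idx_def)
  then show ?thesis
  proof cases
    case 1
    then have ij: "i = 0" "j = 0" using b by (auto simp: bideg_def)
    \<comment> \<open>If the first factor has one of the four other bidegrees, the second one would
      need a bidegree in which no triple exists.\<close>
    have nin: "(-1, 0) \<notin> bidegs" "(-2, 0) \<notin> bidegs" "(int d - 1, 2 - int d) \<notin> bidegs" "(- int d - 1, int d - 2) \<notin> bidegs"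
      using d3 by (auto simp: bidegs_def)
    have "(\<Sum>(a, b)\<in>bidegs. symb d i j (?K a b) l k t) = symb d i j (?K 0 0) l k t"
      unfolding sum_bidegs using nin ij out[of 1 0] out[of 2 0] out[of "1 - int d" "int d - 2"] out[of "int d + 1" "2 - int d"]
      by simp
    also have "\<dots> = ?K 0 0 0 l l" using 1 aff_idx b ij d3 by (auto simp: symb_def)
    also have "\<dots> = c' l l 0 * c l l 0"
      using mat_comp_00_right[OF c rl(1), of 0 "canon d c' 0 0" l] d3 rl ij c' by (simp add: canon_00)
    also have "\<dots> = coord_mult d c' c l k t" using 1 aff_idx by (simp add: coord_mult_def)
    finally show ?thesis .
  next
    case 2
    have lk: "l \<noteq> k" using aff_idx 2 d3 by (auto simp: aff_idx_iff[OF d3])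
    have m: "coord_mult d c' c l k t = c' l l 0 * c l k 1 + c' l k 1 * c k k 0" using aff_idx 2 by (simp add: coord_mult_def)
    have pick: "c l k 1 = symb d i j (canon d c i j) l k 1" "c' l k 1 = symb d i j (canon d c' i j) l k 1"
      using b 2 by (simp_all add: symb_canon[OF d3] c c')
    have ij: "i = 1 \<and> j = 0 \<or> i = 1 - int d \<and> j = int d - 2 \<or> i = int d + 1 \<and> j = 2 - int d"
      using b 2 by (auto simp: bideg_def split: if_splits)
    have "(\<Sum>(a, b)\<in>bidegs. symb d i j (?K a b) l k t) = symb d i j (?K 0 0) l k t + symb d i j (?K i j) l k t"
    proof -
      have "(- 1, 0) \<notin> bidegs" "(1 - (1 - int d), 0 - (int d - 2)) \<notin> bidegs" "(1 - (int d + 1), 0 - (2 - int d)) \<notin> bidegs"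
        "(1 - int d - 1, int d - 2) \<notin> bidegs" "(1 - int d - 2, int d - 2) \<notin> bidegs" "(1 - int d - (int d + 1), int d - 2 - (2 - int d)) \<notin> bidegs"
        "(int d, 2 - int d) \<notin> bidegs" "(int d + 1 - 2, 2 - int d) \<notin> bidegs" "(int d + 1 - (1 - int d), 2 - int d - (int d - 2)) \<notin> bidegs"
        using d3 by (auto simp: bidegs_def)
      then show ?thesis unfolding sum_bidegs
        using ij d3 out[of 1 0] out[of 2 0] out[of "1 - int d" "int d - 2"] out[of "int d + 1" "2 - int d"] by auto
    qed
    also have "symb d i j (?K 0 0) l k t = c k k 0 * c' l k 1"
    proof -
      have P: "?K 0 0 n k l = c k k 0 * canon d c' i j n k l" if "if k = 0 then 0 \<le> n \<and> n \<le> int d - 2 else n = 0" for n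
        using mat_comp_00_right[OF c rl(2) that] by simp
      show ?thesis unfolding pick(2) using aff_idx b 2 d3 lk P[of 0] P[of "int d - 2"]
        by (auto simp: symb_def)
    qed
    also have "symb d i j (?K i j) l k t = c l k 1 * c' l l 0"
    proof -
      have P: "mat_comp j (canon d c' 0 0) (canon d c i j) n k l = canon d c i j n k l * c' l l 0"
        if "if l = 0 then 0 \<le> n + j \<and> n + j \<le> int d - 2 else n + j = 0" for n
        unfolding mat_comp_def using that rl(1) c'
        by (subst sum_one[of l]) (auto simp: canon_00)
      show ?thesis unfolding pick(1) using aff_idx b 2 d3 lk P[of 0] P[of "int d - 2"] ij
        by (auto simp: symb_def bideg_def split: if_splits)
    qed
    finally show ?thesis using m by (simp add: mult.commute add.commute)
  next
    case 3
    then have ij: "i = 2" "j = 0" using b by (auto simp: bideg_def)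
    have l: "1 \<le> l" "l < int d" using rl 3 by auto
    define u where "u = (l + 1) mod int d"
    define w where "w = (l - 1) mod int d"
    have u: "u = (if l = int d - 1 then 0 else l + 1)" and w: "w = l - 1"
      using mod_simps[OF d3, of l] l by (auto simp: u_def w_def)
    have uw: "u \<in> {0..<int d}" "w \<in> {0..<int d}" "u \<noteq> w" using u w l d3 by auto
    have K: "symb d i j (?K a b) l k t = ?K a b 0 l l" for a b
      using aff_idx 3 ij b by (auto simp: symb_def)
    have S: "(\<Sum>(a, b)\<in>bidegs. symb d i j (?K a b) l k t) =
      mat_comp 0 (canon d c' 2 0) (canon d c 0 0) 0 l l + mat_comp 0 (canon d c' 1 0) (canon d c 1 0) 0 l l
      + mat_comp 0 (canon d c' 0 0) (canon d c 2 0) 0 l l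
      + mat_comp (int d - 2) (canon d c' (int d + 1) (2 - int d)) (canon d c (1 - int d) (int d - 2)) 0 l l
      + mat_comp (2 - int d) (canon d c' (1 - int d) (int d - 2)) (canon d c (int d + 1) (2 - int d)) 0 l l"
      unfolding sum_bidegs prod.case K unfolding ij by (simp add: algebra_simps)
    have e1: "mat_comp 0 (canon d c' 2 0) (canon d c 0 0) 0 l l = c l l 0 * c' l l 2"
      using mat_comp_00_right[OF c rl(1), of 0 "canon d c' 2 0" l] 3 rl c' by (simp add: canon_20)
    have e2: "mat_comp 0 (canon d c' 0 0) (canon d c 2 0) 0 l l = c l l 2 * c' l l 0"
      using mat_comp_00_left[OF c' rl(1), of 0 0 "canon d c 2 0" l] 3 rl c by (simp add: canon_20)
    have e3: "mat_comp (2 - int d) (canon d c' (1 - int d) (int d - 2)) (canon d c (int d + 1) (2 - int d)) 0 l l = 0"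
      using 3 by (intro mat_comp_zero1) (simp add: canon_1d)
    \<comment> \<open>The detours through the two neighbours of l. For l = 1 the one through 0 is
      absent from (1, 0) + (1, 0) and is supplied by the other product.\<close>
    have e4: "mat_comp 0 (canon d c' 1 0) (canon d c 1 0) 0 l l
      + mat_comp (int d - 2) (canon d c' (int d + 1) (2 - int d)) (canon d c (1 - int d) (int d - 2)) 0 l l
      = c u l 1 * c' l u 1 + c w l 1 * c' l w 1"
    proof -
      have "mat_comp 0 (canon d c' 1 0) (canon d c 1 0) 0 l l =
        canon d c 1 0 0 l u * canon d c' 1 0 (0 + 0) u l + canon d c 1 0 0 l w * canon d c' 1 0 (0 + 0) w l"
        unfolding mat_comp_def
      proof (rule sum_two[OF uw])
        fix q assume q: "q \<in> {0..<int d}" "q \<noteq> u" "q \<noteq> w"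
        then have "\<not> aff_idx d q l 1" using u w l by (auto simp: aff_idx_iff[OF d3])
        then show "canon d c 1 0 0 l q * canon d c' 1 0 (0 + 0) q l = 0"
          using coord_fun_aff_idx[OF d3 c, of q l 1] by (auto simp: canon_10[OF c])
      qed
      moreover have "mat_comp (int d - 2) (canon d c' (int d + 1) (2 - int d)) (canon d c (1 - int d) (int d - 2)) 0 l l =
        (if l = 1 then c 0 1 1 * c' 1 0 1 else 0)"
      proof -
        have "mat_comp (int d - 2) (canon d c' (int d + 1) (2 - int d)) (canon d c (1 - int d) (int d - 2)) 0 l l =
          canon d c (1 - int d) (int d - 2) 0 l 0 * canon d c' (int d + 1) (2 - int d) (0 + (int d - 2)) 0 l"
          unfolding mat_comp_def by (rule sum_one) (use d3 in \<open>auto simp: canon_01\<close>)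
        then show ?thesis by (simp add: canon_01 canon_1d)
      qed
      ultimately show ?thesis using u w l d3 by (auto simp: canon_10 c c')
    qed
    have r: "x1 + x2 + x3 + x4 + x5 = x1 + x3 + (x2 + x4) + x5" for x1 x2 x3 x4 x5 :: complex by simp
    have *: "(\<Sum>(a, b)\<in>bidegs. symb d i j (?K a b) l k t) = c l l 0 * c' l l 2 + c l l 2 * c' l l 0
        + (c u l 1 * c' l u 1 + c w l 1 * c' l w 1)"
      unfolding S[unfolded r] e1 e2 e3 e4 by simp
    have "coord_mult d c' c l k t = c' l l 0 * c l l 2 + c' l l 2 * c l l 0 + c' l w 1 * c w l 1 + c' l u 1 * c u l 1"
      unfolding u_def w_def using aff_idx 3 by (simp add: coord_mult_def loop_sign_def)
    then show ?thesis unfolding * by (simp add: algebra_simps)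
  next
    case 4
    then have ij: "i = 2" "j = 0" using b by (auto simp: bideg_def)
    have K: "symb d i j (?K a b) l k t = (\<Sum>n<d - 1. (-1) ^ n * ?K a b (int n) 0 0)" for a b
      using aff_idx 4 ij b by (auto simp: symb_def)
    have z: "0 \<in> {0..<int d}" "int d - 1 \<in> {0..<int d}" "1 \<in> {0..<int d}" using d3 by auto
    have single: "(\<Sum>n<d - 1. (-1) ^ n * f (int n)) = (-1) ^ n0 * f (int n0)"
      if "n0 < d - 1" "\<And>n. n < d - 1 \<Longrightarrow> n \<noteq> n0 \<Longrightarrow> f (int n) = 0" for f :: "int \<Rightarrow> complex" and n0
      using that by (subst sum.remove[of _ n0]) (auto intro!: sum.neutral)
    have ne: "int n \<noteq> int d - 2" if "n \<noteq> d - 2" for n using that d3 by auto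
    have d1: "0 < d - 1" "d - 2 < d - 1" "int (d - 2) = int d - 2" using d3 by auto
    have S: "(\<Sum>(a, b)\<in>bidegs. symb d i j (?K a b) l k t) =
      (\<Sum>n<d - 1. (-1) ^ n * mat_comp 0 (canon d c' 2 0) (canon d c 0 0) (int n) 0 0)
      + (\<Sum>n<d - 1. (-1) ^ n * mat_comp 0 (canon d c' 1 0) (canon d c 1 0) (int n) 0 0)
      + (\<Sum>n<d - 1. (-1) ^ n * mat_comp 0 (canon d c' 0 0) (canon d c 2 0) (int n) 0 0)
      + (\<Sum>n<d - 1. (-1) ^ n * mat_comp (int d - 2) (canon d c' (int d + 1) (2 - int d)) (canon d c (1 - int d) (int d - 2)) (int n) 0 0)
      + (\<Sum>n<d - 1. (-1) ^ n * mat_comp (2 - int d) (canon d c' (1 - int d) (int d - 2)) (canon d c (int d + 1) (2 - int d)) (int n) 0 0)"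
      unfolding sum_bidegs prod.case K unfolding ij by (simp add: algebra_simps)
    have e1: "(\<Sum>n<d - 1. (-1) ^ n * mat_comp 0 (canon d c' 2 0) (canon d c 0 0) (int n) 0 0) = c 0 0 0 * c' 0 0 2"
    proof -
      have P: "mat_comp 0 (canon d c' 2 0) (canon d c 0 0) (int n) 0 0 = c 0 0 0 * canon d c' 2 0 (int n) 0 0" if "n < d - 1" for n
        using mat_comp_00_right[OF c z(1), of "int n"] that by auto
      then show ?thesis using P[of 0] c' d3 by (subst single[of 0]) (auto simp: canon_20)
    qed
    have e2: "(\<Sum>n<d - 1. (-1) ^ n * mat_comp 0 (canon d c' 0 0) (canon d c 2 0) (int n) 0 0) = c 0 0 2 * c' 0 0 0"
    proof -
      have P: "mat_comp 0 (canon d c' 0 0) (canon d c 2 0) (int n) 0 0 = canon d c 2 0 (int n) 0 0 * c' 0 0 0" if "n < d - 1" for n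
        using mat_comp_00_left[OF c' z(1), of 0 "int n"] that by auto
      then show ?thesis using P[of 0] c d3 by (subst single[of 0]) (auto simp: canon_20)
    qed
    have e3: "(\<Sum>n<d - 1. (-1) ^ n * mat_comp 0 (canon d c' 1 0) (canon d c 1 0) (int n) 0 0) = c (int d - 1) 0 1 * c' 0 (int d - 1) 1"
    proof -
      have "mat_comp 0 (canon d c' 1 0) (canon d c 1 0) 0 0 0 = canon d c 1 0 0 0 (int d - 1) * canon d c' 1 0 (0 + 0) (int d - 1) 0"
        unfolding mat_comp_def
      proof (rule sum_one[OF z(2)])
        fix q assume q: "q \<in> {0..<int d}" "q \<noteq> int d - 1"
        show "canon d c 1 0 0 0 q * canon d c' 1 0 (0 + 0) q 0 = 0"
          using q coord_fun_aff_idx[OF d3 c, of q 0 1] by (auto simp: canon_10[OF c] aff_idx_iff[OF d3])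
      qed
      then have "mat_comp 0 (canon d c' 1 0) (canon d c 1 0) 0 0 0 = c (int d - 1) 0 1 * c' 0 (int d - 1) 1"
        using d3 by (auto simp: canon_10 c c')
      then show ?thesis using d1 by (subst single[of 0]) (auto simp: mat_comp_def canon_10[OF c])
    qed
    have e4: "(\<Sum>n<d - 1. (-1) ^ n * mat_comp (int d - 2) (canon d c' (int d + 1) (2 - int d)) (canon d c (1 - int d) (int d - 2)) (int n) 0 0) = 0"
      by (simp add: mat_comp_def canon_01)
    have e5: "(\<Sum>n<d - 1. (-1) ^ n * mat_comp (2 - int d) (canon d c' (1 - int d) (int d - 2)) (canon d c (int d + 1) (2 - int d)) (int n) 0 0)
      = (-1) ^ d * (c 1 0 1 * c' 0 1 1)"
    proof -
      have "mat_comp (2 - int d) (canon d c' (1 - int d) (int d - 2)) (canon d c (int d + 1) (2 - int d)) (int d - 2) 0 0 =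
        canon d c (int d + 1) (2 - int d) (int d - 2) 0 1 * canon d c' (1 - int d) (int d - 2) (int d - 2 + (2 - int d)) 1 0"
        unfolding mat_comp_def by (rule sum_one[OF z(3)]) (auto simp: canon_1d)
      then have "mat_comp (2 - int d) (canon d c' (1 - int d) (int d - 2)) (canon d c (int d + 1) (2 - int d)) (int d - 2) 0 0 = c 1 0 1 * c' 0 1 1"
        by (simp add: canon_1d canon_01)
      \<comment> \<open>The detour through 1 sits at the last term n = d - 2, where the alternating
        sum has the sign (-1)^(d - 2); this is \<open>loop_sign\<close> at 0.\<close>
      moreover have "(-1) ^ (d - 2) = ((-1) ^ d :: complex)" using d3 by (cases d; cases "d - 1") (auto simp: numeral_2_eq_2)
      ultimately show ?thesis using d1
        using ne by (subst single[of "d - 2"]) (auto simp: mat_comp_def canon_1d)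
    qed
    have *: "(\<Sum>(a, b)\<in>bidegs. symb d i j (?K a b) l k t) = c 0 0 0 * c' 0 0 2 + c (int d - 1) 0 1 * c' 0 (int d - 1) 1
       + c 0 0 2 * c' 0 0 0 + (-1) ^ d * (c 1 0 1 * c' 0 1 1)"
      unfolding S e1 e2 e3 e4 e5 by simp
    have "(0 - 1) mod int d = int d - 1" "(0 + 1) mod int d = 1" using mod_simps[OF d3, of 0] d3 by auto
    then have "coord_mult d c' c 0 0 2 = c' 0 0 0 * c 0 0 2 + c' 0 0 2 * c 0 0 0 + c' 0 (int d - 1) 1 * c (int d - 1) 0 1
      + (-1) ^ d * (c' 0 1 1 * c 1 0 1)"
      using aff_idx 4 unfolding coord_mult_def loop_sign_def by simp
    then show ?thesis unfolding * using 4 by (simp add: algebra_simps)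
  qed
qed

end

section \<open>Chain maps and homotopies in coordinates\<close>

context zigzag_coords
begin

text \<open>Only differences of shifts enter, so a map and its grading shift have the same
  matrix.\<close>

lemma hom_shift: "hom v (\<lambda>k. s k + a) v' (\<lambda>k. s' k + a) m = hom v s v' s' m"
  by (simp add: hom_def act_def)

lemma hom_eq_iff:
  "(\<forall>x\<in>MC v. hom v s v' s' m x = hom v s v' s' m' x) \<longleftrightarrow>
    (\<forall>k\<in>I. \<forall>l\<in>I. F (v k) (v' l) (s' l - s k) \<longrightarrow> m k l = m' k l)"
proof
  assume "\<forall>x\<in>MC v. hom v s v' s' m x = hom v s v' s' m' x"
  then have "hom v s v' s' m = hom v s v' s' m'" unfolding hom_def by (auto intro!: restrict_ext)
  then show "\<forall>k\<in>I. \<forall>l\<in>I. F (v k) (v' l) (s' l - s k) \<longrightarrow> m k l = m' k l"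
    using mat_hom[of _ _ v s v' s' m] mat_hom[of _ _ v s v' s' m'] by metis
next
  assume "\<forall>k\<in>I. \<forall>l\<in>I. F (v k) (v' l) (s' l - s k) \<longrightarrow> m k l = m' k l"
  then have "hom v s v' s' m = hom v s v' s' m'" by (intro hom_cong) blast
  then show "\<forall>x\<in>MC v. hom v s v' s' m x = hom v s v' s' m' x" by simp
qed

lemma mat_F:
  assumes B: "bricks N v s" and B': "bricks N' v' s'" and f: "f \<in> gr_hom A (msum I N) (msum I N')"
    and "l \<in> I" and "mat v s v' s' f k l \<noteq> 0"
  shows "F (v k) (v' l) (s' l - s k)"
proof -
  have "f (slot k (W (v k) (v k) 0)) \<in> MC v'"
    using f slot_MC[of _ v k, OF W_C] unfolding gr_hom_def M_carrier[OF B] M_carrier[OF B'] by (auto simp: PiE_iff)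
  then show ?thesis using assms(5) kappa_fin_idx[OF MC_carrier[OF _ assms(4)]] unfolding mat_def by blast
qed

lemma mshift_msum: "mshift i (msum J N) = msum J (\<lambda>k. mshift i (N k))"
  by (simp add: msum_def mshift_def)

end

text \<open>The direct sum of all X_k, seen as d summands in every homological degree and known only
  through its terms and the matrix of its differential. This keeps the case distinctions in the
  definition of the X_k out of the argument.\<close>

locale zigzag_complex = zigzag_coords +
  fixes X :: "('a, int \<Rightarrow> 'a) cochain" and N :: "int \<Rightarrow> int \<Rightarrow> ('a, 'a) graded"
  assumes obj_X: "obj X n = msum I (N n)"
    and bricks_X: "bricks (N n) (vert d n) (gshift n)"
    and diff_X: "diff X n = hom (vert d n) (gshift n) (vert d (n + 1)) (gshift (n + 1)) (diff_mat d n)"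
begin

abbreviation "Y i j \<equiv> bishift i j X"
abbreviation "NY i j n \<equiv> (\<lambda>k. mshift i (N (n + j) k))"
abbreviation "v n \<equiv> vert d n"
abbreviation "sh i n \<equiv> (\<lambda>k. gshift n k + i)"

definition hom_at :: "int \<Rightarrow> int \<Rightarrow> int \<Rightarrow> (int \<Rightarrow> int \<Rightarrow> complex) \<Rightarrow> (int \<Rightarrow> 'a) \<Rightarrow> int \<Rightarrow> 'a" where
  "hom_at i j n m = hom (v n) (gshift n) (v (n + j)) (sh i (n + j)) m"

lemma obj_Y: "obj (Y i j) n = msum I (NY i j n)"
  by (simp add: bishift_def hshift_def grshift_def obj_X mshift_msum)

lemma bricks_Y: "bricks (NY i j n) (v (n + j)) (sh i (n + j))"
  using bricks_X[of "n + j"] unfolding bricks_def by (auto intro: brick_mshift)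

text \<open>\<open>hshift\<close> negates the differential for odd j; with \<open>eps j\<close> both
  parities become one matrix. Negation in a shifted module is that of the module itself, because
  \<open>mshift\<close> changes the grading only.\<close>

lemma diff_Y: "diff (Y i j) n = hom (v (n + j)) (sh i (n + j)) (v (n + j + 1)) (sh i (n + j + 1)) (\<lambda>k l. eps j * diff_mat d (n + j) k l)"
proof -
  have carr: "carrier (mshift i (obj X (n + j))) = MC (v (n + j))"
    unfolding obj_X mshift_msum by (rule M_carrier[OF bricks_Y])
  have inv: "\<ominus>\<^bsub>mshift i (obj X m)\<^esub> x = \<ominus>\<^bsub>obj X m\<^esub> x" for m x
    by (simp add: a_inv_def m_inv_def mshift_def)
  have d: "diff (Y i j) n = (if even j then diff X (n + j)
        else (\<lambda>x \<in> MC (v (n + j)). \<ominus>\<^bsub>obj X (n + j + 1)\<^esub> diff X (n + j) x))"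
    by (simp add: bishift_def hshift_def grshift_def carr inv)
  show ?thesis
  proof (cases "even j")
    case True
    then show ?thesis unfolding d hom_shift diff_X by (simp add: eps_def)
  next
    case False
    have "(\<lambda>x \<in> MC (v (n + j)). \<ominus>\<^bsub>obj X (n + j + 1)\<^esub> diff X (n + j) x) =
      hom (v (n + j)) (gshift (n + j)) (v (n + j + 1)) (gshift (n + j + 1)) (\<lambda>k l. - diff_mat d (n + j) k l)" (is "?L = ?R")
    proof
      fix x
      show "?L x = ?R x"
      proof (cases "x \<in> MC (v (n + j))")
        case True
        then show ?thesis unfolding diff_X obj_X by (simp add: hom_uminus[OF bricks_X])
      qed (simp add: hom_def)
    qed
    then show ?thesis using False unfolding d hom_shift by (simp add: eps_def)
  qed
qed

lemma adm_F: "\<lbrakk>k \<in> I; l \<in> I\<rbrakk> \<Longrightarrow> adm d i j n k l \<longleftrightarrow> F (v n k) (v (n + j) l) (sh i (n + j) l - gshift n k)"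
  by (simp add: adm_def)

lemma gr_hom_hom_at: "f \<in> gr_hom A (obj X n) (obj (Y i j) n) \<longleftrightarrow>
    (\<exists>m. (\<forall>k l. m k l \<noteq> 0 \<longrightarrow> adm d i j n k l) \<and> f = hom_at i j n m)"
proof
  assume f: "f \<in> gr_hom A (obj X n) (obj (Y i j) n)"
  note f' = f[unfolded obj_X obj_Y]
  let ?M = "mat (v n) (gshift n) (v (n + j)) (sh i (n + j)) f"
  let ?m = "\<lambda>k l. if k \<in> I \<and> l \<in> I then ?M k l else 0"
  have "hom_at i j n ?m = hom (v n) (gshift n) (v (n + j)) (sh i (n + j)) ?M"
    unfolding hom_at_def by (rule hom_cong) auto
  also have "\<dots> = f" by (rule hom_mat[OF bricks_X bricks_Y f', symmetric])
  finally have "f = hom_at i j n ?m" by simp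
  moreover have "\<forall>k l. ?m k l \<noteq> 0 \<longrightarrow> adm d i j n k l"
  proof (intro allI impI)
    fix k l assume nz: "?m k l \<noteq> 0"
    then have kl: "k \<in> I" "l \<in> I" "?M k l \<noteq> 0" by (auto split: if_splits)
    then show "adm d i j n k l" unfolding adm_F[OF kl(1,2)] using mat_F[OF bricks_X bricks_Y f' kl(2,3)] by simp
  qed
  ultimately show "\<exists>m. (\<forall>k l. m k l \<noteq> 0 \<longrightarrow> adm d i j n k l) \<and> f = hom_at i j n m"
    by (intro exI[of _ ?m] conjI)
next
  assume "\<exists>m. (\<forall>k l. m k l \<noteq> 0 \<longrightarrow> adm d i j n k l) \<and> f = hom_at i j n m"
  then show "f \<in> gr_hom A (obj X n) (obj (Y i j) n)"
    unfolding obj_X obj_Y hom_at_def using hom_gr_hom[OF bricks_X bricks_Y] by blast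
qed

lemma hom_at_diff:
  assumes "supp d i j m" "x \<in> MC (v n)"
  shows "hom_at i j (n + 1) (m (n + 1)) (diff X n x) =
    hom_at i (j + 1) n (\<lambda>k l. if k = 0 \<and> 0 \<le> n \<and> n < int d - 2 then m (n + 1) 0 l else 0) x"
proof -
  have e: "n + 1 + j = n + (j + 1)" by simp
  show ?thesis unfolding hom_at_def diff_X hom_comp[OF assms(2)] e
  proof (rule fun_cong[OF hom_cong])
    fix k l assume kl: "k \<in> I" "l \<in> I"
    show "(\<Sum>q\<in>I. if F (v n k) (v (n + 1) q) (gshift (n + 1) q - gshift n k) \<and>
        F (v (n + 1) q) (v (n + (j + 1)) l) (gshift (n + (j + 1)) l + i - gshift (n + 1) q)
      then diff_mat d n k q * m (n + 1) q l else 0) = (if k = 0 \<and> 0 \<le> n \<and> n < int d - 2 then m (n + 1) 0 l else 0)"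
      using diff_mat_left[OF d3 assms(1) kl, of n] unfolding e .
  qed
qed

lemma diff_hom_at:
  assumes "supp d i j m" "x \<in> MC (v n)"
  shows "hom (v (n + j)) (sh i (n + j)) (v (n + j + 1)) (sh i (n + j + 1)) (\<lambda>k l. e * diff_mat d (n + j) k l) (hom_at i j n (m n) x) =
    hom_at i (j + 1) n (\<lambda>k l. if l = 0 \<and> 0 \<le> n + j \<and> n + j < int d - 2 then e * m n k 0 else 0) x"
proof -
  have e: "n + (j + 1) = n + j + 1" by simp
  show ?thesis unfolding hom_at_def hom_comp[OF assms(2)] e
  proof (rule fun_cong[OF hom_cong])
    fix k l assume kl: "k \<in> I" "l \<in> I"
    show "(\<Sum>q\<in>I. if F (v n k) (v (n + j) q) (gshift (n + j) q + i - gshift n k) \<and>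
        F (v (n + j) q) (v (n + j + 1) l) (gshift (n + j + 1) l + i - (gshift (n + j) q + i))
      then m n k q * (e * diff_mat d (n + j) q l) else 0) = (if l = 0 \<and> 0 \<le> n + j \<and> n + j < int d - 2 then e * m n k 0 else 0)"
      by (rule diff_mat_right[OF d3 assms(1) kl])
  qed
qed

lemma hom_at_eq_iff: "(\<forall>x\<in>MC (v n). hom_at i j n m x = hom_at i j n m' x) \<longleftrightarrow> (\<forall>k l. adm d i j n k l \<longrightarrow> m k l = m' k l)"
  unfolding hom_at_def hom_eq_iff by (auto simp: adm_def)

definition chain :: "int \<Rightarrow> int \<Rightarrow> (int \<Rightarrow> int \<Rightarrow> int \<Rightarrow> complex) \<Rightarrow> int \<Rightarrow> (int \<Rightarrow> 'a) \<Rightarrow> int \<Rightarrow> 'a" where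
  "chain i j m = (\<lambda>n. hom_at i j n (m n))"

lemma carrier_X: "carrier (obj X n) = MC (v n)" unfolding obj_X by (rule M_carrier[OF bricks_X])

text \<open>Both composites with the differential are matrix maps of bidegree (i, j + 1), and such
  maps agree iff their matrices agree at the admissible positions.\<close>

lemma chain_chain_map:
  assumes "supp d i j m"
  shows "chain i j m \<in> chain_maps A X (Y i j) \<longleftrightarrow> cocyc d i j m"
proof -
  have "chain i j m n \<in> gr_hom A (obj X n) (obj (Y i j) n)" for n
    unfolding gr_hom_hom_at chain_def using assms unfolding supp_def by blast
  then have "chain i j m \<in> chain_maps A X (Y i j) \<longleftrightarrow>
    (\<forall>n. \<forall>x\<in>MC (v n). chain i j m (n + 1) (diff X n x) = diff (Y i j) n (chain i j m n x))"
    unfolding chain_maps_def by (simp add: carrier_X)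
  also have "\<dots> \<longleftrightarrow> (\<forall>n. \<forall>x\<in>MC (v n).
      hom_at i (j + 1) n (\<lambda>k l. if k = 0 \<and> 0 \<le> n \<and> n < int d - 2 then m (n + 1) 0 l else 0) x =
      hom_at i (j + 1) n (\<lambda>k l. if l = 0 \<and> 0 \<le> n + j \<and> n + j < int d - 2 then eps j * m n k 0 else 0) x)"
  proof -
    have "chain i j m (n + 1) (diff X n x) = diff (Y i j) n (chain i j m n x) \<longleftrightarrow>
      hom_at i (j + 1) n (\<lambda>k l. if k = 0 \<and> 0 \<le> n \<and> n < int d - 2 then m (n + 1) 0 l else 0) x =
      hom_at i (j + 1) n (\<lambda>k l. if l = 0 \<and> 0 \<le> n + j \<and> n + j < int d - 2 then eps j * m n k 0 else 0) x"
      if "x \<in> MC (v n)" for n x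
      unfolding chain_def diff_Y hom_at_diff[OF assms that] diff_hom_at[OF assms that] ..
    then show ?thesis by blast
  qed
  also have "\<dots> \<longleftrightarrow> cocyc d i j m" unfolding hom_at_eq_iff cocyc_def by blast
  finally show ?thesis .
qed

lemma chain_maps_chain:
  "f \<in> chain_maps A X (Y i j) \<longleftrightarrow> (\<exists>m. supp d i j m \<and> cocyc d i j m \<and> f = chain i j m)"
proof
  assume f: "f \<in> chain_maps A X (Y i j)"
  then have "\<forall>n. f n \<in> gr_hom A (obj X n) (obj (Y i j) n)" unfolding chain_maps_def by blast
  then have "\<forall>n. \<exists>m. (\<forall>k l. m k l \<noteq> 0 \<longrightarrow> adm d i j n k l) \<and> f n = hom_at i j n m" unfolding gr_hom_hom_at .
  then obtain m where m: "\<forall>n. (\<forall>k l. m n k l \<noteq> 0 \<longrightarrow> adm d i j n k l) \<and> f n = hom_at i j n (m n)" by metis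
  then have "supp d i j m" "f = chain i j m" unfolding supp_def chain_def by auto
  then show "\<exists>m. supp d i j m \<and> cocyc d i j m \<and> f = chain i j m" using f chain_chain_map by blast
qed (use chain_chain_map in blast)

text \<open>A homotopy is a family of graded maps of bidegree (i, j - 1), hence again a matrix, and
  the homotopy equation can be compared with \<open>cobnd\<close> entry by entry.\<close>

lemma htpy_iff:
  assumes s: "supp d i j m" "supp d i j m'" and c: "cocyc d i j m" "cocyc d i j m'"
  shows "(chain i j m, chain i j m') \<in> htpy_rel A X (Y i j) \<longleftrightarrow> nullh d i j (\<lambda>n k l. m n k l - m' n k l)"
proof -
  let ?D = "\<lambda>n k l. m n k l - m' n k l"
  let ?P = "\<lambda>g. \<forall>n. g n \<in> gr_hom A (obj X n) (obj (Y i j) (n - 1)) \<and>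
       (\<forall>x \<in> carrier (obj X n).
          chain i j m n x \<ominus>\<^bsub>obj (Y i j) n\<^esub> chain i j m' n x =
          diff (Y i j) (n - 1) (g n x) \<oplus>\<^bsub>obj (Y i j) n\<^esub> g (n + 1) (diff X n x))"
  have objY: "obj (Y i j) (n - 1) = obj (Y i (j - 1)) n" for n
    unfolding obj_Y by (simp add: algebra_simps)
  have main: "?P (chain i (j - 1) h) \<longleftrightarrow> (\<forall>n k l. adm d i j n k l \<longrightarrow> ?D n k l = cobnd d j h n k l)"
    if h: "supp d i (j - 1) h" for h
  proof -
    have gh: "chain i (j - 1) h n \<in> gr_hom A (obj X n) (obj (Y i j) (n - 1))" for n
      unfolding objY gr_hom_hom_at chain_def using h unfolding supp_def by blast
    have L: "chain i j m n x \<ominus>\<^bsub>obj (Y i j) n\<^esub> chain i j m' n x = hom_at i j n (\<lambda>k l. ?D n k l) x" if "x \<in> MC (v n)" for n x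
      unfolding chain_def hom_at_def obj_Y by (rule hom_minus[OF bricks_Y that])
    have R1: "diff (Y i j) (n - 1) (chain i (j - 1) h n x) =
      hom_at i j n (\<lambda>k l. if l = 0 \<and> 0 \<le> n + j - 1 \<and> n + j - 1 < int d - 2 then eps j * h n k 0 else 0) x"
      if "x \<in> MC (v n)" for n x
    proof -
      have e: "n - 1 + j = n + (j - 1)" by simp
      show ?thesis unfolding diff_Y e chain_def diff_hom_at[OF h that] by (simp add: algebra_simps)
    qed
    have R2: "chain i (j - 1) h (n + 1) (diff X n x) =
      hom_at i j n (\<lambda>k l. if k = 0 \<and> 0 \<le> n \<and> n < int d - 2 then h (n + 1) 0 l else 0) x"
      if "x \<in> MC (v n)" for n x
      unfolding chain_def hom_at_diff[OF h that] by simp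
    have R: "diff (Y i j) (n - 1) (chain i (j - 1) h n x) \<oplus>\<^bsub>obj (Y i j) n\<^esub> chain i (j - 1) h (n + 1) (diff X n x) =
      hom_at i j n (cobnd d j h n) x" if "x \<in> MC (v n)" for n x
      unfolding R1[OF that] R2[OF that] unfolding hom_at_def obj_Y hom_add[OF bricks_Y that] cobnd_def by simp
    have "?P (chain i (j - 1) h) \<longleftrightarrow> (\<forall>n. \<forall>x\<in>MC (v n). hom_at i j n (\<lambda>k l. ?D n k l) x = hom_at i j n (cobnd d j h n) x)"
      unfolding carrier_X using gh L R by simp
    also have "\<dots> \<longleftrightarrow> (\<forall>n k l. adm d i j n k l \<longrightarrow> ?D n k l = cobnd d j h n k l)"
      unfolding hom_at_eq_iff by blast
    finally show ?thesis .
  qed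
  have "(chain i j m, chain i j m') \<in> htpy_rel A X (Y i j) \<longleftrightarrow> (\<exists>g. ?P g)"
    unfolding htpy_rel_def using chain_chain_map s c by simp
  also have "\<dots> \<longleftrightarrow> (\<exists>h. supp d i (j - 1) h \<and> ?P (chain i (j - 1) h))"
  proof
    assume "\<exists>g. ?P g"
    then obtain g where g: "?P g" by blast
    then have "\<forall>n. g n \<in> gr_hom A (obj X n) (obj (Y i (j - 1)) n)" unfolding objY by blast
    then have "\<forall>n. \<exists>h. (\<forall>k l. h k l \<noteq> 0 \<longrightarrow> adm d i (j - 1) n k l) \<and> g n = hom_at i (j - 1) n h" unfolding gr_hom_hom_at .
    then obtain h where h: "\<forall>n. (\<forall>k l. h n k l \<noteq> 0 \<longrightarrow> adm d i (j - 1) n k l) \<and> g n = hom_at i (j - 1) n (h n)" by metis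
    then have "supp d i (j - 1) h" "g = chain i (j - 1) h" unfolding supp_def chain_def by auto
    then show "\<exists>h. supp d i (j - 1) h \<and> ?P (chain i (j - 1) h)" using g by blast
  qed blast
  also have "\<dots> \<longleftrightarrow> nullh d i j ?D" unfolding nullh_def using main by blast
  finally show ?thesis .
qed

text \<open>\<open>Kb_Hom\<close> is empty unless source and target are objects, so this has to be
  known for every shift. The differential squares to zero because a path of length 2 from the vertex
  of term n to that of term n + 2 would not return.\<close>

lemma Kb_obj_Y: "Kb_obj A (Y i j)"
  unfolding Kb_obj_def
proof (intro conjI allI ballI)
  fix n
  show "fgproj A (obj (Y i j) n)" unfolding obj_Y by (rule M_fgproj[OF bricks_Y])
  have "diff (Y i j) n \<in> gr_hom A (obj (Y i j) n) (obj (Y i j) (n + 1))"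
  proof -
    have e: "n + j + 1 = n + 1 + j" by simp
    show ?thesis unfolding obj_Y diff_Y e by (rule hom_gr_hom[OF bricks_Y bricks_Y])
  qed
  then show "diff (Y i j) n \<in> gr_hom A (obj (Y i j) n) (obj (Y i j) (n + 1))" .
  fix x assume x: "x \<in> carrier (obj (Y i j) n)"
  then have x: "x \<in> MC (v (n + j))" unfolding obj_Y M_carrier[OF bricks_Y] .
  have e: "n + 1 + j = n + j + 1" "n + j + 1 + 1 = n + j + 2" "n + 2 + j = n + j + 2" by simp_all
  have "diff (Y i j) (n + 1) (diff (Y i j) n x) =
    hom (v (n + j)) (sh i (n + j)) (v (n + j + 2)) (sh i (n + j + 2)) (\<lambda>k l. 0) x"
    unfolding diff_Y e hom_comp[OF x]
  proof (rule fun_cong[OF hom_cong], rule sum.neutral, rule ballI)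
    fix k l q assume kl: "k \<in> I" "l \<in> I" and F: "F (v (n + j) k) (v (n + j + 2) l) (gshift (n + j + 2) l + i - (gshift (n + j) k + i))"
    have "diff_mat d (n + j) k q * diff_mat d (n + j + 1) q l = 0" by (rule diff_mat_diff_mat[OF d3 kl]) (use F in simp)
    then show "(if F (v (n + j) k) (v (n + j + 1) q) (gshift (n + j + 1) q + i - (gshift (n + j) k + i)) \<and>
        F (v (n + j + 1) q) (v (n + j + 2) l) (gshift (n + j + 2) l + i - (gshift (n + j + 1) q + i))
        then eps j * diff_mat d (n + j) k q * (eps j * diff_mat d (n + j + 1) q l) else 0) = 0" by auto
  qed
  also have "\<dots> = \<zero>\<^bsub>obj (Y i j) (n + 2)\<^esub>"
  proof -
    have e3: "n + j + 2 = n + 2 + j" by simp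
    show ?thesis unfolding obj_Y e3 by (rule hom_zero[OF bricks_Y x])
  qed
  finally show "diff (Y i j) (n + 1) (diff (Y i j) n x) = \<zero>\<^bsub>obj (Y i j) (n + 2)\<^esub>" .
next
  have "{n. carrier (obj (Y i j) n) \<noteq> {\<zero>\<^bsub>obj (Y i j) n\<^esub>}} \<subseteq> {- j .. int d - j}"
  proof
    fix n assume n: "n \<in> {n. carrier (obj (Y i j) n) \<noteq> {\<zero>\<^bsub>obj (Y i j) n\<^esub>}}"
    show "n \<in> {- j .. int d - j}"
    proof (rule ccontr)
      assume out: "n \<notin> {- j .. int d - j}"
      then have v0: "v (n + j) k = 0" for k by (auto simp: vert_def)
      have "MC (v (n + j)) = {\<lambda>k\<in>I. \<zero>}"
      proof (intro equalityI subsetI)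
        fix x assume x: "x \<in> MC (v (n + j))"
        have "x k = \<zero>" if "k \<in> I" for k using MC_C[OF x that] unfolding v0 C_0 by simp
        then have "x = (\<lambda>k\<in>I. \<zero>)" by (intro MC_eqI[OF x MC_zero]) simp
        then show "x \<in> {\<lambda>k\<in>I. \<zero>}" by simp
      qed (use MC_zero in auto)
      then show False using n unfolding obj_Y M_carrier[OF bricks_Y] M_zero[OF bricks_Y] by simp
    qed
  qed
  then show "finite {n. carrier (obj (Y i j) n) \<noteq> {\<zero>\<^bsub>obj (Y i j) n\<^esub>}}" by (rule finite_subset) simp
qed

lemma mshift_0: "mshift 0 M = M" by (simp add: mshift_def)

lemma bishift_0: "Y 0 0 = X"
  by (simp add: bishift_def hshift_def grshift_def mshift_0)

lemma Kb_obj_X: "Kb_obj A X" using Kb_obj_Y[of 0 0] by (simp add: bishift_0)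

end

section \<open>Composition of chain maps\<close>

context
  fixes d :: nat
  assumes d3: "d \<ge> 3"
begin

lemma symb_add: "symb d i j (\<lambda>n k l. m n k l + m' n k l) l k t = symb d i j m l k t + symb d i j m' l k t"
  by (simp add: symb_def sum.distrib algebra_simps)

lemma symb_diff: "symb d i j (\<lambda>n k l. m n k l - m' n k l) l k t = symb d i j m l k t - symb d i j m' l k t"
  by (simp add: symb_def sum_subtractf algebra_simps)

lemma symb_smult: "symb d i j (\<lambda>n k l. a * m n k l) l k t = a * symb d i j m l k t"
  by (simp add: symb_def sum_distrib_left algebra_simps)

lemma symb_zero: "symb d i j (\<lambda>n k l. 0) l k t = 0"
  by (simp add: symb_def)

lemma supp_lin: "supp d i j m \<Longrightarrow> supp d i j m' \<Longrightarrow> supp d i j (\<lambda>n k l. m n k l + m' n k l)"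
  "supp d i j m \<Longrightarrow> supp d i j m' \<Longrightarrow> supp d i j (\<lambda>n k l. m n k l - m' n k l)"
  "supp d i j m \<Longrightarrow> supp d i j (\<lambda>n k l. a * m n k l)" "supp d i j (\<lambda>n k l. 0)"
proof -
  show "supp d i j m \<Longrightarrow> supp d i j m' \<Longrightarrow> supp d i j (\<lambda>n k l. m n k l + m' n k l)"
    unfolding supp_def by (metis add_0)
  show "supp d i j m \<Longrightarrow> supp d i j m' \<Longrightarrow> supp d i j (\<lambda>n k l. m n k l - m' n k l)"
    unfolding supp_def by (metis diff_self)
qed (auto simp: supp_def)

lemma cocyc_lin: 
  assumes "cocyc d i j m" "cocyc d i j m'"
  shows "cocyc d i j (\<lambda>n k l. m n k l + m' n k l)" "cocyc d i j (\<lambda>n k l. m n k l - m' n k l)"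
    "cocyc d i j (\<lambda>n k l. a * m n k l)"
  unfolding cocyc_def
proof (safe)
  fix n k l assume adm: "adm d i (j + 1) n k l"
  note e = assms[unfolded cocyc_def, rule_format, OF adm]
  show "(if k = 0 \<and> 0 \<le> n \<and> n < int d - 2 then m (n + 1) 0 l + m' (n + 1) 0 l else 0) =
       (if l = 0 \<and> 0 \<le> n + j \<and> n + j < int d - 2 then eps j * (m n k 0 + m' n k 0) else 0)"
    using e by (auto simp: distrib_left split: if_splits)
  show "(if k = 0 \<and> 0 \<le> n \<and> n < int d - 2 then m (n + 1) 0 l - m' (n + 1) 0 l else 0) =
       (if l = 0 \<and> 0 \<le> n + j \<and> n + j < int d - 2 then eps j * (m n k 0 - m' n k 0) else 0)"
    using e by (auto simp: right_diff_distrib split: if_splits)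
  show "(if k = 0 \<and> 0 \<le> n \<and> n < int d - 2 then a * m (n + 1) 0 l else 0) =
       (if l = 0 \<and> 0 \<le> n + j \<and> n + j < int d - 2 then eps j * (a * m n k 0) else 0)"
    using e(1) by (auto split: if_splits)
qed

lemma cocyc_zero: "cocyc d i j (\<lambda>n k l. 0)" by (simp add: cocyc_def)

text \<open>Applied to the difference of two cocycles, the two directions say that
  \<open>symb\<close> separates homotopy classes: it is linear, kills coboundaries and detects
  them.\<close>

lemma nullh_iff_symb:
  assumes "supp d i j m" "supp d i j m'" "cocyc d i j m" "cocyc d i j m'"
  shows "nullh d i j (\<lambda>n k l. m n k l - m' n k l) \<longleftrightarrow> symb d i j m = symb d i j m'"
proof
  assume "nullh d i j (\<lambda>n k l. m n k l - m' n k l)"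
  from symb_nullh[OF d3 this] show "symb d i j m = symb d i j m'" unfolding symb_diff by (intro ext) simp
next
  assume "symb d i j m = symb d i j m'"
  then show "nullh d i j (\<lambda>n k l. m n k l - m' n k l)"
    using assms by (intro nullh_of_symb[OF d3] cocyc_lin supp_lin) (simp_all add: symb_diff)
qed

text \<open>A product of supported matrices can have entries at positions where the composite basis
  element is 0, as for two arrows in the same direction. \<open>trim\<close> deletes them; neither
  the map nor \<open>symb\<close> changes.\<close>

definition trim :: "int \<Rightarrow> int \<Rightarrow> (int \<Rightarrow> int \<Rightarrow> int \<Rightarrow> complex) \<Rightarrow> int \<Rightarrow> int \<Rightarrow> int \<Rightarrow> complex" where
  "trim i j m n k l = (if adm d i j n k l then m n k l else 0)"

lemma trim_supp: "supp d i j (trim i j m)" by (simp add: supp_def trim_def)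

text \<open>Every entry read by \<open>symb\<close> sits at an admissible position. This makes it
  insensitive to \<open>trim\<close> and well defined on maps instead of matrices.\<close>

lemma symb_cong:
  assumes "\<And>n k l. adm d i j n k l \<Longrightarrow> m n k l = m' n k l"
  shows "symb d i j m l k t = symb d i j m' l k t"
proof (cases "aff_idx d l k t \<and> bideg d l k t = (i, j)")
  case False then show ?thesis by (auto simp: symb_def)
next
  case True
  then have aff_idx: "aff_idx d l k t" and b: "bideg d l k t = (i, j)" by auto
  consider "l = 1" "k = 0" | "l = 0" "k = 0" "t = 2" | "\<not> (l = 1 \<and> k = 0)" "\<not> (l = 0 \<and> k = 0 \<and> t = 2)" by blast
  then show ?thesis
  proof cases
    case 1
    then have "adm d i j (int d - 2) 0 1"
      using aff_idx b d3 by (auto simp: aff_idx_iff[OF d3] bideg_def adm_0p[OF d3] fin_idx_iff[OF d3])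
    then show ?thesis using 1 assms by (simp add: symb_def)
  next
    case 2
    then have "adm d i j (int n) 0 0" if "n < d - 1" for n
      using aff_idx b d3 that by (auto simp: bideg_def adm_00[OF d3])
    then have "(\<Sum>n<d - 1. (-1) ^ n * m (int n) 0 0) = (\<Sum>n<d - 1. (-1) ^ n * m' (int n) 0 0)"
      using assms by (intro sum.cong refl) auto
    then show ?thesis using 2 by (simp add: symb_def)
  next
    case 3
    have "adm d i j 0 k l"
    proof (cases "k = 0"; cases "l = 0")
      assume "k = 0" "l = 0"
      then show ?thesis using aff_idx b d3 3 by (auto simp: aff_idx_iff[OF d3] bideg_def adm_00[OF d3])
    next
      assume "k = 0" "l \<noteq> 0"
      then show ?thesis using aff_idx b d3 3 by (auto simp: aff_idx_iff[OF d3] bideg_def adm_0p[OF d3] fin_idx_iff[OF d3])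
    next
      assume "k \<noteq> 0" "l = 0"
      then show ?thesis using aff_idx b d3 3 by (auto simp: aff_idx_iff[OF d3] bideg_def adm_p0[OF d3] fin_idx_iff[OF d3] split: if_splits)
    next
      assume "k \<noteq> 0" "l \<noteq> 0"
      then show ?thesis using aff_idx b d3 3 by (auto simp: aff_idx_iff[OF d3] bideg_def adm_pp[OF d3] fin_idx_iff[OF d3])
    qed
    then show ?thesis using 3 assms by (auto simp: symb_def)
  qed
qed

lemma symb_trim: "symb d i j (trim i j m) = symb d i j m"
  by (intro ext symb_cong) (simp add: trim_def)

lemma mat_comp_diff:
  "mat_comp d b m' m n k l - mat_comp d b m1' m1 n k l =
    mat_comp d b m' (\<lambda>n k l. m n k l - m1 n k l) n k l + mat_comp d b (\<lambda>n k l. m' n k l - m1' n k l) m1 n k l"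
  unfolding mat_comp_def[OF d3] sum_subtractf[symmetric] sum.distrib[symmetric]
  by (rule sum.cong) (simp_all add: algebra_simps)

end

section \<open>Linearity of matrix maps\<close>

context zigzag_coords
begin

text \<open>Sums are written without reference to a particular \<open>msum I N\<close>, so that
  equations can be rewritten across terms with different shifts.\<close>

definition vadd :: "(int \<Rightarrow> 'a) \<Rightarrow> (int \<Rightarrow> 'a) \<Rightarrow> int \<Rightarrow> 'a" where "vadd x y = (\<lambda>k\<in>I. x k \<oplus> y k)"

definition vscale :: "complex \<Rightarrow> (int \<Rightarrow> 'a) \<Rightarrow> int \<Rightarrow> 'a" where "vscale e x = (\<lambda>k\<in>I. e \<odot> x k)"

lemma vadd_MC: "x \<in> MC v \<Longrightarrow> y \<in> MC v \<Longrightarrow> vadd x y \<in> MC v" unfolding vadd_def by (rule MC_add)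

lemma vscale_MC: "x \<in> MC v \<Longrightarrow> vscale e x \<in> MC v" unfolding vscale_def by (intro MC_I C_smult MC_C)

lemma kappa_vadd: "x \<in> MC v \<Longrightarrow> y \<in> MC v \<Longrightarrow> k \<in> I \<Longrightarrow> \<kappa> (vadd x y k) p q t = \<kappa> (x k) p q t + \<kappa> (y k) p q t"
  by (simp add: vadd_def kappa_add MC_carrier)

lemma kappa_vscale: "x \<in> MC v \<Longrightarrow> k \<in> I \<Longrightarrow> \<kappa> (vscale e x k) p q t = e * \<kappa> (x k) p q t"
  by (simp add: vscale_def kappa_smult MC_carrier)

lemma vscale_vscale: "x \<in> MC v \<Longrightarrow> vscale e (vscale e' x) = vscale (e * e') x"
  by (rule MC_eqI[of _ v]) (simp_all add: vscale_MC kappa_vscale[OF vscale_MC] kappa_vscale)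

lemma hom_vadd:
  assumes x: "x \<in> MC v" and y: "y \<in> MC v"
  shows "hom v s v' s' m (vadd x y) = vadd (hom v s v' s' m x) (hom v s v' s' m y)"
proof (rule MC_eqI[OF hom_MC[OF vadd_MC[OF x y]] vadd_MC[OF hom_MC[OF x] hom_MC[OF y]]])
  fix l p q t assume l: "l \<in> I"
  have "\<kappa> (vadd x y k \<otimes> w) p q t = \<kappa> (x k \<otimes> w) p q t + \<kappa> (y k \<otimes> w) p q t" if "k \<in> I" "w \<in> carrier A" for k w
    using that x y by (simp add: vadd_def l_distr MC_carrier kappa_add)
  then show "\<kappa> (hom v s v' s' m (vadd x y) l) p q t = \<kappa> (vadd (hom v s v' s' m x) (hom v s v' s' m y) l) p q t"
    unfolding kappa_vadd[OF hom_MC[OF x] hom_MC[OF y] l] kappa_hom[OF vadd_MC[OF x y] l] kappa_hom[OF x l] kappa_hom[OF y l]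
    by (simp add: sum.distrib[symmetric] distrib_left)
qed

lemma hom_vscale:
  assumes x: "x \<in> MC v"
  shows "hom v s v' s' m (vscale e x) = vscale e (hom v s v' s' m x)"
proof (rule MC_eqI[OF hom_MC[OF vscale_MC[OF x]] vscale_MC[OF hom_MC[OF x]]])
  fix l p q t assume l: "l \<in> I"
  have "\<kappa> (vscale e x k \<otimes> w) p q t = e * \<kappa> (x k \<otimes> w) p q t" if "k \<in> I" "w \<in> carrier A" for k w
    using that x by (simp add: vscale_def smult_mult MC_carrier kappa_smult)
  then show "\<kappa> (hom v s v' s' m (vscale e x) l) p q t = \<kappa> (vscale e (hom v s v' s' m x) l) p q t"
    unfolding kappa_vscale[OF hom_MC[OF x] l] kappa_hom[OF vscale_MC[OF x] l] kappa_hom[OF x l]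
    by (simp add: sum_distrib_left algebra_simps)
qed

lemma hom_mat_vadd:
  assumes x: "x \<in> MC v"
  shows "hom v s v' s' (\<lambda>k l. m k l + m' k l) x = vadd (hom v s v' s' m x) (hom v s v' s' m' x)"
proof (rule MC_eqI[OF hom_MC[OF x] vadd_MC[OF hom_MC[OF x] hom_MC[OF x]]])
  fix l p q t assume l: "l \<in> I"
  show "\<kappa> (hom v s v' s' (\<lambda>k l. m k l + m' k l) x l) p q t = \<kappa> (vadd (hom v s v' s' m x) (hom v s v' s' m' x) l) p q t"
    unfolding kappa_vadd[OF hom_MC[OF x] hom_MC[OF x] l] kappa_hom[OF x l]
    by (simp add: sum.distrib[symmetric] distrib_right)
qed

lemma hom_mat_vscale:
  assumes x: "x \<in> MC v"
  shows "hom v s v' s' (\<lambda>k l. e * m k l) x = vscale e (hom v s v' s' m x)"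
proof (rule MC_eqI[OF hom_MC[OF x] vscale_MC[OF hom_MC[OF x]]])
  fix l p q t assume l: "l \<in> I"
  show "\<kappa> (hom v s v' s' (\<lambda>k l. e * m k l) x l) p q t = \<kappa> (vscale e (hom v s v' s' m x) l) p q t"
    unfolding kappa_vscale[OF hom_MC[OF x] l] kappa_hom[OF x l]
    by (simp add: sum_distrib_left algebra_simps)
qed

end

section \<open>Composites of cocycles and of homotopies\<close>

context zigzag_complex
begin

abbreviation "Dx n \<equiv> diff X n"

lemma Dx_MC: "x \<in> MC (v n) \<Longrightarrow> Dx n x \<in> MC (v (n + 1))" unfolding diff_X by (rule hom_MC)

lemma Dx_vscale: "x \<in> MC (v n) \<Longrightarrow> Dx n (vscale e x) = vscale e (Dx n x)" unfolding diff_X by (rule hom_vscale)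

lemma hom_at_MC: "x \<in> MC (v n) \<Longrightarrow> hom_at i j n m x \<in> MC (v (n + j))" unfolding hom_at_def by (rule hom_MC)

lemma Dx_eps: "x \<in> MC (v n) \<Longrightarrow> hom (v n) (sh i n) (v (n + 1)) (sh i (n + 1)) (\<lambda>k l. e * diff_mat d n k l) x = vscale e (Dx n x)"
  unfolding hom_shift diff_X by (rule hom_mat_vscale)

text \<open>The cocycle condition as an equation f D = \<open>eps j\<close> D f of maps, with the
  unshifted differential D. Composites and homotopies are handled in this form, which avoids
  comparing entries of products.\<close>

lemma cocyc_fun:
  assumes s: "supp d i j m"
  shows "cocyc d i j m \<longleftrightarrow> (\<forall>n. \<forall>x\<in>MC (v n). hom_at i j (n + 1) (m (n + 1)) (Dx n x) = vscale (eps j) (Dx (n + j) (hom_at i j n (m n) x)))"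
proof -
  have "(hom_at i j (n + 1) (m (n + 1)) (Dx n x) = vscale (eps j) (Dx (n + j) (hom_at i j n (m n) x))) \<longleftrightarrow>
      hom_at i (j + 1) n (\<lambda>k l. if k = 0 \<and> 0 \<le> n \<and> n < int d - 2 then m (n + 1) 0 l else 0) x =
      hom_at i (j + 1) n (\<lambda>k l. if l = 0 \<and> 0 \<le> n + j \<and> n + j < int d - 2 then eps j * m n k 0 else 0) x"
    if "x \<in> MC (v n)" for n x
    unfolding hom_at_diff[OF s that] diff_hom_at[OF s that, symmetric] Dx_eps[OF hom_at_MC[OF that]] ..
  then have "(\<forall>n. \<forall>x\<in>MC (v n). hom_at i j (n + 1) (m (n + 1)) (Dx n x) = vscale (eps j) (Dx (n + j) (hom_at i j n (m n) x))) \<longleftrightarrow>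
    (\<forall>n. \<forall>x\<in>MC (v n). hom_at i (j + 1) n (\<lambda>k l. if k = 0 \<and> 0 \<le> n \<and> n < int d - 2 then m (n + 1) 0 l else 0) x =
      hom_at i (j + 1) n (\<lambda>k l. if l = 0 \<and> 0 \<le> n + j \<and> n + j < int d - 2 then eps j * m n k 0 else 0) x)"
    by blast
  also have "\<dots> \<longleftrightarrow> cocyc d i j m" unfolding hom_at_eq_iff cocyc_def by blast
  finally show ?thesis by blast
qed

lemma cobnd_fun:
  assumes h: "supp d i (j - 1) h" and x: "x \<in> MC (v n)"
  shows "hom_at i j n (cobnd d j h n) x =
    vadd (vscale (eps j) (Dx (n + (j - 1)) (hom_at i (j - 1) n (h n) x))) (hom_at i (j - 1) (n + 1) (h (n + 1)) (Dx n x))"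
proof -
  have R1: "vscale (eps j) (Dx (n + (j - 1)) (hom_at i (j - 1) n (h n) x)) =
      hom_at i j n (\<lambda>k l. if l = 0 \<and> 0 \<le> n + j - 1 \<and> n + j - 1 < int d - 2 then eps j * h n k 0 else 0) x"
    unfolding Dx_eps[where i = i, OF hom_at_MC[OF x], symmetric] diff_hom_at[OF h x] by (simp add: algebra_simps)
  have R2: "hom_at i (j - 1) (n + 1) (h (n + 1)) (Dx n x) =
      hom_at i j n (\<lambda>k l. if k = 0 \<and> 0 \<le> n \<and> n < int d - 2 then h (n + 1) 0 l else 0) x"
    unfolding hom_at_diff[OF h x] by simp
  show ?thesis unfolding R1 R2 unfolding hom_at_def hom_mat_vadd[OF x, symmetric] cobnd_def by simp
qed

text \<open>The second map has to be shifted by a in the grading, which leaves its matrix alone by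
  \<open>hom_shift\<close>. The test in \<open>hom_comp\<close> disappears because both matrices are
  supported.\<close>

lemma mat_comp_fun:
  assumes s: "supp d a b m" and s': "supp d (i - a) (j - b) m'" and x: "x \<in> MC (v n)"
  shows "hom_at (i - a) (j - b) (n + b) (m' (n + b)) (hom_at a b n (m n) x) = hom_at i j n (mat_comp d b m' m n) x"
proof -
  have e: "n + b + (j - b) = n + j" by simp
  have "hom (v (n + b)) (gshift (n + b)) (v (n + j)) (sh (i - a) (n + j)) (m' (n + b)) =
    hom (v (n + b)) (sh a (n + b)) (v (n + j)) (\<lambda>k. sh (i - a) (n + j) k + a) (m' (n + b))"
    by (rule hom_shift[symmetric])
  also have "(\<lambda>k. sh (i - a) (n + j) k + a) = sh i (n + j)" by simp
  finally have sw: "hom (v (n + b)) (gshift (n + b)) (v (n + j)) (sh (i - a) (n + j)) (m' (n + b)) =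
    hom (v (n + b)) (sh a (n + b)) (v (n + j)) (sh i (n + j)) (m' (n + b))" .
  show ?thesis unfolding hom_at_def e sw hom_comp[OF x]
  proof (rule fun_cong[OF hom_cong])
    fix k l assume kl: "k \<in> I" "l \<in> I"
    show "(\<Sum>q\<in>I. if F (v n k) (v (n + b) q) (gshift (n + b) q + a - gshift n k) \<and>
        F (v (n + b) q) (v (n + j) l) (gshift (n + j) l + i - (gshift (n + b) q + a))
        then m n k q * m' (n + b) q l else 0) = mat_comp d b m' m n k l"
      unfolding mat_comp_def[OF d3]
    proof (rule sum.cong[OF refl])
      fix q assume q: "q \<in> I"
      show "(if F (v n k) (v (n + b) q) (gshift (n + b) q + a - gshift n k) \<and>
        F (v (n + b) q) (v (n + j) l) (gshift (n + j) l + i - (gshift (n + b) q + a))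
        then m n k q * m' (n + b) q l else 0) = m n k q * m' (n + b) q l"
      proof (cases "m n k q = 0 \<or> m' (n + b) q l = 0")
        case False
        then have "adm d a b n k q" "adm d (i - a) (j - b) (n + b) q l" using s s' unfolding supp_def by blast+
        then show ?thesis by (simp add: adm_def algebra_simps)
      qed auto
    qed
  qed
qed

lemma hom_at_trim: "hom_at i j n (trim d i j m n) = hom_at i j n (m n)"
  unfolding hom_at_def by (rule hom_cong) (simp add: trim_def[OF d3] adm_def)

text \<open>Moving D past the two maps costs \<open>eps b\<close> and \<open>eps (j - b)\<close>,
  with product \<open>eps j\<close>.\<close>

lemma cocyc_mat_comp:
  assumes s: "supp d a b m" and s': "supp d (i - a) (j - b) m'" and c: "cocyc d a b m" and c': "cocyc d (i - a) (j - b) m'"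
  shows "cocyc d i j (trim d i j (mat_comp d b m' m))"
  unfolding cocyc_fun[OF trim_supp[OF d3]] hom_at_trim
proof (intro allI ballI)
  fix n x assume x: "x \<in> MC (v n)"
  have e: "n + 1 + b = n + b + 1" "n + b + (j - b) = n + j" by simp_all
  have fx: "hom_at a b n (m n) x \<in> MC (v (n + b))" by (rule hom_at_MC[OF x])
  have "hom_at i j (n + 1) (mat_comp d b m' m (n + 1)) (Dx n x) =
    hom_at (i - a) (j - b) (n + b + 1) (m' (n + b + 1)) (hom_at a b (n + 1) (m (n + 1)) (Dx n x))"
    unfolding mat_comp_fun[OF s s' Dx_MC[OF x], symmetric] e ..
  also have "hom_at a b (n + 1) (m (n + 1)) (Dx n x) = vscale (eps b) (Dx (n + b) (hom_at a b n (m n) x))"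
    using c[unfolded cocyc_fun[OF s]] x by blast
  also have "hom_at (i - a) (j - b) (n + b + 1) (m' (n + b + 1)) (vscale (eps b) (Dx (n + b) (hom_at a b n (m n) x))) =
    vscale (eps b) (hom_at (i - a) (j - b) (n + b + 1) (m' (n + b + 1)) (Dx (n + b) (hom_at a b n (m n) x)))"
    unfolding hom_at_def by (rule hom_vscale) (use Dx_MC[OF fx] in \<open>simp add: hom_at_def\<close>)
  also have "hom_at (i - a) (j - b) (n + b + 1) (m' (n + b + 1)) (Dx (n + b) (hom_at a b n (m n) x)) =
    vscale (eps (j - b)) (Dx (n + b + (j - b)) (hom_at (i - a) (j - b) (n + b) (m' (n + b)) (hom_at a b n (m n) x)))"
    using c'[unfolded cocyc_fun[OF s']] fx by blast
  also have "\<dots> = vscale (eps (j - b)) (Dx (n + j) (hom_at i j n (mat_comp d b m' m n) x))"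
    unfolding mat_comp_fun[OF s s' x] e ..
  also have "vscale (eps b) \<dots> = vscale (eps j) (Dx (n + j) (hom_at i j n (mat_comp d b m' m n) x))"
    unfolding vscale_vscale[OF Dx_MC[OF hom_at_MC[OF x]]] eps_simps(5)[symmetric, OF d3] by simp
  finally show "hom_at i j (n + 1) (mat_comp d b m' m (n + 1)) (Dx n x) = vscale (eps j) (Dx (n + j) (hom_at i j n (mat_comp d b m' m n) x))" .
qed

text \<open>If the first map m is the boundary of h, then h followed by m' bounds the composite.
  Moving m' across the differential costs \<open>eps (j - b)\<close>, which together with the
  \<open>eps b\<close> of \<open>cobnd\<close> gives \<open>eps j\<close>.\<close>

lemma nullh_mat_comp_left:
  assumes s: "supp d a b m" and s': "supp d (i - a) (j - b) m'" and z: "nullh d a b m" and c': "cocyc d (i - a) (j - b) m'"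
  shows "nullh d i j (mat_comp d b m' m)"
proof -
  obtain h where h: "supp d a (b - 1) h" "\<And>n k l. adm d a b n k l \<Longrightarrow> m n k l = cobnd d b h n k l"
    using z unfolding nullh_def by blast
  have s1: "supp d (i - a) (j - 1 - (b - 1)) m'" using s' by simp
  let ?H = "trim d i (j - 1) (mat_comp d (b - 1) m' h)"
  note Hs = trim_supp[OF d3, of i "j - 1" "mat_comp d (b - 1) m' h"]
  have "hom_at i j n (mat_comp d b m' m n) x = hom_at i j n (cobnd d j ?H n) x" if x: "x \<in> MC (v n)" for n x
  proof -
    have e: "n + (b - 1) + 1 = n + b" "n + (b - 1) + (j - b) = n + (j - 1)" "j - 1 - (b - 1) = j - b" "n + 1 + (b - 1) = n + b" by simp_all
    have hx: "hom_at a (b - 1) n (h n) x \<in> MC (v (n + (b - 1)))" by (rule hom_at_MC[OF x])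
    have Dh: "Dx (n + (b - 1)) (hom_at a (b - 1) n (h n) x) \<in> MC (v (n + b))" using Dx_MC[OF hx] unfolding e .
    have hD: "hom_at a (b - 1) (n + 1) (h (n + 1)) (Dx n x) \<in> MC (v (n + b))" using hom_at_MC[OF Dx_MC[OF x], of a "b - 1" "h (n + 1)"] unfolding e .
    let ?g = "hom_at (i - a) (j - b) (n + b) (m' (n + b))"
    have mx: "hom_at a b n (m n) x = hom_at a b n (cobnd d b h n) x" using hom_at_eq_iff[of n a b "m n" "cobnd d b h n"] h(2) x by blast
    have "hom_at i j n (mat_comp d b m' m n) x = ?g (hom_at a b n (cobnd d b h n) x)"
      unfolding mat_comp_fun[OF s s' x, symmetric] mx ..
    also have "\<dots> = vadd (vscale (eps b) (?g (Dx (n + (b - 1)) (hom_at a (b - 1) n (h n) x))))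
        (?g (hom_at a (b - 1) (n + 1) (h (n + 1)) (Dx n x)))"
      unfolding cobnd_fun[OF h(1) x] unfolding hom_at_def[of "i - a"] hom_vadd[OF vscale_MC[OF Dh] hD] hom_vscale[OF Dh] ..
    also have "?g (Dx (n + (b - 1)) (hom_at a (b - 1) n (h n) x)) =
      vscale (eps (j - b)) (Dx (n + (j - 1)) (hom_at (i - a) (j - b) (n + (b - 1)) (m' (n + (b - 1))) (hom_at a (b - 1) n (h n) x)))"
      using c'[unfolded cocyc_fun[OF s'], rule_format, OF hx] unfolding e .
    also have "hom_at (i - a) (j - b) (n + (b - 1)) (m' (n + (b - 1))) (hom_at a (b - 1) n (h n) x) = hom_at i (j - 1) n (?H n) x"
      unfolding hom_at_trim mat_comp_fun[OF h(1) s1 x, symmetric] e ..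
    also have "?g (hom_at a (b - 1) (n + 1) (h (n + 1)) (Dx n x)) = hom_at i (j - 1) (n + 1) (?H (n + 1)) (Dx n x)"
      unfolding hom_at_trim mat_comp_fun[OF h(1) s1 Dx_MC[OF x], symmetric] e ..
    also have "vscale (eps b) (vscale (eps (j - b)) (Dx (n + (j - 1)) (hom_at i (j - 1) n (?H n) x))) =
      vscale (eps j) (Dx (n + (j - 1)) (hom_at i (j - 1) n (?H n) x))"
      unfolding vscale_vscale[OF Dx_MC[OF hom_at_MC[OF x]]] eps_simps(5)[symmetric, OF d3] by simp
    also have "vadd (vscale (eps j) (Dx (n + (j - 1)) (hom_at i (j - 1) n (?H n) x))) (hom_at i (j - 1) (n + 1) (?H (n + 1)) (Dx n x)) =
      hom_at i j n (cobnd d j ?H n) x" by (rule cobnd_fun[OF Hs x, symmetric])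
    finally show ?thesis .
  qed
  then show ?thesis unfolding nullh_def using Hs hom_at_eq_iff by blast
qed

text \<open>If the second map m' is the boundary of h, the homotopy is m followed by h with the sign
  \<open>eps b\<close>, the cost of moving the differential past m.\<close>

lemma nullh_mat_comp_right:
  assumes s: "supp d a b m" and s': "supp d (i - a) (j - b) m'" and z: "nullh d (i - a) (j - b) m'" and c: "cocyc d a b m"
  shows "nullh d i j (mat_comp d b m' m)"
proof -
  obtain h where h: "supp d (i - a) (j - b - 1) h" "\<And>n k l. adm d (i - a) (j - b) n k l \<Longrightarrow> m' n k l = cobnd d (j - b) h n k l"
    using z unfolding nullh_def by blast
  have s1: "supp d (i - a) (j - 1 - b) h" using h(1) by (simp add: algebra_simps)
  let ?K = "trim d i (j - 1) (mat_comp d b h m)"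
  let ?H = "\<lambda>n k l. eps b * ?K n k l"
  have Hs: "supp d i (j - 1) ?H" by (intro supp_lin[OF d3] trim_supp[OF d3])
  have "hom_at i j n (mat_comp d b m' m n) x = hom_at i j n (cobnd d j ?H n) x" if x: "x \<in> MC (v n)" for n x
  proof -
    have e: "j - b - 1 = j - 1 - b" "n + b + (j - 1 - b) = n + (j - 1)" "n + 1 + b = n + b + 1" by simp_all
    have fx: "hom_at a b n (m n) x \<in> MC (v (n + b))" by (rule hom_at_MC[OF x])
    let ?y = "hom_at a b n (m n) x"
    have mx: "hom_at (i - a) (j - b) (n + b) (m' (n + b)) ?y = hom_at (i - a) (j - b) (n + b) (cobnd d (j - b) h (n + b)) ?y"
      using hom_at_eq_iff[of "n + b" "i - a" "j - b" "m' (n + b)" "cobnd d (j - b) h (n + b)"] h(2) fx by blast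
    have K1: "hom_at (i - a) (j - 1 - b) (n + b) (h (n + b)) ?y = hom_at i (j - 1) n (?K n) x"
      unfolding hom_at_trim mat_comp_fun[OF s s1 x] ..
    have fD: "hom_at a b (n + 1) (m (n + 1)) (Dx n x) = vscale (eps b) (Dx (n + b) ?y)"
      using c[unfolded cocyc_fun[OF s]] x by blast
    have ee: "vscale (eps b) (vscale (eps b) z) = z" if z: "z \<in> MC w" for z w
    proof -
      have "vscale 1 z = z" by (rule MC_eqI[OF vscale_MC[OF z] z]) (simp add: kappa_vscale[OF z])
      then show ?thesis unfolding vscale_vscale[OF z] eps_simps(4)[OF d3] .
    qed
    have Dy: "Dx (n + b) ?y \<in> MC (v (n + b + 1))" by (rule Dx_MC[OF fx])
    have K2: "hom_at (i - a) (j - 1 - b) (n + b + 1) (h (n + b + 1)) (Dx (n + b) ?y) =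
      vscale (eps b) (hom_at i (j - 1) (n + 1) (?K (n + 1)) (Dx n x))"
    proof -
      have "hom_at i (j - 1) (n + 1) (?K (n + 1)) (Dx n x) = hom_at (i - a) (j - 1 - b) (n + b + 1) (h (n + b + 1)) (vscale (eps b) (Dx (n + b) ?y))"
        unfolding hom_at_trim mat_comp_fun[OF s s1 Dx_MC[OF x], symmetric] fD e ..
      also have "\<dots> = vscale (eps b) (hom_at (i - a) (j - 1 - b) (n + b + 1) (h (n + b + 1)) (Dx (n + b) ?y))"
        unfolding hom_at_def[of "i - a"] by (rule hom_vscale[OF Dy])
      finally show ?thesis using ee[OF hom_at_MC[OF Dy]] by simp
    qed
    have "hom_at i j n (mat_comp d b m' m n) x = hom_at (i - a) (j - b) (n + b) (cobnd d (j - b) h (n + b)) ?y"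
      unfolding mat_comp_fun[OF s s' x, symmetric] mx ..
    also have "\<dots> = vadd (vscale (eps (j - b)) (Dx (n + (j - 1)) (hom_at i (j - 1) n (?K n) x))) (vscale (eps b) (hom_at i (j - 1) (n + 1) (?K (n + 1)) (Dx n x)))"
      unfolding cobnd_fun[OF h(1) fx] e K1 K2 ..
    also have "vscale (eps (j - b)) (Dx (n + (j - 1)) (hom_at i (j - 1) n (?K n) x)) =
      vscale (eps j) (Dx (n + (j - 1)) (vscale (eps b) (hom_at i (j - 1) n (?K n) x)))"
      unfolding Dx_vscale[OF hom_at_MC[OF x]] vscale_vscale[OF Dx_MC[OF hom_at_MC[OF x]]] eps_simps(7)[OF d3] ..
    also have "vscale (eps b) (hom_at i (j - 1) n (?K n) x) = hom_at i (j - 1) n (?H n) x"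
      unfolding hom_at_def hom_mat_vscale[OF x] ..
    also have "vscale (eps b) (hom_at i (j - 1) (n + 1) (?K (n + 1)) (Dx n x)) = hom_at i (j - 1) (n + 1) (?H (n + 1)) (Dx n x)"
      unfolding hom_at_def hom_mat_vscale[OF Dx_MC[OF x]] ..
    also have "vadd (vscale (eps j) (Dx (n + (j - 1)) (hom_at i (j - 1) n (?H n) x))) (hom_at i (j - 1) (n + 1) (?H (n + 1)) (Dx n x)) =
      hom_at i j n (cobnd d j ?H n) x" by (rule cobnd_fun[OF Hs x, symmetric])
    finally show ?thesis .
  qed
  then show ?thesis unfolding nullh_def using Hs hom_at_eq_iff by blast
qed

text \<open>Composition descends to homotopy classes: by \<open>mat_comp_diff\<close> the difference
  of two composites is a sum of two products with a null-homotopic factor each. This permits the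
  computation with canonical representatives.\<close>

lemma symb_mat_comp_cong:
  assumes m: "supp d a b m" "cocyc d a b m" "supp d a b m1" "cocyc d a b m1"
    and m': "supp d (i - a) (j - b) m'" "cocyc d (i - a) (j - b) m'" "supp d (i - a) (j - b) m1'" "cocyc d (i - a) (j - b) m1'"
    and eq: "symb d a b m = symb d a b m1" "symb d (i - a) (j - b) m' = symb d (i - a) (j - b) m1'"
  shows "symb d i j (mat_comp d b m' m) = symb d i j (mat_comp d b m1' m1)"
proof (intro ext)
  fix l k t
  have "nullh d a b (\<lambda>n k l. m n k l - m1 n k l)" "nullh d (i - a) (j - b) (\<lambda>n k l. m' n k l - m1' n k l)"
    using nullh_iff_symb[OF d3] m m' eq by blast+
  then have "nullh d i j (mat_comp d b m' (\<lambda>n k l. m n k l - m1 n k l))" "nullh d i j (mat_comp d b (\<lambda>n k l. m' n k l - m1' n k l) m1)"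
    using nullh_mat_comp_left[OF supp_lin(2)[OF d3 m(1,3)] m'(1)] nullh_mat_comp_right[OF m(3) supp_lin(2)[OF d3 m'(1,3)]] m m' by blast+
  then have z: "symb d i j (mat_comp d b m' (\<lambda>n k l. m n k l - m1 n k l)) l k t = 0"
    "symb d i j (mat_comp d b (\<lambda>n k l. m' n k l - m1' n k l) m1) l k t = 0"
    using symb_nullh[OF d3] by blast+
  have "symb d i j (mat_comp d b m' m) l k t - symb d i j (mat_comp d b m1' m1) l k t =
    symb d i j (\<lambda>n k l. mat_comp d b m' m n k l - mat_comp d b m1' m1 n k l) l k t"
    by (rule symb_diff[OF d3, symmetric])
  also have "\<dots> = 0" unfolding mat_comp_diff[OF d3] symb_add[OF d3] z by simp
  finally show "symb d i j (mat_comp d b m' m) l k t = symb d i j (mat_comp d b m1' m1) l k t" by simp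
qed

end

section \<open>The endomorphism algebra in coordinates\<close>

context
  fixes d :: nat
  assumes d3: "d \<ge> 3"
begin

definition bideg_part :: "int \<Rightarrow> int \<Rightarrow> (int \<Rightarrow> int \<Rightarrow> int \<Rightarrow> complex) \<Rightarrow> int \<Rightarrow> int \<Rightarrow> int \<Rightarrow> complex" where
  "bideg_part i j c l k t = (if bideg d l k t = (i, j) then c l k t else 0)"

definition bideg_coords :: "int \<Rightarrow> int \<Rightarrow> (int \<Rightarrow> int \<Rightarrow> int \<Rightarrow> complex) set" where
  "bideg_coords i j = {c. \<forall>l k t. c l k t \<noteq> 0 \<longrightarrow> aff_idx d l k t \<and> bideg d l k t = (i, j)}"

lemma bideg_part_bideg_coords: "c \<in> coord_fun d \<Longrightarrow> bideg_part i j c \<in> bideg_coords i j" by (auto simp: bideg_coords_def bideg_part_def coord_fun_def)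

lemma bideg_coords_coord_fun: "c \<in> bideg_coords i j \<Longrightarrow> c \<in> coord_fun d" by (auto simp: bideg_coords_def coord_fun_def)

lemma bideg_coords_zero: "(\<lambda>l k t. 0) \<in> bideg_coords i j" by (simp add: bideg_coords_def)

lemma bideg_coords_add: "c \<in> bideg_coords i j \<Longrightarrow> c' \<in> bideg_coords i j \<Longrightarrow> (\<lambda>l k t. c l k t + c' l k t) \<in> bideg_coords i j"
  unfolding bideg_coords_def mem_Collect_eq by (metis add_0)

lemma symb_bideg_coords: "symb d i j m \<in> bideg_coords i j" by (auto simp: bideg_coords_def symb_def)

lemma bideg_part_id: "c \<in> bideg_coords i j \<Longrightarrow> bideg_part i j c = c"
proof (intro ext)
  fix l k t assume "c \<in> bideg_coords i j"
  then show "bideg_part i j c l k t = c l k t" unfolding bideg_coords_def bideg_part_def by (cases "c l k t = 0") auto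
qed

lemma symb_canon_bideg_part: "c \<in> coord_fun d \<Longrightarrow> symb d i j (canon d c i j) = bideg_part i j c"
  by (intro ext) (simp add: symb_canon[OF d3] bideg_part_def)

end

section \<open>Homotopy classes indexed by coordinates\<close>

context zigzag_complex
begin

abbreviation "CM i j \<equiv> chain_maps A X (Y i j)"

text \<open>A chain map is a family of functions and does not come with a matrix, so one is chosen;
  \<open>map_symb_chain\<close> shows that the choice does not matter.\<close>

definition map_symb :: "int \<Rightarrow> int \<Rightarrow> (int \<Rightarrow> (int \<Rightarrow> 'a) \<Rightarrow> int \<Rightarrow> 'a) \<Rightarrow> int \<Rightarrow> int \<Rightarrow> int \<Rightarrow> complex" where
  "map_symb i j f = symb d i j (SOME m. supp d i j m \<and> cocyc d i j m \<and> f = chain i j m)"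

lemma map_symb_chain:
  assumes "supp d i j m" "cocyc d i j m"
  shows "map_symb i j (chain i j m) = symb d i j m"
proof -
  let ?P = "\<lambda>m'. supp d i j m' \<and> cocyc d i j m' \<and> chain i j m = chain i j m'"
  define m' where "m' = (SOME m'. ?P m')"
  have "?P m" using assms by simp
  from someI[of ?P, OF this] have "?P m'" unfolding m'_def .
  then have "chain i j m = chain i j m'" by (rule conjunct2[OF conjunct2])
  from fun_cong[OF this] have "hom_at i j n (m n) = hom_at i j n (m' n)" for n unfolding chain_def .
  then have "\<forall>x\<in>MC (v n). hom_at i j n (m n) x = hom_at i j n (m' n) x" for n by simp
  then have okeq: "adm d i j n k l \<Longrightarrow> m n k l = m' n k l" for n k l unfolding hom_at_eq_iff by blast
  have "symb d i j m = symb d i j m'" by (intro ext symb_cong[OF d3] okeq)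
  then show ?thesis unfolding map_symb_def m'_def by simp
qed

lemma CM_cases:
  assumes "f \<in> CM i j"
  obtains m where "supp d i j m" "cocyc d i j m" "f = chain i j m" "map_symb i j f = symb d i j m"
  using assms map_symb_chain unfolding chain_maps_chain by blast

lemma chain_CM: "supp d i j m \<Longrightarrow> cocyc d i j m \<Longrightarrow> chain i j m \<in> CM i j"
  unfolding chain_maps_chain by blast

lemma map_symb_bideg_coords: "f \<in> CM i j \<Longrightarrow> map_symb i j f \<in> bideg_coords d i j"
  by (metis CM_cases symb_bideg_coords[OF d3])

lemma rel_iff: "f \<in> CM i j \<Longrightarrow> g \<in> CM i j \<Longrightarrow> (f, g) \<in> htpy_rel A X (Y i j) \<longleftrightarrow> map_symb i j f = map_symb i j g"
proof -
  assume f: "f \<in> CM i j" and g: "g \<in> CM i j"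
  obtain m where m: "supp d i j m" "cocyc d i j m" "f = chain i j m" "map_symb i j f = symb d i j m" by (rule CM_cases[OF f])
  obtain m' where m': "supp d i j m'" "cocyc d i j m'" "g = chain i j m'" "map_symb i j g = symb d i j m'" by (rule CM_cases[OF g])
  have "(chain i j m, chain i j m') \<in> htpy_rel A X (Y i j) \<longleftrightarrow> symb d i j m = symb d i j m'"
    by (rule trans[OF htpy_iff[OF m(1) m'(1) m(2) m'(2)] nullh_iff_symb[OF d3 m(1) m'(1) m(2) m'(2)]])
  then show ?thesis unfolding m(4) m'(4) unfolding m(3) m'(3) .
qed

text \<open>Homotopy classes appear as fibres of \<open>map_symb\<close>, labelled by coordinates
  instead of representatives.\<close>

definition htpy_class :: "int \<Rightarrow> int \<Rightarrow> (int \<Rightarrow> int \<Rightarrow> int \<Rightarrow> complex) \<Rightarrow> (int \<Rightarrow> (int \<Rightarrow> 'a) \<Rightarrow> int \<Rightarrow> 'a) set" where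
  "htpy_class i j c = {g \<in> CM i j. map_symb i j g = c}"

lemma rel_class: "f \<in> CM i j \<Longrightarrow> htpy_rel A X (Y i j) `` {f} = htpy_class i j (map_symb i j f)"
proof -
  assume f: "f \<in> CM i j"
  have "(f, g) \<in> htpy_rel A X (Y i j) \<Longrightarrow> g \<in> CM i j" for g unfolding htpy_rel_def by blast
  then show ?thesis using rel_iff[OF f] unfolding htpy_class_def Image_singleton by (metis (mono_tags, lifting))
qed

lemma canon_chain: "c \<in> coord_fun d \<Longrightarrow> chain i j (canon d c i j) \<in> CM i j"
  by (intro chain_CM canon_supp[OF d3] canon_cocyc[OF d3])

lemma map_symb_canon: "c \<in> coord_fun d \<Longrightarrow> map_symb i j (chain i j (canon d c i j)) = bideg_part d i j c"
  by (simp add: map_symb_chain canon_supp[OF d3] canon_cocyc[OF d3] symb_canon_bideg_part[OF d3])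

lemma htpy_class_nonempty: "c \<in> bideg_coords d i j \<Longrightarrow> \<exists>f. f \<in> htpy_class i j c"
  unfolding htpy_class_def
  by (intro exI[of _ "chain i j (canon d c i j)"] CollectI conjI canon_chain[OF bideg_coords_coord_fun[OF d3]])
    (simp_all add: map_symb_canon[OF bideg_coords_coord_fun[OF d3]] bideg_part_id[OF d3])

lemma htpy_class_inj: "\<lbrakk>c \<in> bideg_coords d i j; c' \<in> bideg_coords d i j; htpy_class i j c = htpy_class i j c'\<rbrakk> \<Longrightarrow> c = c'"
  using htpy_class_nonempty[of c i j] unfolding htpy_class_def by blast

abbreviation "H i j \<equiv> Kb_Hom A X (Y i j)"

lemma carrier_H: "carrier (H i j) = htpy_class i j ` bideg_coords d i j"
proof -
  have "carrier (H i j) = CM i j // htpy_rel A X (Y i j)"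
    unfolding Kb_Hom_def using Kb_obj_X Kb_obj_Y by simp
  also have "\<dots> = (\<lambda>f. htpy_class i j (map_symb i j f)) ` CM i j"
    unfolding quotient_def using rel_class by auto
  also have "\<dots> = htpy_class i j ` bideg_coords d i j"
  proof -
    have "map_symb i j ` CM i j = bideg_coords d i j"
    proof (intro equalityI subsetI)
      fix c assume c: "c \<in> bideg_coords d i j"
      then obtain f where "f \<in> htpy_class i j c" using htpy_class_nonempty by blast
      then show "c \<in> map_symb i j ` CM i j" unfolding htpy_class_def by blast
    qed (use map_symb_bideg_coords in blast)
    then show ?thesis unfolding image_image[symmetric] by metis
  qed
  finally show ?thesis .
qed

lemma chain_add: "(\<lambda>n. \<lambda>x \<in> carrier (obj X n). chain i j m n x \<oplus>\<^bsub>obj (Y i j) n\<^esub> chain i j m' n x) = chain i j (\<lambda>n k l. m n k l + m' n k l)"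
proof (rule ext, rule ext)
  fix n x
  show "(\<lambda>x \<in> carrier (obj X n). chain i j m n x \<oplus>\<^bsub>obj (Y i j) n\<^esub> chain i j m' n x) x = chain i j (\<lambda>n k l. m n k l + m' n k l) n x"
  proof (cases "x \<in> MC (v n)")
    case True
    then show ?thesis unfolding chain_def hom_at_def obj_Y carrier_X using hom_add[OF bricks_Y True] by simp
  qed (simp add: chain_def hom_at_def hom_def carrier_X)
qed

lemma chain_smult: "(\<lambda>n. \<lambda>x \<in> carrier (obj X n). (a \<odot> \<one>) \<odot>\<^bsub>obj (Y i j) n\<^esub> chain i j m n x) = chain i j (\<lambda>n k l. a * m n k l)"
proof (rule ext, rule ext)
  fix n x
  show "(\<lambda>x \<in> carrier (obj X n). (a \<odot> \<one>) \<odot>\<^bsub>obj (Y i j) n\<^esub> chain i j m n x) x = chain i j (\<lambda>n k l. a * m n k l) n x"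
  proof (cases "x \<in> MC (v n)")
    case True
    then show ?thesis unfolding chain_def hom_at_def obj_Y carrier_X using hom_smult[OF bricks_Y True] by simp
  qed (simp add: chain_def hom_at_def hom_def carrier_X)
qed

lemma chain_zero: "(\<lambda>n. \<lambda>x \<in> carrier (obj X n). \<zero>\<^bsub>obj (Y i j) n\<^esub>) = chain i j (\<lambda>n k l. 0)"
proof (rule ext, rule ext)
  fix n x
  show "(\<lambda>x \<in> carrier (obj X n). \<zero>\<^bsub>obj (Y i j) n\<^esub>) x = chain i j (\<lambda>n k l. 0) n x"
  proof (cases "x \<in> MC (v n)")
    case True
    then show ?thesis unfolding chain_def hom_at_def obj_Y carrier_X using hom_zero[OF bricks_Y True] by simp
  qed (simp add: chain_def hom_at_def hom_def carrier_X)
qed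

lemma H_zero: "\<zero>\<^bsub>H i j\<^esub> = htpy_class i j (\<lambda>l k t. 0)"
proof -
  note s = supp_lin(4)[OF d3, of i j] cocyc_zero[OF d3, of i j]
  have "symb d i j (\<lambda>n k l. 0) = (\<lambda>l k t. 0)" by (intro ext) (rule symb_zero[OF d3])
  then show ?thesis unfolding Kb_Hom_def by (simp add: chain_zero rel_class[OF chain_CM[OF s]] map_symb_chain[OF s])
qed

text \<open>The sum of two classes is a union over all pairs of representatives; every pair yields
  the same class, and the union collapses because the classes are not empty.\<close>

lemma H_add:
  assumes "c \<in> bideg_coords d i j" "c' \<in> bideg_coords d i j"
  shows "htpy_class i j c \<oplus>\<^bsub>H i j\<^esub> htpy_class i j c' = htpy_class i j (\<lambda>l k t. c l k t + c' l k t)"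
proof -
  obtain f0 g0 where f0: "f0 \<in> htpy_class i j c" "g0 \<in> htpy_class i j c'" using htpy_class_nonempty assms by meson
  have "htpy_rel A X (Y i j) `` {\<lambda>n. \<lambda>x \<in> carrier (obj X n). f n x \<oplus>\<^bsub>obj (Y i j) n\<^esub> g n x} = htpy_class i j (\<lambda>l k t. c l k t + c' l k t)"
    if f: "f \<in> htpy_class i j c" and g: "g \<in> htpy_class i j c'" for f g
  proof -
    obtain m where m: "supp d i j m" "cocyc d i j m" "f = chain i j m" "map_symb i j f = symb d i j m"
      using f unfolding htpy_class_def by (blast elim: CM_cases)
    obtain m' where m': "supp d i j m'" "cocyc d i j m'" "g = chain i j m'" "map_symb i j g = symb d i j m'"
      using g unfolding htpy_class_def by (blast elim: CM_cases)
    note s = supp_lin(1)[OF d3 m(1) m'(1)] cocyc_lin(1)[OF d3 m(2) m'(2)]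
    have "symb d i j (\<lambda>n k l. m n k l + m' n k l) = (\<lambda>l k t. c l k t + c' l k t)"
      using f g m(4) m'(4) unfolding htpy_class_def by (intro ext) (simp add: symb_add[OF d3])
    then show ?thesis unfolding m(3) m'(3) chain_add rel_class[OF chain_CM[OF s]] map_symb_chain[OF s] by simp
  qed
  then show ?thesis unfolding Kb_Hom_def using f0
    by simp blast
qed

lemma H_smult:
  assumes "c \<in> bideg_coords d i j"
  shows "a \<odot>\<^bsub>H i j\<^esub> htpy_class i j c = htpy_class i j (\<lambda>l k t. a * c l k t)"
proof -
  obtain f0 where f0: "f0 \<in> htpy_class i j c" using htpy_class_nonempty assms by meson
  have "htpy_rel A X (Y i j) `` {\<lambda>n. \<lambda>x \<in> carrier (obj X n). (a \<odot> \<one>) \<odot>\<^bsub>obj (Y i j) n\<^esub> f n x} = htpy_class i j (\<lambda>l k t. a * c l k t)"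
    if f: "f \<in> htpy_class i j c" for f
  proof -
    obtain m where m: "supp d i j m" "cocyc d i j m" "f = chain i j m" "map_symb i j f = symb d i j m"
      using f unfolding htpy_class_def by (blast elim: CM_cases)
    note s = supp_lin(3)[OF d3 m(1), of a] cocyc_lin(3)[OF d3 m(2) m(2), of a]
    have "symb d i j (\<lambda>n k l. a * m n k l) = (\<lambda>l k t. a * c l k t)"
      using f m(4) unfolding htpy_class_def by (intro ext) (simp add: symb_smult[OF d3])
    then show ?thesis unfolding m(3) chain_smult rel_class[OF chain_CM[OF s]] map_symb_chain[OF s] by simp
  qed
  then show ?thesis unfolding Kb_Hom_def using f0
    by simp blast
qed

text \<open>The product of \<open>Kb_End\<close> is a \<open>finsum\<close> in this structure, which
  calls for a commutative and associative addition.\<close>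

lemma H_monoid: "abelian_monoid (H i j)"
proof (rule abelian_monoidI, unfold carrier_H H_zero)
  fix x y assume "x \<in> htpy_class i j ` bideg_coords d i j" "y \<in> htpy_class i j ` bideg_coords d i j"
  then obtain c c' where c: "c \<in> bideg_coords d i j" "x = htpy_class i j c" "c' \<in> bideg_coords d i j" "y = htpy_class i j c'" by blast
  show "x \<oplus>\<^bsub>H i j\<^esub> y \<in> htpy_class i j ` bideg_coords d i j"
    unfolding c H_add[OF c(1,3)] using bideg_coords_add[OF d3 c(1,3)] by blast
  show "x \<oplus>\<^bsub>H i j\<^esub> y = y \<oplus>\<^bsub>H i j\<^esub> x"
    unfolding c H_add[OF c(1,3)] H_add[OF c(3,1)] by (simp add: add.commute)
  show "htpy_class i j (\<lambda>l k t. 0) \<oplus>\<^bsub>H i j\<^esub> x = x"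
    unfolding c H_add[OF bideg_coords_zero[OF d3] c(1)] by simp
  fix z assume "z \<in> htpy_class i j ` bideg_coords d i j"
  then obtain c'' where c'': "c'' \<in> bideg_coords d i j" "z = htpy_class i j c''" by blast
  show "x \<oplus>\<^bsub>H i j\<^esub> y \<oplus>\<^bsub>H i j\<^esub> z = x \<oplus>\<^bsub>H i j\<^esub> (y \<oplus>\<^bsub>H i j\<^esub> z)"
    unfolding c c'' H_add[OF c(1,3)] H_add[OF c(3) c''(1)] H_add[OF bideg_coords_add[OF d3 c(1,3)] c''(1)]
      H_add[OF c(1) bideg_coords_add[OF d3 c(3) c''(1)]] by (simp add: add.assoc)
qed (use bideg_coords_zero[OF d3] in blast)

lemma H_finsum:
  assumes "finite S" "\<And>s. s \<in> S \<Longrightarrow> f s = htpy_class i j (c s)" "\<And>s. s \<in> S \<Longrightarrow> c s \<in> bideg_coords d i j"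
  shows "finsum (H i j) f S = htpy_class i j (\<lambda>l k t. \<Sum>s\<in>S. c s l k t) \<and> (\<lambda>l k t. \<Sum>s\<in>S. c s l k t) \<in> bideg_coords d i j"
  using assms
proof (induction S rule: finite_induct)
  interpret H: abelian_monoid "H i j" by (rule H_monoid)
  case empty
  then show ?case using bideg_coords_zero[OF d3] by (simp add: H_zero)
next
  interpret H: abelian_monoid "H i j" by (rule H_monoid)
  case (insert s S)
  have IH: "finsum (H i j) f S = htpy_class i j (\<lambda>l k t. \<Sum>s\<in>S. c s l k t)" "(\<lambda>l k t. \<Sum>s\<in>S. c s l k t) \<in> bideg_coords d i j"
    using insert by auto
  have s: "f s = htpy_class i j (c s)" "c s \<in> bideg_coords d i j" using insert.prems by auto
  have fs: "f s \<in> carrier (H i j)" "f \<in> S \<rightarrow> carrier (H i j)" using insert.prems unfolding carrier_H by auto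
  have "finsum (H i j) f (insert s S) = htpy_class i j (c s) \<oplus>\<^bsub>H i j\<^esub> htpy_class i j (\<lambda>l k t. \<Sum>s\<in>S. c s l k t)"
    using H.finsum_insert[OF insert(1,2) fs(2,1)] IH s by simp
  also have "\<dots> = htpy_class i j (\<lambda>l k t. c s l k t + (\<Sum>s\<in>S. c s l k t))" by (rule H_add[OF s(2) IH(2)])
  finally show ?case using bideg_coords_add[OF d3 s(2) IH(2)] insert(1,2) by simp
qed

text \<open>The image under \<open>\<lambda>g n. g (n + b)\<close> realises the homological shift
  [b]. Representatives may be replaced by the canonical ones without changing the symbol of the
  composite.\<close>

lemma H_comp:
  assumes c: "c \<in> coord_fun d" and c': "c' \<in> coord_fun d"
  shows "Kb_comp A X (Y i j) ((\<lambda>g n. g (n + b)) ` htpy_class (i - a) (j - b) (bideg_part d (i - a) (j - b) c')) (htpy_class a b (bideg_part d a b c)) =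
    htpy_class i j (symb d i j (mat_comp d b (canon d c' (i - a) (j - b)) (canon d c a b)))"
proof -
  let ?L = "symb d i j (mat_comp d b (canon d c' (i - a) (j - b)) (canon d c a b))"
  have "htpy_rel A X (Y i j) `` {\<lambda>n. compose (carrier (obj X n)) (g (n + b)) (f n)} = htpy_class i j ?L"
    if f: "f \<in> htpy_class a b (bideg_part d a b c)" and g: "g \<in> htpy_class (i - a) (j - b) (bideg_part d (i - a) (j - b) c')" for f g
  proof -
    obtain m where m: "supp d a b m" "cocyc d a b m" "f = chain a b m" "map_symb a b f = symb d a b m"
      using f unfolding htpy_class_def by (blast elim: CM_cases)
    obtain m' where m': "supp d (i - a) (j - b) m'" "cocyc d (i - a) (j - b) m'" "g = chain (i - a) (j - b) m'"
        "map_symb (i - a) (j - b) g = symb d (i - a) (j - b) m'"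
      using g unfolding htpy_class_def by (blast elim: CM_cases)
    let ?m = "trim d i j (mat_comp d b m' m)"
    have comp: "(\<lambda>n. compose (carrier (obj X n)) (g (n + b)) (f n)) = chain i j ?m"
    proof (rule ext, rule ext)
      fix n x
      show "compose (carrier (obj X n)) (g (n + b)) (f n) x = chain i j ?m n x"
      proof (cases "x \<in> MC (v n)")
        case True
        then show ?thesis unfolding m(3) m'(3) chain_def carrier_X hom_at_trim
          using mat_comp_fun[OF m(1) m'(1) True] by (simp add: compose_def)
      next
        case False
        then show ?thesis unfolding chain_def hom_at_def hom_def carrier_X by (simp add: compose_def)
      qed
    qed
    note s = trim_supp[OF d3, of i j "mat_comp d b m' m"] cocyc_mat_comp[OF m(1) m'(1) m(2) m'(2)]
    have "symb d i j ?m = symb d i j (mat_comp d b m' m)" by (rule symb_trim[OF d3])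
    also have "\<dots> = ?L"
    proof (rule symb_mat_comp_cong[OF m(1,2) canon_supp[OF d3 c] canon_cocyc[OF d3 c] m'(1,2) canon_supp[OF d3 c'] canon_cocyc[OF d3 c']])
      show "symb d a b m = symb d a b (canon d c a b)"
        using f m(4) symb_canon_bideg_part[OF d3 c] unfolding htpy_class_def by simp
      show "symb d (i - a) (j - b) m' = symb d (i - a) (j - b) (canon d c' (i - a) (j - b))"
        using g m'(4) symb_canon_bideg_part[OF d3 c'] unfolding htpy_class_def by simp
    qed
    finally show ?thesis unfolding comp rel_class[OF chain_CM[OF s]] map_symb_chain[OF s] by simp
  qed
  moreover obtain f0 where "f0 \<in> htpy_class a b (bideg_part d a b c)" using htpy_class_nonempty[OF bideg_part_bideg_coords[OF d3 c]] by blast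
  moreover obtain g0 where "g0 \<in> htpy_class (i - a) (j - b) (bideg_part d (i - a) (j - b) c')" using htpy_class_nonempty[OF bideg_part_bideg_coords[OF d3 c']] by blast
  ultimately show ?thesis unfolding Kb_comp_def by (simp add: image_image) blast
qed

definition one_coord :: "int \<Rightarrow> int \<Rightarrow> int \<Rightarrow> complex" where
  "one_coord l k t = (if aff_idx d l k t \<and> t = 0 then 1 else 0)"

lemma one_coord_coord_fun: "one_coord \<in> coord_fun d" by (auto simp: coord_fun_def one_coord_def)

lemma id_chain: "(\<lambda>n. \<lambda>x \<in> carrier (obj X n). x) = chain 0 0 (canon d one_coord 0 0)"
proof (rule ext, rule ext)
  fix n x
  show "(\<lambda>x \<in> carrier (obj X n). x) x = chain 0 0 (canon d one_coord 0 0) n x"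
  proof (cases "x \<in> MC (v n)")
    case True
    \<comment> \<open>The canonical cocycle of the unit has entries 0 at absent terms, where the
      identity matrix has 1; these positions are not admissible, so the maps agree.\<close>
    have to_id: "hom_at 0 0 n (canon d one_coord 0 0 n) = hom_at 0 0 n (\<lambda>k l. if k = l then 1 else 0)"
      unfolding hom_at_def
    proof (rule hom_cong)
      fix k l assume kl: "k \<in> I" "l \<in> I" and F: "F (v n k) (v (n + 0) l) (gshift (n + 0) l + 0 - gshift n k)"
      then have "adm d 0 0 n k l" by (simp add: adm_def)
      then show "canon d one_coord 0 0 n k l = (if k = l then 1 else 0)"
        using kl d3 unfolding canon_00[OF d3 one_coord_coord_fun]
        by (cases "k = 0"; cases "l = 0") (auto simp: adm_00[OF d3] adm_pp[OF d3] one_coord_def aff_idx_iff[OF d3] fin_idx_iff[OF d3])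
    qed
    have id_x: "hom_at 0 0 n (\<lambda>k l. if k = l then 1 else 0) x = x"
    proof (rule MC_eqI[of _ "v n"])
      show "hom_at 0 0 n (\<lambda>k l. if k = l then 1 else 0) x \<in> MC (v n)" using hom_at_MC[OF True, of 0 0] by simp
      fix l p q t assume l: "l \<in> I"
      have "\<kappa> (hom_at 0 0 n (\<lambda>k l. if k = l then 1 else 0) x l) p q t =
        (\<Sum>k\<in>I. (if k = l then 1 else 0) * \<kappa> (x k \<otimes> W (v n k) (v n l) (gshift n l - gshift n k)) p q t)"
        unfolding hom_at_def kappa_hom[OF True l] by simp
      also have "\<dots> = (\<Sum>k\<in>I. if k = l then \<kappa> (x l \<otimes> W (v n l) (v n l) 0) p q t else 0)"
        by (intro sum.cong refl) auto
      also have "\<dots> = \<kappa> (x l) p q t" using l C_left_mult[OF MC_C[OF True l]] by (simp add: sum.delta)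
      finally show "\<kappa> (hom_at 0 0 n (\<lambda>k l. if k = l then 1 else 0) x l) p q t = \<kappa> (x l) p q t" .
    qed (rule True)
    show ?thesis unfolding chain_def to_id id_x using True by (simp add: carrier_X)
  next
    case False then show ?thesis by (simp add: chain_def hom_at_def hom_def carrier_X)
  qed
qed

lemma Kb_id_htpy_class: "Kb_id A X = htpy_class 0 0 (bideg_part d 0 0 one_coord)"
proof -
  have "Kb_id A X = htpy_rel A X (Y 0 0) `` {chain 0 0 (canon d one_coord 0 0)}"
    unfolding Kb_id_def id_chain bishift_0 ..
  then show ?thesis unfolding rel_class[OF canon_chain[OF one_coord_coord_fun]] map_symb_canon[OF one_coord_coord_fun] .
qed

text \<open>The endomorphism with coordinates c, distributed over the bidegrees of the triples.
  Composed with \<open>coord\<close> it is the isomorphism from the affine zigzag algebra.\<close>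

definition end_elem :: "(int \<Rightarrow> int \<Rightarrow> int \<Rightarrow> complex) \<Rightarrow> int \<Rightarrow> int \<Rightarrow> (int \<Rightarrow> (int \<Rightarrow> 'a) \<Rightarrow> int \<Rightarrow> 'a) set" where
  "end_elem c i j = htpy_class i j (bideg_part d i j c)"

lemma end_elem_zero_iff: "c \<in> coord_fun d \<Longrightarrow> end_elem c i j = \<zero>\<^bsub>H i j\<^esub> \<longleftrightarrow> bideg_part d i j c = (\<lambda>l k t. 0)"
  unfolding end_elem_def H_zero using htpy_class_inj bideg_part_bideg_coords[OF d3] bideg_coords_zero[OF d3] by metis

lemma end_elem_support: "c \<in> coord_fun d \<Longrightarrow> {(i, j). end_elem c i j \<noteq> \<zero>\<^bsub>H i j\<^esub>} \<subseteq> bidegs d"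
proof
  fix p assume c: "c \<in> coord_fun d" and "p \<in> {(i, j). end_elem c i j \<noteq> \<zero>\<^bsub>H i j\<^esub>}"
  then obtain i j where p: "p = (i, j)" "bideg_part d i j c \<noteq> (\<lambda>l k t. 0)" using end_elem_zero_iff by auto
  then obtain l k t where "bideg_part d i j c l k t \<noteq> 0" by (auto simp: fun_eq_iff)
  then have "bideg d l k t = (i, j)" "aff_idx d l k t" using bideg_part_bideg_coords[OF d3 c, of i j] unfolding bideg_coords_def[OF d3] by blast+
  then show "p \<in> bidegs d" using bideg_bidegs[OF d3] p by metis
qed

lemma finite_bidegs: "finite (bidegs d)" by (simp add: bidegs_def[OF d3])

lemma End_carrier: "carrier (Kb_End A X) = end_elem ` coord_fun d"
proof (intro equalityI subsetI)
  fix G assume "G \<in> carrier (Kb_End A X)"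
  then have "\<forall>i j. G i j \<in> htpy_class i j ` bideg_coords d i j" unfolding Kb_End_def Let_def by (simp add: carrier_H)
  then obtain cc where cc: "\<And>i j. cc i j \<in> bideg_coords d i j" "\<And>i j. G i j = htpy_class i j (cc i j)" unfolding image_iff by metis
  \<comment> \<open>Each triple has exactly one bidegree, so the components in all bidegrees glue to
    a single coordinate function.\<close>
  let ?c = "\<lambda>l k t. case bideg d l k t of (i, j) \<Rightarrow> cc i j l k t"
  have "?c \<in> coord_fun d" using cc(1) unfolding bideg_coords_def[OF d3] coord_fun_def by (auto split: prod.splits)
  moreover have R: "bideg_part d i j ?c = cc i j" for i j
  proof (intro ext)
    fix l k t
    have e: "cc i j l k t = (if bideg d l k t = (i, j) then cc i j l k t else 0)"
      using fun_cong[OF fun_cong[OF fun_cong[OF bideg_part_id[OF d3 cc(1)[of i j]]]], of l k t] unfolding bideg_part_def[OF d3] by (rule sym)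
    show "bideg_part d i j ?c l k t = cc i j l k t"
    proof (cases "bideg d l k t = (i, j)")
      case False
      then have "cc i j l k t = 0" by (subst e) simp
      with False show ?thesis by (simp add: bideg_part_def[OF d3])
    qed (simp add: bideg_part_def[OF d3])
  qed
  moreover have "G = end_elem ?c" by (rule ext, rule ext) (simp only: end_elem_def R cc(2))
  ultimately show "G \<in> end_elem ` coord_fun d" by blast
next
  fix G assume "G \<in> end_elem ` coord_fun d"
  then obtain c where c: "c \<in> coord_fun d" "G = end_elem c" by blast
  then have "\<forall>i j. G i j \<in> carrier (H i j)" unfolding carrier_H end_elem_def using bideg_part_bideg_coords[OF d3] by blast
  moreover have "finite {(i, j). G i j \<noteq> \<zero>\<^bsub>H i j\<^esub>}"
    using end_elem_support[OF c(1)] finite_bidegs finite_subset unfolding c(2) by blast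
  ultimately show "G \<in> carrier (Kb_End A X)" unfolding Kb_End_def Let_def by simp
qed

lemma end_elem_inj: "inj_on end_elem (coord_fun d)"
proof (rule inj_onI)
  fix c c' assume c: "c \<in> coord_fun d" "c' \<in> coord_fun d" and eq: "end_elem c = end_elem c'"
  have bideg_part: "bideg_part d i j c = bideg_part d i j c'" for i j
    using fun_cong[OF fun_cong[OF eq]] htpy_class_inj[OF bideg_part_bideg_coords[OF d3 c(1)] bideg_part_bideg_coords[OF d3 c(2)]] unfolding end_elem_def by blast
  show "c = c'"
  proof (intro ext)
    fix l k t
    obtain i j where "bideg d l k t = (i, j)" by fastforce
    then show "c l k t = c' l k t" using bideg_part[of i j] unfolding bideg_part_def[OF d3] fun_eq_iff by (metis (full_types))
  qed
qed

lemma bideg_part_lin: "bideg_part d i j (\<lambda>l k t. c l k t + c' l k t) = (\<lambda>l k t. bideg_part d i j c l k t + bideg_part d i j c' l k t)"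
  "bideg_part d i j (\<lambda>l k t. a * c l k t) = (\<lambda>l k t. a * bideg_part d i j c l k t)"
  by (auto simp: bideg_part_def[OF d3] fun_eq_iff)

lemma end_elem_add:
  assumes "c \<in> coord_fun d" "c' \<in> coord_fun d"
  shows "end_elem c \<oplus>\<^bsub>Kb_End A X\<^esub> end_elem c' = end_elem (\<lambda>l k t. c l k t + c' l k t)"
proof -
  have "end_elem c i j \<oplus>\<^bsub>H i j\<^esub> end_elem c' i j = end_elem (\<lambda>l k t. c l k t + c' l k t) i j" for i j
    unfolding end_elem_def H_add[OF bideg_part_bideg_coords[OF d3 assms(1)] bideg_part_bideg_coords[OF d3 assms(2)]] bideg_part_lin ..
  then show ?thesis unfolding Kb_End_def Let_def by (simp add: fun_eq_iff)
qed

lemma end_elem_smult: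
  assumes "c \<in> coord_fun d"
  shows "a \<odot>\<^bsub>Kb_End A X\<^esub> end_elem c = end_elem (\<lambda>l k t. a * c l k t)"
proof -
  have "a \<odot>\<^bsub>H i j\<^esub> end_elem c i j = end_elem (\<lambda>l k t. a * c l k t) i j" for i j
    unfolding end_elem_def H_smult[OF bideg_part_bideg_coords[OF d3 assms]] bideg_part_lin ..
  then show ?thesis unfolding Kb_End_def Let_def by (simp add: fun_eq_iff)
qed

lemma end_elem_one: "\<one>\<^bsub>Kb_End A X\<^esub> = end_elem one_coord"
proof -
  have "bideg_part d i j one_coord = (\<lambda>l k t. 0)" if "\<not> (i = 0 \<and> j = 0)" for i j
    using that by (auto simp: bideg_part_def[OF d3] one_coord_def bideg_def fun_eq_iff)
  then have "(if i = 0 \<and> j = 0 then Kb_id A X else \<zero>\<^bsub>H i j\<^esub>) = end_elem one_coord i j" for i j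
    unfolding Kb_id_htpy_class H_zero end_elem_def by auto
  then show ?thesis unfolding Kb_End_def Let_def by (simp add: fun_eq_iff)
qed

text \<open>The order is kept: the left factor is the map applied last, just as the left part of a
  path is traversed last.\<close>

lemma end_elem_mult:
  assumes c: "c \<in> coord_fun d" and c': "c' \<in> coord_fun d"
  shows "end_elem c' \<otimes>\<^bsub>Kb_End A X\<^esub> end_elem c = end_elem (coord_mult d c' c)"
proof -
  let ?S = "{(a, b). end_elem c a b \<noteq> \<zero>\<^bsub>H a b\<^esub>}"
  have fin: "finite ?S" using end_elem_support[OF c] finite_bidegs finite_subset by blast
  have "finsum (H i j) (\<lambda>(a, b). Kb_comp A X (Y i j) ((\<lambda>g n. g (n + b)) ` end_elem c' (i - a) (j - b)) (end_elem c a b)) ?S = end_elem (coord_mult d c' c) i j"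
    for i j
  proof -
    let ?L = "\<lambda>(a, b). symb d i j (mat_comp d b (canon d c' (i - a) (j - b)) (canon d c a b))"
    have "finsum (H i j) (\<lambda>(a, b). Kb_comp A X (Y i j) ((\<lambda>g n. g (n + b)) ` end_elem c' (i - a) (j - b)) (end_elem c a b)) ?S =
      htpy_class i j (\<lambda>l k t. \<Sum>s\<in>?S. ?L s l k t)"
    proof (rule conjunct1[OF H_finsum[OF fin]])
      fix s assume "s \<in> ?S"
      show "?L s \<in> bideg_coords d i j" by (cases s) (simp add: symb_bideg_coords[OF d3])
      show "(\<lambda>(a, b). Kb_comp A X (Y i j) ((\<lambda>g n. g (n + b)) ` end_elem c' (i - a) (j - b)) (end_elem c a b)) s = htpy_class i j (?L s)"
        unfolding end_elem_def by (cases s) (simp add: H_comp[OF c c'])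
    qed
    also have "(\<lambda>l k t. \<Sum>s\<in>?S. ?L s l k t) = bideg_part d i j (coord_mult d c' c)"
    proof (intro ext)
      fix l k t
      \<comment> \<open>The product sums over the bidegrees with a nonzero component; the others
        among the five contribute zero matrices, by \<open>canon_outside\<close>.\<close>
      have "(\<Sum>s\<in>?S. ?L s l k t) = (\<Sum>s\<in>bidegs d. ?L s l k t)"
      proof (rule sum.mono_neutral_left[OF finite_bidegs end_elem_support[OF c]], rule ballI)
        fix s assume s: "s \<in> bidegs d - ?S"
        obtain a b where ab: "s = (a, b)" by fastforce
        then have rs0: "bideg_part d a b c = (\<lambda>l k t. 0)" using s end_elem_zero_iff[OF c] by auto
        have "canon d c a b n k l = 0" for n k l
        proof (rule canon_outside[OF d3 c])
          fix l k t assume "bideg d l k t = (a, b)"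
          then show "c l k t = 0" using fun_cong[OF fun_cong[OF fun_cong[OF rs0]], of l k t] by (simp add: bideg_part_def[OF d3])
        qed
        then have "mat_comp d b (canon d c' (i - a) (j - b)) (canon d c a b) n k l = 0" for n k l
          by (rule mat_comp_zero1[OF d3])
        then show "?L s l k t = 0" using ab by (simp add: symb_def)
      qed
      also have "\<dots> = bideg_part d i j (coord_mult d c' c) l k t"
      proof (cases "aff_idx d l k t \<and> bideg d l k t = (i, j)")
        case True
        then have "(\<Sum>(a, b)\<in>bidegs d. symb d i j (mat_comp d b (canon d c' (i - a) (j - b)) (canon d c a b)) l k t) = coord_mult d c' c l k t"
          by (intro symb_mat_comp[OF d3 c c']) auto
        then show ?thesis using True by (simp add: bideg_part_def[OF d3] case_prod_unfold)
      next
        case False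
        then have "?L s l k t = 0" for s by (cases s) (auto simp: symb_def)
        moreover have "bideg_part d i j (coord_mult d c' c) l k t = 0" using False by (auto simp: bideg_part_def[OF d3] coord_mult_def)
        ultimately show ?thesis by simp
      qed
      finally show "(\<Sum>s\<in>?S. ?L s l k t) = bideg_part d i j (coord_mult d c' c) l k t" .
    qed
    finally show ?thesis by (simp add: end_elem_def)
  qed
  then show ?thesis unfolding Kb_End_def Let_def by (simp add: fun_eq_iff)
qed

end

section \<open>The complexes of the theorem\<close>

context
  fixes d :: nat
  assumes d3: "d \<ge> 3"
begin

abbreviation "Zf \<equiv> finite_zigzag d"
abbreviation "Xc \<equiv> csum {0..<int d} (X_cplx d)"

lemma finite_zigzag_coords: "zigzag_coords Zf d (coord d)"
proof -
  interpret Z: ring Zf by (rule ring_finite[OF d3])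
  have cA: "x \<in> carrier (affine_zigzag d)" if "x \<in> carrier Zf" for x
    using that by (simp add: finite_carrier[OF d3])
  have cF: "fin_idx d p q t" if "x \<in> carrier Zf" "coord d x p q t \<noteq> 0" for x p q t
    using that unfolding finite_carrier[OF d3] by blast
  show ?thesis
  proof (unfold_locales)
    show "d \<ge> 3" by (rule d3)
    show "\<And>x p q t. x \<in> carrier Zf \<Longrightarrow> coord d x p q t \<noteq> 0 \<Longrightarrow> fin_idx d p q t" by (rule cF)
    show "\<And>x y. x \<in> carrier Zf \<Longrightarrow> y \<in> carrier Zf \<Longrightarrow> coord d x = coord d y \<Longrightarrow> x = y"
      using coord_inj[OF d3] cA by blast
    show "\<exists>x\<in>carrier Zf. coord d x = c" if "\<And>p q t. c p q t \<noteq> 0 \<Longrightarrow> fin_idx d p q t" for c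
    proof -
      have c: "c \<in> coord_fun d" using that by (auto simp: coord_fun_def fin_idx_aff_idx[OF d3])
      then have "of_coord d c \<in> carrier Zf" using that by (simp add: finite_carrier[OF d3] of_coord_closed[OF d3] coord_of_coord[OF d3])
      then show ?thesis using coord_of_coord[OF d3 c] by blast
    qed
    show "coord d (x \<oplus>\<^bsub>Zf\<^esub> y) p q t = coord d x p q t + coord d y p q t" if "x \<in> carrier Zf" "y \<in> carrier Zf" for x y p q t
      using coord_add[OF d3 cA[OF that(1)] cA[OF that(2)]] by (simp add: finite_sel(5)[OF d3])
    show "coord d (x \<otimes>\<^bsub>Zf\<^esub> y) p q t =
      (if t = 0 \<and> q = p then coord d x p p 0 * coord d y p p 0
       else if t = 1 then coord d x p p 0 * coord d y p q 1 + coord d x p q 1 * coord d y q q 0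
       else if t = 2 \<and> q = p then coord d x p p 0 * coord d y p p 2 + coord d x p p 2 * coord d y p p 0
         + coord d x p (p - 1) 1 * coord d y (p - 1) p 1 + coord d x p (p + 1) 1 * coord d y (p + 1) p 1 else 0)"
      if "x \<in> carrier Zf" "y \<in> carrier Zf" for x y p q t
      using coord_mult_finite[OF d3 cF[OF that(1)] cF[OF that(2)], where p = p and q = q and t = t] coord_mult[OF d3 cA[OF that(1)] cA[OF that(2)]]
      by (simp add: finite_sel(2)[OF d3])
    show "a \<odot>\<^bsub>Zf\<^esub> x \<in> carrier Zf" if "x \<in> carrier Zf" for x a
    proof -
      have "a \<odot>\<^bsub>affine_zigzag d\<^esub> x \<in> carrier (affine_zigzag d)" by (rule affine_smult_closed[OF d3 cA[OF that]])
      then show ?thesis using cF[OF that]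
        unfolding finite_sel(6)[OF d3] finite_carrier[OF d3] by (simp add: coord_smult[OF d3 cA[OF that]])
    qed
    show "coord d (a \<odot>\<^bsub>Zf\<^esub> x) p q t = a * coord d x p q t" if "x \<in> carrier Zf" for x a p q t
      by (simp add: finite_sel(6)[OF d3] coord_smult[OF d3 cA[OF that]])
    show "homog Zf n = {x \<in> carrier Zf. \<forall>p q t. coord d x p q t \<noteq> 0 \<longrightarrow> t = n}" for n
      by (rule finite_homog[OF d3])
  qed
qed

interpretation Z: zigzag_coords Zf d "coord d" by (rule finite_zigzag_coords)

lemma pth_W:
  assumes "is_path d p" "fin_idx d a b t" "path_coord d (path_elem p) = (\<lambda>p' q' t'. if p' = a \<and> q' = b \<and> t' = t then 1 else 0)"
  shows "pth d p = Z.W a b t"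
proof (rule coord_inj[OF d3])
  show pA: "pth d p \<in> carrier (affine_zigzag d)" by (rule pth_closed[OF d3 assms(1)])
  show "Z.W a b t \<in> carrier (affine_zigzag d)" using Z.W_closed[of a b t] by (simp add: finite_carrier[OF d3])
  show "coord d (pth d p) = coord d (Z.W a b t)"
    unfolding coord_pth[OF d3 assms(1)] assms(3) using assms(2) by (intro ext) (simp add: Z.kappa_W)
qed

lemma pth_vertex:
  assumes "1 \<le> i" "i < int d" shows "pth d [i] = Z.W i i 0"
proof (rule pth_W)
  show "is_path d [i]" using assms by (simp add: is_path_def)
  show "fin_idx d i i 0" using assms by (simp add: fin_idx_iff[OF d3])
  show "path_coord d (path_elem [i]) = (\<lambda>p' q' t'. if p' = i \<and> q' = i \<and> t' = 0 then 1 else 0)"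
    using assms by (auto simp: fun_eq_iff path_coord_def path_elem_def aff_idx_iff[OF d3])
qed

lemma pth_arrow:
  assumes "1 \<le> i" "i + 1 < int d" shows "pth d [i + 1, i] = Z.W (i + 1) i 1"
proof (rule pth_W)
  show "is_path d [i + 1, i]" using assms by (simp add: is_path_def)
  show "fin_idx d (i + 1) i 1" using assms by (simp add: fin_idx_iff[OF d3])
  show "path_coord d (path_elem [i + 1, i]) = (\<lambda>p' q' t'. if p' = i + 1 \<and> q' = i \<and> t' = 1 then 1 else 0)"
    using assms by (auto simp: fun_eq_iff path_coord_def path_elem_def aff_idx_iff[OF d3])
qed

lemma bricks_Xc: "Z.bricks (\<lambda>k. obj (X_cplx d k) n) (vert d n) (gshift n)"
  unfolding Z.bricks_def
proof
  fix k assume k: "k \<in> {0..<int d}"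
  show "Z.brick (obj (X_cplx d k) n) (vert d n k) (gshift n k)"
  proof (cases "k = 0")
    case True
    show ?thesis
    proof (cases "0 \<le> n \<and> n \<le> int d - 2")
      case in_range: True
      have o: "obj (X_cplx d k) n = mshift (n + 1) (left_mod Zf (Z.W (int d - 1 - n) (int d - 1 - n) 0))"
        using True in_range by (simp add: X_cplx_def X_zero_def Let_def pth_vertex)
      show ?thesis unfolding o using Z.brick_mshift[OF Z.brick_left_mod, of "n + 1" "int d - 1 - n"] True in_range
        by (simp add: vert_def gshift_def)
    next
      case False
      then have o: "obj (X_cplx d k) n = zero_module Zf" using True by (auto simp: X_cplx_def X_zero_def Let_def)
      show ?thesis unfolding o using Z.brick_zero_module False True by (auto simp: vert_def)
    qed
  next
    case False
    show ?thesis
    proof (cases "n = 0")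
      case True
      have o: "obj (X_cplx d k) n = left_mod Zf (Z.W k k 0)"
        using False True k by (simp add: X_cplx_def X_pos_def Let_def pth_vertex)
      show ?thesis unfolding o using Z.brick_left_mod False True by (simp add: vert_def gshift_def)
    next
      case n: False
      then have o: "obj (X_cplx d k) n = zero_module Zf" using False by (auto simp: X_cplx_def X_pos_def Let_def)
      show ?thesis unfolding o using Z.brick_zero_module False n by (auto simp: vert_def)
    qed
  qed
qed

text \<open>Successive terms of X_0 have the vertices d - 1 - n, d - 2 - n and the shifts n + 1, n +
  2, so the basis element between them is the arrow of the differential and the entry is 1.\<close>

lemma diff_Xc: "diff Xc n = Z.hom (vert d n) (gshift n) (vert d (n + 1)) (gshift (n + 1)) (diff_mat d n)"
proof
  fix x
  have carr: "carrier (msum {0..<int d} (\<lambda>i. obj (X_cplx d i) n)) = Z.MC (vert d n)"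
    by (rule Z.M_carrier[OF bricks_Xc])
  show "diff Xc n x = Z.hom (vert d n) (gshift n) (vert d (n + 1)) (gshift (n + 1)) (diff_mat d n) x"
  proof (cases "x \<in> Z.MC (vert d n)")
    case False
    then show ?thesis by (simp add: csum_def carr Z.hom_def)
  next
    case x: True
    have d0: "diff Xc n x = (\<lambda>i\<in>{0..<int d}. diff (X_cplx d i) n (x i))"
      using x by (simp add: csum_def carr)
    have xl: "x l \<in> carrier (obj (X_cplx d l) n)" if "l \<in> {0..<int d}" for l
      using Z.MC_C[OF x that] bricks_Xc that unfolding Z.bricks_def Z.brick_def by blast
    have z: "\<zero>\<^bsub>obj (X_cplx d l) m\<^esub> = \<zero>\<^bsub>Zf\<^esub>" if "l \<in> {0..<int d}" for l m
      using bricks_Xc[of m] that unfolding Z.bricks_def Z.brick_def by blast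
    have val: "diff (X_cplx d l) n (x l) =
      (if l = 0 \<and> 0 \<le> n \<and> n < int d - 2 then x 0 \<otimes>\<^bsub>Zf\<^esub> Z.W (int d - 1 - n) (int d - 2 - n) 1 else \<zero>\<^bsub>Zf\<^esub>)"
      if l: "l \<in> {0..<int d}" for l
    proof (cases "l = 0")
      case True
      have ar: "pth d [int d - n - 1, int d - n - 2] = Z.W (int d - 1 - n) (int d - 2 - n) 1" if "0 \<le> n" "n < int d - 2"
        using pth_arrow[of "int d - n - 2"] that by (simp add: algebra_simps)
      have ob: "obj (X_cplx d 0) = (\<lambda>n. if 0 \<le> n \<and> n \<le> int d - 2 then mshift (n + 1) (Ze d (int d - 1 - n)) else zero_module Zf)"
        by (simp add: X_cplx_def X_zero_def Let_def)
      have "diff (X_cplx d 0) n = (\<lambda>x \<in> carrier (obj (X_cplx d 0) n).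
         if 0 \<le> n \<and> n < int d - 2 then x \<otimes>\<^bsub>Zf\<^esub> pth d [int d - n - 1, int d - n - 2]
         else \<zero>\<^bsub>obj (X_cplx d 0) (n + 1)\<^esub>)"
        unfolding ob by (simp add: X_cplx_def X_zero_def Let_def)
      then show ?thesis using True xl[OF l] z[OF l] ar by auto
    next
      case False
      have ob: "obj (X_cplx d l) = (\<lambda>n. if n = 0 then Ze d l else zero_module Zf)"
        using False by (simp add: X_cplx_def X_pos_def Let_def)
      have "diff (X_cplx d l) n = (\<lambda>x \<in> carrier (obj (X_cplx d l) n). \<zero>\<^bsub>obj (X_cplx d l) (n + 1)\<^esub>)"
        unfolding ob using False by (simp add: X_cplx_def X_pos_def Let_def)
      then show ?thesis using False xl[OF l] z[OF l] by simp
    qed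
    have hl: "Z.hom (vert d n) (gshift n) (vert d (n + 1)) (gshift (n + 1)) (diff_mat d n) x l = diff (X_cplx d l) n (x l)"
      if l: "l \<in> {0..<int d}" for l
    proof (rule Z.kappa_eqI)
      have x0: "x 0 \<in> carrier Zf" using Z.MC_carrier[OF x, of 0] d3 by simp
      show "Z.hom (vert d n) (gshift n) (vert d (n + 1)) (gshift (n + 1)) (diff_mat d n) x l \<in> carrier Zf"
        by (rule Z.MC_carrier[OF Z.hom_MC[OF x] l])
      show "diff (X_cplx d l) n (x l) \<in> carrier Zf" unfolding val[OF l] using x0 by simp
      fix p q t
      have "coord d (Z.hom (vert d n) (gshift n) (vert d (n + 1)) (gshift (n + 1)) (diff_mat d n) x l) p q t =
        (\<Sum>k\<in>{0..<int d}. diff_mat d n k l * coord d (x k \<otimes>\<^bsub>Zf\<^esub> Z.W (vert d n k) (vert d (n + 1) l) (gshift (n + 1) l - gshift n k)) p q t)"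
        by (rule Z.kappa_hom[OF x l])
      also have "\<dots> = diff_mat d n 0 l * coord d (x 0 \<otimes>\<^bsub>Zf\<^esub> Z.W (vert d n 0) (vert d (n + 1) l) (gshift (n + 1) l - gshift n 0)) p q t"
        by (rule sum_one[OF d3]) (use d3 in \<open>auto simp: diff_mat_def[OF d3]\<close>)
      also have "\<dots> = coord d (diff (X_cplx d l) n (x l)) p q t"
        unfolding val[OF l] by (auto simp: diff_mat_def[OF d3] vert_def gshift_def Z.kappa_zero algebra_simps)
      finally show "coord d (Z.hom (vert d n) (gshift n) (vert d (n + 1)) (gshift (n + 1)) (diff_mat d n) x l) p q t =
        coord d (diff (X_cplx d l) n (x l)) p q t" .
    qed
    show ?thesis
    proof
      fix l
      show "diff Xc n x l = Z.hom (vert d n) (gshift n) (vert d (n + 1)) (gshift (n + 1)) (diff_mat d n) x l"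
      proof (cases "l \<in> {0..<int d}")
        case True
        then show ?thesis unfolding d0 hl[OF True] by simp
      next
        case False
        then show ?thesis unfolding d0 using Z.hom_MC[OF x] by (auto simp: Z.MC_def PiE_iff extensional_def)
      qed
    qed
  qed
qed

lemma zigzag_complex_Xc: "zigzag_complex Zf d (coord d) Xc (\<lambda>n k. obj (X_cplx d k) n)"
proof (intro zigzag_complex.intro zigzag_complex_axioms.intro finite_zigzag_coords)
  show "obj Xc n = msum {0..<int d} (\<lambda>k. obj (X_cplx d k) n)" for n by (simp add: csum_def)
qed (rule bricks_Xc, rule diff_Xc)

interpretation E: zigzag_complex Zf d "coord d" Xc "\<lambda>n k. obj (X_cplx d k) n" by (rule zigzag_complex_Xc)

text \<open>Both \<open>coord\<close> and \<open>end_elem\<close> are bijective, with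
  \<open>coord_fun\<close> in the middle, and both turn the product of their algebra into
  \<open>coord_mult\<close>.\<close>

lemma end_elem_coord_iso: "(\<lambda>x. E.end_elem (coord d x)) \<in> ring_iso (affine_zigzag d) (Kb_End Zf Xc)"
proof (rule ring_iso_memI)
  note coord_fun = coord_coord_fun[OF d3]
  fix x y assume x: "x \<in> carrier (affine_zigzag d)" and y: "y \<in> carrier (affine_zigzag d)"
  show "E.end_elem (coord d x) \<in> carrier (Kb_End Zf Xc)" unfolding E.End_carrier using coord_fun by blast
  show "E.end_elem (coord d (x \<otimes>\<^bsub>affine_zigzag d\<^esub> y)) = E.end_elem (coord d x) \<otimes>\<^bsub>Kb_End Zf Xc\<^esub> E.end_elem (coord d y)"
    unfolding coord_mult[OF d3 x y] by (rule E.end_elem_mult[OF coord_fun coord_fun, symmetric])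
  show "E.end_elem (coord d (x \<oplus>\<^bsub>affine_zigzag d\<^esub> y)) = E.end_elem (coord d x) \<oplus>\<^bsub>Kb_End Zf Xc\<^esub> E.end_elem (coord d y)"
    unfolding coord_add[OF d3 x y] by (rule E.end_elem_add[OF coord_fun coord_fun, symmetric])
next
  have "coord d \<one>\<^bsub>affine_zigzag d\<^esub> = E.one_coord" unfolding coord_one[OF d3] by (intro ext) (simp add: E.one_coord_def)
  then show "E.end_elem (coord d \<one>\<^bsub>affine_zigzag d\<^esub>) = \<one>\<^bsub>Kb_End Zf Xc\<^esub>" by (simp add: E.end_elem_one)
next
  have "bij_betw (coord d) (carrier (affine_zigzag d)) (coord_fun d)"
    unfolding bij_betw_def
  proof
    show "inj_on (coord d) (carrier (affine_zigzag d))" by (rule inj_onI) (rule coord_inj[OF d3])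
    show "coord d ` carrier (affine_zigzag d) = coord_fun d"
    proof (intro equalityI subsetI)
      fix c assume "c \<in> coord_fun d"
      then show "c \<in> coord d ` carrier (affine_zigzag d)" using coord_of_coord[OF d3] of_coord_closed[OF d3] by (metis imageI)
    qed (use coord_coord_fun[OF d3] in blast)
  qed
  moreover have "bij_betw E.end_elem (coord_fun d) (carrier (Kb_End Zf Xc))"
    unfolding bij_betw_def E.End_carrier using E.end_elem_inj by blast
  ultimately show "bij_betw (\<lambda>x. E.end_elem (coord d x)) (carrier (affine_zigzag d)) (carrier (Kb_End Zf Xc))"
    using bij_betw_trans unfolding comp_def by blast
qed

text \<open>The constructed map starts at the affine algebra while the claim starts at the
  endomorphisms, so the inverse is taken; its linearity follows from that of the map.\<close>

lemma Kb_End_iso: "alg_isomorphic (Kb_End Zf Xc) (affine_zigzag d)"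
proof -
  let ?g = "\<lambda>x. E.end_elem (coord d x)"
  let ?f = "inv_into (carrier (affine_zigzag d)) ?g"
  have bij: "bij_betw ?g (carrier (affine_zigzag d)) (carrier (Kb_End Zf Xc))"
    using end_elem_coord_iso unfolding ring_iso_def by blast
  have "?f \<in> ring_iso (Kb_End Zf Xc) (affine_zigzag d)"
    by (rule ring_iso_set_sym[OF ring_affine[OF d3] end_elem_coord_iso])
  moreover have "?f (a \<odot>\<^bsub>Kb_End Zf Xc\<^esub> G) = a \<odot>\<^bsub>affine_zigzag d\<^esub> ?f G" if G: "G \<in> carrier (Kb_End Zf Xc)" for a G
  proof -
    have x: "?f G \<in> carrier (affine_zigzag d)" "?g (?f G) = G"
      using G inv_into_into[of G ?g "carrier (affine_zigzag d)"] f_inv_into_f[of G ?g "carrier (affine_zigzag d)"]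
      unfolding bij_betw_imp_surj_on[OF bij] by blast+
    have "a \<odot>\<^bsub>Kb_End Zf Xc\<^esub> G = ?g (a \<odot>\<^bsub>affine_zigzag d\<^esub> ?f G)"
      using E.end_elem_smult[OF coord_coord_fun[OF d3], of a "?f G"] x(2) unfolding coord_smult[OF d3 x(1)] by simp
    then show ?thesis
      using inv_into_f_f[OF bij_betw_imp_inj_on[OF bij] affine_smult_closed[OF d3 x(1)]] by simp
  qed
  ultimately show ?thesis unfolding alg_isomorphic_def by blast
qed

end

theorem proposition6p7:
  fixes d :: nat and r s :: int
  assumes "d \<ge> 3"
  shows "alg_isomorphic (Ev_End d r s (csum {0..<int d} (X_cplx d))) (affine_zigzag d)"
  unfolding Ev_End_def by (rule Kb_End_iso[OF assms])

end
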